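(* (1) For every ITRM-c-random real $y$ there is a real $x$ with $x\le_{\mathrm{ITRM}}y$ such that $x$ is neither ITRM-c-random nor ITRM-computable. (2) If $y$ is ITRM-c-random, $x\le_{\mathrm{ITRM}}y$, and $x\in S$ for some countable ITRM-decidable set $S$ of reals, then $x$ is ITRM-computable.
   Context: Reals are subsets of $\omega$. An infinite time register machine (ITRM) has finitely many registers, each holding a natural number, and runs a finite register-machine program in transfinite ordinal time; with an oracle $x\subseteq\omega$ it may test whether the content of a register belongs to $x$. At successor times it acts as an ordinary register machine; at limit times the active program line is the $\liminf$ of the earlier program lines, and each register holds the $\liminf$ of its earlier contents if that is finite, and $0$ otherwise. $P^x\downarrow=i$ means program $P$ with oracle $x$ halts with output $i$. $x\le_{\mathrm{ITRM}}y$ iff there is a program $P$ such that for every $i\in\omega$, $P^y(i)$ halts with output $1$ if $i\in x$ and $0$ otherwise; ITRM-computable means $\le_{\mathrm{ITRM}}\emptyset$. A set $X$ of reals is ITRM-decidable iff there is a program $P$ with $P^{w}\downarrow=1$ for $w\in X$ and $P^{w}\downarrow=0$ for $w\notin X$. A real is ITRM-c-random iff it lies in no meager ITRM-decidable set. *)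

theory Defs
  imports "HOL-Analysis.Analysis"
begin

text \<open>Instructions (Koepke's ITRM instruction set, with oracle query).
  Program lines are numbered 0,1,...; the machine halts when the active line
  is not a line of the program (e.g. after the last line).\<close>

datatype instr =
    Zero nat
  | Inc nat
  | Copy nat nat
  | JumpEq nat nat nat
  | OracleJump nat nat

type_synonym program = "instr list"
type_synonym config = "nat \<times> (nat \<Rightarrow> nat)"   (* active line, register contents *)

definition halted :: "program \<Rightarrow> config \<Rightarrow> bool" where
  "halted P c \<longleftrightarrow> length P \<le> fst c"

fun exec :: "nat set \<Rightarrow> instr \<Rightarrow> config \<Rightarrow> config" where
  "exec x (Zero n) (l, R) = (Suc l, R(n := 0))"
| "exec x (Inc n) (l, R) = (Suc l, R(n := Suc (R n)))"
| "exec x (Copy i j) (l, R) = (Suc l, R(j := R i))"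
| "exec x (JumpEq i j k) (l, R) = (if R i = R j then (k, R) else (Suc l, R))"
| "exec x (OracleJump i k) (l, R) = (if R i \<in> x then (k, R) else (Suc l, R))"

definition step :: "program \<Rightarrow> nat set \<Rightarrow> config \<Rightarrow> config" where
  "step P x c = (if halted P c then c else exec x (P ! fst c) c)"

text \<open>Time is represented by a well-order \<open>r\<close> (reflexive, as in HOL's
  well-order library).  \<open>lt r b a\<close>: b strictly precedes a.\<close>

definition lt :: "('a \<times> 'a) set \<Rightarrow> 'a \<Rightarrow> 'a \<Rightarrow> bool" where
  "lt r b a \<longleftrightarrow> (b, a) \<in> r \<and> b \<noteq> a"

definition liminf_is :: "('a \<times> 'a) set \<Rightarrow> 'a \<Rightarrow> ('a \<Rightarrow> nat) \<Rightarrow> nat \<Rightarrow> bool" where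
  "liminf_is r a v n \<longleftrightarrow>
     (\<exists>g. lt r g a \<and> (\<forall>b. (g, b) \<in> r \<and> lt r b a \<longrightarrow> n \<le> v b)) \<and>
     (\<forall>g. lt r g a \<longrightarrow> (\<exists>b. (g, b) \<in> r \<and> lt r b a \<and> v b = n))"

definition lim_val :: "('a \<times> 'a) set \<Rightarrow> 'a \<Rightarrow> ('a \<Rightarrow> nat) \<Rightarrow> nat" where
  "lim_val r a v = (if \<exists>n. liminf_is r a v n then (THE n. liminf_is r a v n) else 0)"

definition limit_config :: "('a \<times> 'a) set \<Rightarrow> 'a \<Rightarrow> ('a \<Rightarrow> config) \<Rightarrow> config" where
  "limit_config r a f = (lim_val r a (\<lambda>b. fst (f b)), (\<lambda>k. lim_val r a (\<lambda>b. snd (f b) k)))"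

definition is_succ_of :: "('a \<times> 'a) set \<Rightarrow> 'a \<Rightarrow> 'a \<Rightarrow> bool" where
  "is_succ_of r a b \<longleftrightarrow> lt r b a \<and> \<not> (\<exists>g. lt r b g \<and> lt r g a)"

text \<open>\<open>halting_run P x c0 r f\<close>: \<open>f\<close> is the complete computation of program \<open>P\<close>
  with oracle \<open>x\<close> from initial configuration \<open>c0\<close>, indexed by the
  well-ordered time \<open>r\<close> (an ordinal \<open>\<alpha>+1\<close>), which halts at the last time \<open>\<alpha>\<close>.\<close>

definition halting_run ::
  "program \<Rightarrow> nat set \<Rightarrow> config \<Rightarrow> ('a \<times> 'a) set \<Rightarrow> ('a \<Rightarrow> config) \<Rightarrow> bool" where
  "halting_run P x c0 r f \<longleftrightarrow>
     Well_order r \<and>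
     (\<exists>z m. z \<in> Field r \<and> m \<in> Field r \<and>
        (\<forall>a\<in>Field r. (z, a) \<in> r \<and> (a, m) \<in> r) \<and>
        f z = c0 \<and>
        (\<forall>a\<in>Field r. a \<noteq> z \<longrightarrow>
           (if (\<exists>b. is_succ_of r a b)
            then f a = step P x (f (THE b. is_succ_of r a b))
            else f a = limit_config r a f)) \<and>
        (\<forall>a\<in>Field r. a \<noteq> m \<longrightarrow> \<not> halted P (f a)) \<and>
        halted P (f m))"

text \<open>Runs are indexed by well-orders on \<open>nat set\<close>; every countable ordinal
  (indeed every ordinal of size at most continuum) is represented, and ITRM
  halting times are countable.  Output is register R_0.\<close>

definition halts_with :: "program \<Rightarrow> nat set \<Rightarrow> config \<Rightarrow> nat \<Rightarrow> bool" where
  "halts_with P x c0 i \<longleftrightarrow>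
     (\<exists>(r :: (nat set \<times> nat set) set) f m.
        halting_run P x c0 r f \<and> m \<in> Field r \<and> (\<forall>a\<in>Field r. (a, m) \<in> r) \<and>
        snd (f m) 0 = i)"

definition init_config :: "nat \<Rightarrow> config" where
  "init_config i = (0, (\<lambda>k. 0)(0 := i))"

definition itrm_comp :: "program \<Rightarrow> nat set \<Rightarrow> nat \<Rightarrow> nat \<Rightarrow> bool" where
  "itrm_comp P x i j \<longleftrightarrow> halts_with P x (init_config i) j"

definition itrm_comp0 :: "program \<Rightarrow> nat set \<Rightarrow> nat \<Rightarrow> bool" where
  "itrm_comp0 P x j \<longleftrightarrow> halts_with P x (init_config 0) j"

definition itrm_reducible :: "nat set \<Rightarrow> nat set \<Rightarrow> bool" where
  "itrm_reducible x y \<longleftrightarrow>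
     (\<exists>P. \<forall>i. itrm_comp P y i (if i \<in> x then 1 else 0))"

definition itrm_computable :: "nat set \<Rightarrow> bool" where
  "itrm_computable x \<longleftrightarrow> itrm_reducible x {}"

definition itrm_decidable :: "nat set set \<Rightarrow> bool" where
  "itrm_decidable X \<longleftrightarrow>
     (\<exists>P. \<forall>w. (w \<in> X \<longrightarrow> itrm_comp0 P w 1) \<and> (w \<notin> X \<longrightarrow> itrm_comp0 P w 0))"

definition cantor_open :: "nat set set \<Rightarrow> bool" where
  "cantor_open U \<longleftrightarrow> (\<forall>x\<in>U. \<exists>n. {z. z \<inter> {..<n} = x \<inter> {..<n}} \<subseteq> U)"

lemma restr_mono:
  assumes "(z::nat set) \<inter> {..<k} = x \<inter> {..<k}" and "n \<le> k"
  shows "z \<inter> {..<n} = x \<inter> {..<n}"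
proof -
  have e: "{..<k} \<inter> {..<n} = {..<n}" using assms(2) by auto
  have "z \<inter> {..<n} = (z \<inter> {..<k}) \<inter> {..<n}" "x \<inter> {..<n} = (x \<inter> {..<k}) \<inter> {..<n}"
    using e by (simp_all add: Int_assoc)
  then show ?thesis using assms(1) by simp
qed

lemma istopology_cantor_open: "istopology cantor_open"
proof -
  have inter: "cantor_open (S \<inter> T)" if S: "cantor_open S" and T: "cantor_open T" for S T
    unfolding cantor_open_def
  proof
    fix x assume x: "x \<in> S \<inter> T"
    obtain n where n: "{z. z \<inter> {..<n} = x \<inter> {..<n}} \<subseteq> S"
      using S x unfolding cantor_open_def by blast
    obtain m where m: "{z. z \<inter> {..<m} = x \<inter> {..<m}} \<subseteq> T"
      using T x unfolding cantor_open_def by blast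
    have "{z. z \<inter> {..<max n m} = x \<inter> {..<max n m}} \<subseteq> S \<inter> T"
    proof
      fix z assume "z \<in> {z. z \<inter> {..<max n m} = x \<inter> {..<max n m}}"
      then have h: "z \<inter> {..<max n m} = x \<inter> {..<max n m}" by simp
      have "z \<in> S" using n restr_mono[OF h, of n] by auto
      moreover have "z \<in> T" using m restr_mono[OF h, of m] by auto
      ultimately show "z \<in> S \<inter> T" by blast
    qed
    then show "\<exists>n. {z. z \<inter> {..<n} = x \<inter> {..<n}} \<subseteq> S \<inter> T" by blast
  qed
  have union: "cantor_open (\<Union>K)" if KS: "\<forall>S\<in>K. cantor_open S" for K
    unfolding cantor_open_def
  proof
    fix x assume "x \<in> \<Union>K"
    then obtain S where S: "S \<in> K" "x \<in> S" by blast
    then obtain n where "{z. z \<inter> {..<n} = x \<inter> {..<n}} \<subseteq> S"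
      using KS unfolding cantor_open_def by blast
    then have "{z. z \<inter> {..<n} = x \<inter> {..<n}} \<subseteq> \<Union>K" using S(1) by blast
    then show "\<exists>n. {z. z \<inter> {..<n} = x \<inter> {..<n}} \<subseteq> \<Union>K" by (rule exI)
  qed
  show ?thesis unfolding istopology_def
  proof (intro conjI allI impI)
    fix S T assume "cantor_open S" "cantor_open T"
    then show "cantor_open (S \<inter> T)" by (rule inter)
  next
    fix K :: "nat set set set" assume "\<forall>S\<in>K. cantor_open S"
    then show "cantor_open (\<Union>K)" by (rule union)
  qed
qed

text \<open>Cantor space \<open>2^\<omega>\<close> with the product topology, reals being subsets of \<open>\<omega>\<close>.\<close>
definition cantor_top :: "nat set topology" where
  "cantor_top = topology cantor_open"

lemma openin_cantor_top: "openin cantor_top = cantor_open"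
  unfolding cantor_top_def using istopology_cantor_open by (rule topology_inverse')

definition nowhere_dense :: "nat set set \<Rightarrow> bool" where
  "nowhere_dense X \<longleftrightarrow> cantor_top interior_of (cantor_top closure_of X) = {}"

definition meager :: "nat set set \<Rightarrow> bool" where
  "meager X \<longleftrightarrow> (\<exists>F :: nat \<Rightarrow> nat set set. (\<forall>n. nowhere_dense (F n)) \<and> X \<subseteq> (\<Union>n. F n))"

definition itrm_c_random :: "nat set \<Rightarrow> bool" where
  "itrm_c_random y \<longleftrightarrow> \<not> (\<exists>X. meager X \<and> itrm_decidable X \<and> y \<in> X)"

end

theory Submission
  imports Defs
begin

text \<open>The proof is forcing with finite binary strings. ITRMs recognise ill-founded trees by
  depth-first search, so the ITRM-decidable predicates are closed under inductive definitions. Conversely,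
  whether a program gets from one configuration to another is decided by finitely many nested inductive
  definitions, one for each possible number of divergent registers: registers diverging at a limit are
  eventually nonzero before it, hence do not diverge at the intermediate limits. All predicates obtained
  in this way have decidable forcing relations, and since a c-random real avoids the decidable meager
  sets, truth for it coincides with being forced by an initial segment.

  For (1) take \<open>x = {2n | n \<in> y}\<close>, a member of the decidable nowhere dense set of all
  sets of even numbers. If \<open>x\<close> were computable, an initial segment of \<open>y\<close> would
  force the generic real to be \<open>y\<close>.

  For (2) let \<open>z w\<close> be the real computed from \<open>w\<close> by the reduction of
  \<open>x\<close> to \<open>y\<close>; an initial segment of \<open>y\<close> forces \<open>z w \<in>
  S\<close>. The set of those \<open>w\<close> all of whose initial segments have extensions forcing
  incompatible facts about \<open>z w\<close> is decidable, and it is meager because \<open>S\<close> is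
  countable and each set \<open>{w. z w = s}\<close> is nowhere dense within it. So some initial segment
  of \<open>y\<close> has no such extensions, and \<open>i \<in> x\<close> iff some extension of it forces
  \<open>i \<in> z w\<close>.\<close>

section \<open>Transfinite runs\<close>

text \<open>Two obstacles shape the proof. A halting run may be indexed by any well-order of
  \<open>nat set\<close>, so uncountable running times have to be excluded: at a limit of
  uncountable cofinality the configuration has already recurred in such a way that the machine loops
  forever (\<open>halting_trun\<close>). After that every limit is cut along an \<omega>-sequence
  into blocks, and reachability can be stated by \<open>trun\<close> without ordinals. The second
  obstacle is the reset to 0 of divergent registers. A limit at which all inferior limits are finite
  is certified by finite chains of every length, since a greedy choice of times turns them into an
  infinite one. This negation is the reason for the nesting. So a single closure property, that
  under inductive definitions, carries both sides: decidability (\<open>cp_ind\<close>, by a path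
  search) and forcing (\<open>fp_ind\<close>).\<close>

type_synonym vec = "nat \<Rightarrow> nat"

text \<open>\<open>V n\<close> collects the configurations in the n-th block of a run that is cut
  along a cofinal \<omega>-sequence. The order within a block is irrelevant to the inferior limit,
  so sets suffice.\<close>

definition is_liminf :: "(nat \<Rightarrow> vec set) \<Rightarrow> nat \<Rightarrow> nat \<Rightarrow> bool" where
  "is_liminf V i x \<longleftrightarrow> (\<exists>N. \<forall>n\<ge>N. \<forall>v\<in>V n. x \<le> v i) \<and> (\<forall>N. \<exists>n\<ge>N. \<exists>v\<in>V n. v i = x)"

definition lim_vec :: "(nat \<Rightarrow> vec set) \<Rightarrow> vec" where
  "lim_vec V = (\<lambda>i. if \<exists>x. is_liminf V i x then THE x. is_liminf V i x else 0)"

lemma is_liminf_le: "is_liminf V i x \<Longrightarrow> is_liminf V i y \<Longrightarrow> x \<le> y"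
proof -
  assume "is_liminf V i x" "is_liminf V i y"
  then obtain N n v where "\<forall>n\<ge>N. \<forall>v\<in>V n. x \<le> v i" "n \<ge> N" "v \<in> V n" "v i = y"
    unfolding is_liminf_def by meson
  then show "x \<le> y" by auto
qed

lemma lim_vec_eq: "is_liminf V i x \<Longrightarrow> lim_vec V i = x"
proof -
  assume h: "is_liminf V i x"
  have "(THE x. is_liminf V i x) = x"
    by (rule the_equality, rule h) (metis h is_liminf_le order_antisym)
  then show ?thesis unfolding lim_vec_def using h by auto
qed

lemma lim_vec_none: "(\<And>x. \<not> is_liminf V i x) \<Longrightarrow> lim_vec V i = 0"
  unfolding lim_vec_def by auto

lemma lim_vec_cong:
  assumes "\<And>x. is_liminf V i x \<longleftrightarrow> is_liminf W j x"
  shows "lim_vec V i = lim_vec W j"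
proof -
  have "is_liminf V i = is_liminf W j" using assms by blast
  then show ?thesis unfolding lim_vec_def by metis
qed

text \<open>The least bound that recurs in arbitrarily late blocks is the inferior limit. Hence a
  missing inferior limit always means divergence to infinity.\<close>

lemma ex_is_liminf:
  assumes "\<forall>N. \<exists>n\<ge>N. \<exists>v\<in>V n. v i \<le> B"
  shows "\<exists>x. is_liminf V i x"
proof -
  define Q where "Q x \<longleftrightarrow> (\<forall>N. \<exists>n\<ge>N. \<exists>v\<in>V n. v i \<le> x)" for x
  have "Q B" using assms by (simp add: Q_def)
  define x where "x = (LEAST x. Q x)"
  have Qx: "Q x" unfolding x_def by (rule LeastI) fact
  have "\<exists>N. \<forall>n\<ge>N. \<forall>v\<in>V n. x \<le> v i"
  proof (cases x)
    case (Suc y)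
    have "\<not> Q y" using Suc not_less_Least[of y Q] unfolding x_def by simp
    then show ?thesis unfolding Q_def Suc by (metis Suc_leI not_less)
  qed simp
  moreover have "\<forall>N. \<exists>n\<ge>N. \<exists>v\<in>V n. v i = x"
  proof
    fix N
    obtain M where M: "\<forall>n\<ge>M. \<forall>v\<in>V n. x \<le> v i" using calculation by blast
    obtain n v where "n \<ge> max N M" "v \<in> V n" "v i \<le> x" using Qx unfolding Q_def by blast
    then show "\<exists>n\<ge>N. \<exists>v\<in>V n. v i = x" using M by (metis le_antisym max.bounded_iff)
  qed
  ultimately show ?thesis unfolding is_liminf_def by blast
qed

lemma lim_vec_const:
  assumes "\<And>n. V n \<noteq> {}" "\<And>n v. v \<in> V n \<Longrightarrow> v i = x"
  shows "lim_vec V i = x"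
  by (rule lim_vec_eq) (use assms in \<open>auto simp: is_liminf_def\<close>, metis ex_in_conv order_refl)

text \<open>\<open>trun G c V d\<close>: iterating \<open>G\<close> transfinitely from \<open>c\<close>, with componentwise inferior
  limits, leads to \<open>d\<close>; \<open>V\<close> is the set of vectors visited strictly before the end.
  Limits of cofinality \<open>\<omega>\<close> suffice for countable time.\<close>

inductive trun :: "(vec \<Rightarrow> vec) \<Rightarrow> vec \<Rightarrow> vec set \<Rightarrow> vec \<Rightarrow> bool" for G where
  trun_refl: "trun G c {} c"
| trun_step: "trun G c V d \<Longrightarrow> trun G c (insert d V) (G d)"
| trun_lim: "(\<And>n. trun G (c n) (V n) (c (Suc n))) \<Longrightarrow> (\<And>n. V n \<noteq> {}) \<Longrightarrow>
     trun G (c 0) (\<Union>n. V n) (lim_vec V)"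

lemma trun_empty: "trun G c {} d \<Longrightarrow> c = d"
proof -
  have "V = {} \<Longrightarrow> c = d" if "trun G c V d" for V
    using that by induction (auto simp: ex_in_conv[symmetric])
  then show "trun G c {} d \<Longrightarrow> c = d" by blast
qed

lemma trun_trans:
  assumes "trun G d W e" "trun G c V d"
  shows "trun G c (V \<union> W) e"
  using assms
proof (induction arbitrary: c V rule: trun.induct)
  case (trun_refl d)
  then show ?case by simp
next
  case (trun_step d W e)
  then show ?case using trun.trun_step by fastforce
next
  case (trun_lim d W)
  \<comment> \<open>The earlier run is merged into block 0, which does not affect inferior
    limits.\<close>
  define V' where "V' n = (if n = 0 then V \<union> W 0 else W n)" for n
  define d' where "d' n = (if n = 0 then c else d n)" for n
  have 1: "trun G (d' n) (V' n) (d' (Suc n))" for n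
    using trun_lim unfolding V'_def d'_def by auto
  have 2: "V' n \<noteq> {}" for n using trun_lim.hyps(2)[of n] unfolding V'_def by auto
  have "trun G (d' 0) (\<Union>n. V' n) (lim_vec V')" by (rule trun.trun_lim) (use 1 2 in auto)
  moreover have "lim_vec V' = lim_vec W"
  proof
    fix i show "lim_vec V' i = lim_vec W i"
    proof (rule lim_vec_cong)
      fix x
      have "(\<exists>N. \<forall>n\<ge>N. \<forall>v\<in>V' n. x \<le> v i) \<longleftrightarrow> (\<exists>N. \<forall>n\<ge>N. \<forall>v\<in>W n. x \<le> v i)"
        unfolding V'_def by (metis Suc_leD not_less_eq_eq le0)
      moreover have "(\<forall>N. \<exists>n\<ge>N. \<exists>v\<in>V' n. v i = x) \<longleftrightarrow> (\<forall>N. \<exists>n\<ge>N. \<exists>v\<in>W n. v i = x)"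
        unfolding V'_def by (metis Suc_leD not_less_eq_eq le0)
      ultimately show "is_liminf V' i x = is_liminf W i x" unfolding is_liminf_def by simp
    qed
  qed
  moreover have "(\<Union>n. V' n) = V \<union> (\<Union>n. W n)"
  proof
    show "(\<Union>n. V' n) \<subseteq> V \<union> (\<Union>n. W n)" unfolding V'_def by (auto split: if_splits)
    have "W n \<subseteq> V' n" "V \<subseteq> V' 0" for n unfolding V'_def by auto
    then show "V \<union> (\<Union>n. W n) \<subseteq> (\<Union>n. V' n)" by blast
  qed
  ultimately show ?case by (simp add: d'_def)
qed

lemma trun_step1: "trun G c {c} (G c)"
  using trun_step[OF trun_refl] by simp

lemma trun_Cons: "trun G (G c) V d \<Longrightarrow> trun G c (insert c V) d"
  using trun_trans[OF _ trun_step1] by simp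

lemma trun_start: "trun G c V d \<Longrightarrow> V \<noteq> {} \<Longrightarrow> c \<in> V"
proof (induction rule: trun.induct)
  case (trun_step c V d)
  then show ?case using trun_empty by blast
qed auto

lemma trun_const:
  assumes "\<And>v. G v i = v i" "trun G c V d"
  shows "d i = c i \<and> (\<forall>v\<in>V. v i = c i)"
  using assms(2)
proof (induction rule: trun.induct)
  case (trun_lim c V)
  have "c n i = c 0 i" for n by (induction n) (use trun_lim in auto)
  then have *: "\<And>n v. v \<in> V n \<Longrightarrow> v i = c 0 i" using trun_lim by metis
  then show ?case using lim_vec_const[of V i "c 0 i"] trun_lim by auto
qed (use assms(1) in auto)

definition wseg :: "'a rel \<Rightarrow> 'a \<Rightarrow> 'a \<Rightarrow> 'a set" where
  "wseg r s t = {b. (s, b) \<in> r \<and> lt r b t}"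

definition wpre :: "'a rel \<Rightarrow> 'a \<Rightarrow> 'a set" where
  "wpre r t = {b. lt r b t}"

text \<open>\<open>f\<close> iterates \<open>G\<close> along the well-order \<open>r\<close>; the value at the least point is free.\<close>

definition run_on :: "(vec \<Rightarrow> vec) \<Rightarrow> 'a rel \<Rightarrow> ('a \<Rightarrow> vec) \<Rightarrow> bool" where
  "run_on G r f \<longleftrightarrow> Well_order r \<and>
     (\<forall>a\<in>Field r. (\<forall>b. is_succ_of r a b \<longrightarrow> f a = G (f b)) \<and>
        ((\<exists>b. lt r b a) \<and> \<not> (\<exists>b. is_succ_of r a b) \<longrightarrow> f a = (\<lambda>i. lim_val r a (\<lambda>b. f b i))))"

text \<open>Every strictly increasing \<open>\<omega>\<close>-sequence in the initial segment \<open>A\<close> is bounded in \<open>A\<close>,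
  and \<open>A\<close> has no maximum.\<close>

definition sigma_closed :: "'a rel \<Rightarrow> 'a set \<Rightarrow> bool" where
  "sigma_closed r A \<longleftrightarrow> A \<subseteq> Field r \<and> (\<forall>a\<in>A. \<forall>b. (b, a) \<in> r \<longrightarrow> b \<in> A) \<and>
     (\<forall>s :: nat \<Rightarrow> 'a. range s \<subseteq> A \<longrightarrow> (\<exists>a\<in>A. \<forall>n. lt r (s n) a))"

section \<open>Well-orders as time axes\<close>

locale wo =
  fixes r :: "'a rel"
  assumes wo: "Well_order r"
begin

lemma trans: "(a, b) \<in> r \<Longrightarrow> (b, c) \<in> r \<Longrightarrow> (a, c) \<in> r"
  using wo unfolding order_on_defs by (meson transD)

lemma antisym: "(a, b) \<in> r \<Longrightarrow> (b, a) \<in> r \<Longrightarrow> a = b"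
  using wo unfolding order_on_defs by (meson antisymD)

lemma refl: "a \<in> Field r \<Longrightarrow> (a, a) \<in> r"
  using wo unfolding order_on_defs by (meson refl_onD)

lemma field: "(a, b) \<in> r \<Longrightarrow> a \<in> Field r \<and> b \<in> Field r"
  by (auto simp: Field_def)

lemma lt_field: "lt r a b \<Longrightarrow> a \<in> Field r \<and> b \<in> Field r"
  by (auto simp: Field_def lt_def)

lemma total: "a \<in> Field r \<Longrightarrow> b \<in> Field r \<Longrightarrow> (a, b) \<in> r \<or> lt r b a"
  using wo refl[of a] unfolding order_on_defs total_on_def lt_def by metis

lemma not_lt: "a \<in> Field r \<Longrightarrow> b \<in> Field r \<Longrightarrow> \<not> lt r a b \<longleftrightarrow> (b, a) \<in> r"
  using total antisym unfolding lt_def by blast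

lemma not_le: "a \<in> Field r \<Longrightarrow> b \<in> Field r \<Longrightarrow> (b, a) \<notin> r \<longleftrightarrow> lt r a b"
  using not_lt by blast

lemma lt_irrefl: "\<not> lt r a a" by (simp add: lt_def)

lemma lt_trans: "lt r a b \<Longrightarrow> lt r b c \<Longrightarrow> lt r a c"
  unfolding lt_def using trans antisym by blast

lemma le_lt_trans: "(a, b) \<in> r \<Longrightarrow> lt r b c \<Longrightarrow> lt r a c"
  unfolding lt_def using trans antisym by blast

lemma lt_le_trans: "lt r a b \<Longrightarrow> (b, c) \<in> r \<Longrightarrow> lt r a c"
  unfolding lt_def using trans antisym by blast

lemma lt_imp_le: "lt r a b \<Longrightarrow> (a, b) \<in> r" by (simp add: lt_def)

lemma wf_lt: "wf {(a, b). lt r a b}"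
proof -
  have "{(a, b). lt r a b} = r - Id" by (auto simp: lt_def)
  then show ?thesis using wo by (simp add: order_on_defs)
qed

lemma least: "A \<subseteq> Field r \<Longrightarrow> A \<noteq> {} \<Longrightarrow> \<exists>m\<in>A. \<forall>a\<in>A. (m, a) \<in> r"
  using wfE_min[OF wf_lt, of _ A] total by (metis case_prod_conv ex_in_conv mem_Collect_eq subsetD)

lemma lt_induct [consumes 1, case_names less]:
  assumes "a \<in> Field r"
    and "\<And>a. a \<in> Field r \<Longrightarrow> (\<And>b. lt r b a \<Longrightarrow> P b) \<Longrightarrow> P a"
  shows "P a"
proof -
  have "a \<in> Field r \<longrightarrow> P a"
    by (induction a rule: wf_induct[OF wf_lt]) (use assms(2) lt_field in blast)
  then show ?thesis using assms(1) by blast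
qed

lemma is_succ_unique: "is_succ_of r a b \<Longrightarrow> is_succ_of r a c \<Longrightarrow> b = c"
  unfolding is_succ_of_def using total lt_field lt_def by metis

lemma is_succ_le: "is_succ_of r a b \<Longrightarrow> lt r c a \<Longrightarrow> (c, b) \<in> r"
  unfolding is_succ_of_def using total lt_field by blast

lemma ex_succ:
  assumes "lt r b c" shows "\<exists>a. is_succ_of r a b \<and> (a, c) \<in> r"
proof -
  have "{a. lt r b a} \<subseteq> Field r" "{a. lt r b a} \<noteq> {}" using assms lt_field by auto
  from least[OF this] obtain a where "lt r b a" "\<forall>x. lt r b x \<longrightarrow> (a, x) \<in> r" by blast
  then show ?thesis unfolding is_succ_of_def using assms not_lt lt_field by blast
qed

lemma succ_seg:
  assumes "(s, b) \<in> r" "is_succ_of r a b"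
  shows "wseg r s a = insert b (wseg r s b)"
proof -
  have ba: "lt r b a" using assms by (simp add: is_succ_of_def)
  have "lt r c a \<longleftrightarrow> c = b \<or> lt r c b" for c
    using is_succ_le[OF assms(2), of c] lt_trans[OF _ ba, of c] ba unfolding lt_def by blast
  then show ?thesis
    unfolding wseg_def using assms(1) by blast
qed

lemma liminf_is_le: "liminf_is r a v x \<Longrightarrow> liminf_is r a v y \<Longrightarrow> x \<le> y"
proof -
  assume "liminf_is r a v x" "liminf_is r a v y"
  then obtain g b where "\<forall>b. (g, b) \<in> r \<and> lt r b a \<longrightarrow> x \<le> v b" "(g, b) \<in> r" "lt r b a" "v b = y"
    unfolding liminf_is_def by meson
  then show "x \<le> y" by auto
qed

lemma lim_val_eq: "liminf_is r a v x \<Longrightarrow> lim_val r a v = x"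
proof -
  assume h: "liminf_is r a v x"
  have "(THE x. liminf_is r a v x) = x"
    by (rule the_equality, rule h) (metis h liminf_is_le order_antisym)
  then show ?thesis unfolding lim_val_def using h by auto
qed

lemma sup_seq:
  assumes "sigma_closed r A" "range s \<subseteq> A" "\<And>n. lt r (s n) (s (Suc n))"
  obtains t where "t \<in> A" "\<And>n. lt r (s n) t" "\<And>b. lt r b t \<Longrightarrow> \<exists>n. (b, s n) \<in> r"
    "\<not> (\<exists>b. is_succ_of r t b)"
proof -
  let ?B = "{t\<in>A. \<forall>n. lt r (s n) t}"
  have "?B \<subseteq> Field r" "?B \<noteq> {}" using assms(1,2) unfolding sigma_closed_def by blast+
  from least[OF this] obtain t where t: "t \<in> ?B" "\<forall>b\<in>?B. (t, b) \<in> r" by blast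
  have cof: "\<exists>n. (b, s n) \<in> r" if "lt r b t" for b
  proof (rule ccontr)
    assume n: "\<nexists>n. (b, s n) \<in> r"
    have "b \<in> A" using that t(1) assms(1) unfolding sigma_closed_def lt_def by blast
    moreover have "lt r (s n) b" for n
      using n total[of b "s n"] that lt_field[OF that] assms(1,2) unfolding sigma_closed_def by blast
    ultimately have "(t, b) \<in> r" using t(2) by blast
    then show False using that antisym unfolding lt_def by blast
  qed
  have "\<not> is_succ_of r t b" for b
  proof
    assume s: "is_succ_of r t b"
    then obtain n where "(b, s n) \<in> r" using cof unfolding is_succ_of_def by blast
    then have "lt r b (s (Suc n))" using assms(3) le_lt_trans by blast
    moreover have "lt r (s (Suc n)) t" using t by blast
    ultimately show False using s unfolding is_succ_of_def by blast
  qed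
  then show ?thesis using that t cof by blast
qed

text \<open>The bridge between well-ordered time and blocks: along a cofinal sequence every tail of
  times contains a tail of blocks, and conversely.\<close>

lemma liminf_seq:
  assumes "\<And>n. lt r (s n) (s (Suc n))" "\<And>n. lt r (s n) t" "\<And>b. lt r b t \<Longrightarrow> \<exists>n. (b, s n) \<in> r"
  shows "is_liminf (\<lambda>n. f ` wseg r (s n) (s (Suc n))) i x \<longleftrightarrow> liminf_is r t (\<lambda>b. f b i) x"
proof -
  have mono: "(s m, s n) \<in> r" if "m \<le> n" for m n
    using that
  proof (induction rule: dec_induct)
    case base show ?case using refl lt_field assms(2) by blast
  next
    case (step n) then show ?case using trans lt_imp_le assms(1) by blast
  qed
  have in_seg: "\<exists>n\<ge>N. b \<in> wseg r (s n) (s (Suc n))" if sb: "(s N, b) \<in> r" "lt r b t" for b N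
  proof -
    obtain m where "(b, s m) \<in> r" using assms(3)[OF sb(2)] by blast
    then have m: "lt r b (s (Suc m))" using assms(1) le_lt_trans by blast
    \<comment> \<open>The block of \<open>b\<close> is the one that ends at the first sequence point
      beyond \<open>b\<close>.\<close>
    define k where "k = (LEAST k. lt r b (s k))"
    have k: "lt r b (s k)" unfolding k_def by (rule LeastI) fact
    have "\<not> k \<le> N"
      using k that(1) mono[of k N] antisym unfolding lt_def by (metis lt_def lt_le_trans)
    then obtain j where j: "k = Suc j" "N \<le> j" by (metis Suc_leD not_less_eq_eq old.nat.exhaust le0)
    have "\<not> lt r b (s j)" using j not_less_Least[of j "\<lambda>k. lt r b (s k)"] unfolding k_def by simp
    then have "(s j, b) \<in> r" using not_lt lt_field that(2) assms(2) by blast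
    then show ?thesis using k j unfolding wseg_def by blast
  qed
  have seg_t: "lt r b t \<and> (s n, b) \<in> r" if "b \<in> wseg r (s n) (s (Suc n))" for b n
    using that assms(2) lt_trans unfolding wseg_def by blast
  have A: "(\<exists>N. \<forall>n\<ge>N. \<forall>v\<in>f ` wseg r (s n) (s (Suc n)). x \<le> v i) \<longleftrightarrow>
        (\<exists>g. lt r g t \<and> (\<forall>b. (g, b) \<in> r \<and> lt r b t \<longrightarrow> x \<le> f b i))" (is "?L = ?R")
  proof
    assume ?L
    then obtain N where "\<forall>n\<ge>N. \<forall>v\<in>f ` wseg r (s n) (s (Suc n)). x \<le> v i" by blast
    then have "\<forall>b. (s N, b) \<in> r \<and> lt r b t \<longrightarrow> x \<le> f b i" using in_seg by blast
    then show ?R using assms(2) by blast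
  next
    assume ?R
    then obtain g where g: "lt r g t" "\<forall>b. (g, b) \<in> r \<and> lt r b t \<longrightarrow> x \<le> f b i" by blast
    obtain N where "(g, s N) \<in> r" using assms(3) g by blast
    then have "\<forall>n\<ge>N. \<forall>b\<in>wseg r (s n) (s (Suc n)). (g, b) \<in> r \<and> lt r b t"
      using seg_t mono trans by metis
    then show ?L using g(2) by blast
  qed
  have B: "(\<forall>N. \<exists>n\<ge>N. \<exists>v\<in>f ` wseg r (s n) (s (Suc n)). v i = x) \<longleftrightarrow>
        (\<forall>g. lt r g t \<longrightarrow> (\<exists>b. (g, b) \<in> r \<and> lt r b t \<and> f b i = x))" (is "?L = ?R")
  proof
    assume L: ?L
    show ?R
    proof (intro allI impI)
      fix g assume g: "lt r g t"
      then obtain N where N: "(g, s N) \<in> r" using assms(3) by blast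
      obtain n b where "n \<ge> N" "b \<in> wseg r (s n) (s (Suc n))" "f b i = x" using L by blast
      then show "\<exists>b. (g, b) \<in> r \<and> lt r b t \<and> f b i = x"
        using seg_t mono N trans by metis
    qed
  next
    assume R: ?R
    show ?L
    proof
      fix N
      obtain b where "(s N, b) \<in> r" "lt r b t" "f b i = x" using R assms(2) by blast
      then show "\<exists>n\<ge>N. \<exists>v\<in>f ` wseg r (s n) (s (Suc n)). v i = x" using in_seg by blast
    qed
  qed
  show ?thesis unfolding is_liminf_def liminf_is_def using A B by simp
qed

lemma lim_vec_seq:
  assumes "\<And>n. lt r (s n) (s (Suc n))" "\<And>n. lt r (s n) t" "\<And>b. lt r b t \<Longrightarrow> \<exists>n. (b, s n) \<in> r"
  shows "lim_vec (\<lambda>n. f ` wseg r (s n) (s (Suc n))) = (\<lambda>i. lim_val r t (\<lambda>b. f b i))"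
proof
  fix i
  have "is_liminf (\<lambda>n. f ` wseg r (s n) (s (Suc n))) i = liminf_is r t (\<lambda>b. f b i)"
    using liminf_seq[OF assms] by blast
  then show "lim_vec (\<lambda>n. f ` wseg r (s n) (s (Suc n))) i = lim_val r t (\<lambda>b. f b i)"
    unfolding lim_vec_def lim_val_def by metis
qed

lemma wseg_seq:
  assumes "\<And>n. lt r (s n) (s (Suc n))" "\<And>n. lt r (s n) t" "\<And>b. lt r b t \<Longrightarrow> \<exists>n. (b, s n) \<in> r"
  shows "wseg r (s 0) t = (\<Union>n. wseg r (s n) (s (Suc n)))"
proof
  have le: "(s 0, s n) \<in> r" for n
    by (induction n) (use refl lt_field assms(1) lt_imp_le trans in blast)+
  show "(\<Union>n. wseg r (s n) (s (Suc n))) \<subseteq> wseg r (s 0) t"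
    using le assms(2) trans lt_trans unfolding wseg_def by blast
  show "wseg r (s 0) t \<subseteq> (\<Union>n. wseg r (s n) (s (Suc n)))"
  proof
    fix b assume b: "b \<in> wseg r (s 0) t"
    then obtain n where "(b, s n) \<in> r" using assms(3) unfolding wseg_def by blast
    then have "lt r b (s (Suc n))" using assms(1) le_lt_trans by blast
    moreover have "lt r b (s m) \<Longrightarrow> b \<in> (\<Union>n. wseg r (s n) (s (Suc n)))" for m
    proof (induction m)
      case 0
      then show ?case using b antisym unfolding wseg_def lt_def by blast
    next
      case (Suc m)
      then show ?case
        using total[of "s m" b] lt_field assms(2) unfolding wseg_def by blast
    qed
    ultimately show "b \<in> (\<Union>n. wseg r (s n) (s (Suc n)))" by blast
  qed
qed

end

section \<open>Runs along a well-order and their block form\<close>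

locale timeline = wo r for r :: "'a rel" +
  fixes G :: "vec \<Rightarrow> vec" and f :: "'a \<Rightarrow> vec"
  assumes run: "run_on G r f"
begin

lemma f_succ: "is_succ_of r a b \<Longrightarrow> f a = G (f b)"
  using run lt_field unfolding run_on_def is_succ_of_def by blast

lemma f_lim: "lt r b a \<Longrightarrow> \<not> (\<exists>b. is_succ_of r a b) \<Longrightarrow> f a = (\<lambda>i. lim_val r a (\<lambda>b. f b i))"
  using run lt_field unfolding run_on_def by blast

text \<open>Runs are deterministic, so an abstract run is reproduced by \<open>f\<close> from any
  time with the same configuration, as long as time does not end: \<open>sigma_closed\<close>
  supplies the successors and suprema that the induction needs.\<close>

lemma trun_timeline:
  assumes "sigma_closed r A" "trun G c V d" "s \<in> A" "f s = c"
  shows "\<exists>t\<in>A. (s, t) \<in> r \<and> f t = d \<and> V = f ` wseg r s t"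
  using assms(2-4)
proof (induction arbitrary: s rule: trun.induct)
  case (trun_refl c)
  have "(s, s) \<in> r" using trun_refl assms(1) refl unfolding sigma_closed_def by blast
  moreover have "wseg r s s = {}" unfolding wseg_def using antisym by (auto simp: lt_def)
  ultimately show ?case using trun_refl by auto
next
  case (trun_step c V d)
  then obtain t where t: "t\<in>A" "(s, t) \<in> r" "f t = d" "V = f ` wseg r s t" by blast
  \<comment> \<open>A constant sequence yields a time of \<open>A\<close> after
    \<open>t\<close>.\<close>
  have "range (\<lambda>n::nat. t) \<subseteq> A" using t(1) by blast
  then obtain u where u: "u \<in> A" "lt r t u"
    using assms(1) unfolding sigma_closed_def by blast
  obtain a where a: "is_succ_of r a t" "(a, u) \<in> r" using ex_succ[OF u(2)] by blast
  have "a \<in> A" using a(2) u assms(1) unfolding sigma_closed_def by blast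
  moreover have "(s, a) \<in> r" using a t(2) trans lt_imp_le unfolding is_succ_of_def by blast
  ultimately show ?case using f_succ[OF a(1)] succ_seg[OF t(2) a(1)] t by (metis image_insert)
next
  case (trun_lim c V)
  define R where "R n t t' \<longleftrightarrow> (t, t') \<in> r \<and> V n = f ` wseg r t t'" for n t t'
  have "\<exists>t. \<forall>n. ((t n \<in> A \<and> f (t n) = c n) \<and> (n = 0 \<longrightarrow> t n = s)) \<and> R n (t n) (t (Suc n))"
  proof (rule dependent_nat_choice)
    show "\<exists>x. (x \<in> A \<and> f x = c 0) \<and> (0 = (0::nat) \<longrightarrow> x = s)" using trun_lim by blast
  next
    fix x and n :: nat assume "(x \<in> A \<and> f x = c n) \<and> (n = 0 \<longrightarrow> x = s)"
    then have x: "x \<in> A" "f x = c n" by auto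
    from trun_lim.IH(1)[OF x] show "\<exists>y. ((y \<in> A \<and> f y = c (Suc n)) \<and> (Suc n = 0 \<longrightarrow> y = s)) \<and> R n x y"
      unfolding R_def by auto
  qed
  then obtain t where t: "t 0 = s" "\<And>n. t n \<in> A" "\<And>n. f (t n) = c n"
    "\<And>n. (t n, t (Suc n)) \<in> r" "\<And>n. V n = f ` wseg r (t n) (t (Suc n))"
    unfolding R_def by blast
  have lt: "lt r (t n) (t (Suc n))" for n
  proof -
    have "wseg r (t n) (t (Suc n)) \<noteq> {}" using trun_lim(2)[of n] t(5)[of n] by auto
    then show ?thesis using le_lt_trans unfolding wseg_def by blast
  qed
  obtain u where u: "u \<in> A" "\<And>n. lt r (t n) u" "\<And>b. lt r b u \<Longrightarrow> \<exists>n. (b, t n) \<in> r"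
    "\<not> (\<exists>b. is_succ_of r u b)"
    using sup_seq[OF assms(1), of t] t(2) lt by blast
  have "f u = lim_vec V"
    using f_lim[OF u(2) u(4)] lim_vec_seq[OF lt u(2,3), of f] t(5) by presburger
  moreover have "(\<Union>n. V n) = f ` wseg r s u"
    using wseg_seq[OF lt u(2,3)] t(1,5) by auto
  moreover have "(s, u) \<in> r" using u(2)[of 0] t(1) lt_imp_le by simp
  ultimately show ?case using u(1) by metis
qed

definition omega_cof :: "'a \<Rightarrow> bool" where
  "omega_cof a \<longleftrightarrow> (\<exists>s :: nat \<Rightarrow> 'a. (\<forall>n. lt r (s n) a) \<and> (\<forall>b. lt r b a \<longrightarrow> (\<exists>n. (b, s n) \<in> r)))"

definition is_lim :: "'a \<Rightarrow> bool" where
  "is_lim a \<longleftrightarrow> (\<exists>b. lt r b a) \<and> \<not> (\<exists>b. is_succ_of r a b)"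

lemma omega_cof_seq:
  assumes "omega_cof a" "is_lim a" "lt r b a"
  obtains t where "t 0 = b" "\<And>n. lt r (t n) (t (Suc n))" "\<And>n. lt r (t n) a"
    "\<And>b. lt r b a \<Longrightarrow> \<exists>n. (b, t n) \<in> r"
proof -
  obtain s :: "nat \<Rightarrow> 'a" where s: "\<And>n. lt r (s n) a" "\<And>b. lt r b a \<Longrightarrow> \<exists>n. (b, s n) \<in> r"
    using assms(1) unfolding omega_cof_def by blast
  have ex: "\<exists>y. lt r y a \<and> lt r x y \<and> (s n, y) \<in> r" if x: "lt r x a" for x n
  proof -
    define m where "m = (if (x, s n) \<in> r then s n else x)"
    have m: "lt r m a" "(x, m) \<in> r" "(s n, m) \<in> r"
      using s(1)[of n] x lt_field total[of x "s n"] refl lt_imp_le unfolding m_def by (auto)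
    obtain y where y: "is_succ_of r y m" "(y, a) \<in> r" using ex_succ[OF m(1)] by blast
    have "y \<noteq> a" using y(1) assms(2) unfolding is_lim_def by blast
    then have "lt r y a" using y(2) by (simp add: lt_def)
    moreover have "lt r m y" using y unfolding is_succ_of_def by blast
    ultimately show ?thesis using m le_lt_trans trans lt_imp_le by blast
  qed
  have "\<exists>t. \<forall>n. (lt r (t n) a \<and> (n = 0 \<longrightarrow> t n = b)) \<and> (lt r (t n) (t (Suc n)) \<and> (s n, t (Suc n)) \<in> r)"
    by (rule dependent_nat_choice[of "\<lambda>n t. lt r t a \<and> (n = 0 \<longrightarrow> t = b)" "\<lambda>n t t'. lt r t t' \<and> (s n, t') \<in> r"])
       (use assms(3) ex in auto)
  then obtain t where t: "\<And>n. lt r (t n) a" "t 0 = b" "\<And>n. lt r (t n) (t (Suc n))" "\<And>n. (s n, t (Suc n)) \<in> r"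
    by blast
  have "\<exists>n. (b, t n) \<in> r" if "lt r b a" for b using s(2)[OF that] t(4) trans by blast
  then show ?thesis using that t by blast
qed

text \<open>Induction on the end time. \<open>trun\<close> can only express limits of cofinality
  \<omega>, whence the hypothesis on the limits passed.\<close>

lemma timeline_trun:
  assumes "(s, t) \<in> r" "\<And>a. lt r s a \<Longrightarrow> (a, t) \<in> r \<Longrightarrow> is_lim a \<Longrightarrow> omega_cof a"
  shows "trun G (f s) (f ` wseg r s t) (f t)"
proof -
  have "t \<in> Field r" using assms(1) field by blast
  then have "\<forall>s. (s, t) \<in> r \<longrightarrow> (\<forall>a. lt r s a \<longrightarrow> (a, t) \<in> r \<longrightarrow> is_lim a \<longrightarrow> omega_cof a) \<longrightarrow>
      trun G (f s) (f ` wseg r s t) (f t)"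
  proof (induction t rule: lt_induct)
    case (less t)
    show ?case
    proof (intro allI impI)
      fix s assume st: "(s, t) \<in> r" and lim: "\<forall>a. lt r s a \<longrightarrow> (a, t) \<in> r \<longrightarrow> is_lim a \<longrightarrow> omega_cof a"
      have IH: "trun G (f u) (f ` wseg r u v) (f v)" if "lt r v t" "(u, v) \<in> r" "(s, u) \<in> r" for u v
        using less.IH[OF that(1)] lim that le_lt_trans lt_imp_le trans by blast
      consider "s = t" | "lt r s t" "is_lim t" | b where "lt r s t" "is_succ_of r t b"
        using st unfolding is_lim_def lt_def by blast
      then show "trun G (f s) (f ` wseg r s t) (f t)"
      proof cases
        case 1
        have "wseg r s s = {}" unfolding wseg_def using antisym by (auto simp: lt_def)
        then show ?thesis using 1 trun_refl by simp
      next
        case 2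
        have "omega_cof t" using lim 2 refl less.hyps by blast
        then obtain q where q: "q 0 = s" "\<And>n. lt r (q n) (q (Suc n))" "\<And>n. lt r (q n) t"
          "\<And>b. lt r b t \<Longrightarrow> \<exists>n. (b, q n) \<in> r"
          using omega_cof_seq 2 by blast
        have sq: "(s, q n) \<in> r" for n
          by (induction n) (use q refl field st lt_imp_le trans in blast)+
        have "trun G (f (q 0)) (\<Union>n. f ` wseg r (q n) (q (Suc n))) (lim_vec (\<lambda>n. f ` wseg r (q n) (q (Suc n))))"
        proof (rule trun_lim)
          fix n show "trun G (f (q n)) (f ` wseg r (q n) (q (Suc n))) (f (q (Suc n)))"
            by (rule IH) (use q sq lt_imp_le in auto)
          have "q n \<in> wseg r (q n) (q (Suc n))" unfolding wseg_def using q refl lt_field by blast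
          then show "f ` wseg r (q n) (q (Suc n)) \<noteq> {}" by blast
        qed
        moreover have "lim_vec (\<lambda>n. f ` wseg r (q n) (q (Suc n))) = f t"
          using lim_vec_seq[OF q(2-4)] f_lim 2 unfolding is_lim_def by metis
        moreover have "(\<Union>n. f ` wseg r (q n) (q (Suc n))) = f ` wseg r s t"
          using wseg_seq[OF q(2-4)] q(1) by auto
        ultimately show ?thesis using q(1) by simp
      next
        case 3
        have sb: "(s, b) \<in> r" using is_succ_le 3 by blast
        have "trun G (f s) (f ` wseg r s b) (f b)"
          by (rule IH) (use 3 sb refl field in \<open>auto simp: is_succ_of_def\<close>)
        then have "trun G (f s) (insert (f b) (f ` wseg r s b)) (G (f b))" by (rule trun_step)
        then show ?thesis using succ_seg[OF sb 3(2)] f_succ[OF 3(2)] by simp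
      qed
    qed
  qed
  then show ?thesis using assms by blast
qed

end

context timeline begin

lemma sigma_closed_wpre:
  assumes "is_lim u" "\<not> omega_cof u"
  shows "sigma_closed r (wpre r u)"
  unfolding sigma_closed_def
proof (intro conjI allI impI ballI)
  show "wpre r u \<subseteq> Field r" unfolding wpre_def using lt_field by blast
  show "b \<in> wpre r u" if "a \<in> wpre r u" "(b, a) \<in> r" for a b
    using that le_lt_trans unfolding wpre_def by blast
  fix s :: "nat \<Rightarrow> 'a" assume s: "range s \<subseteq> wpre r u"
  then have su: "lt r (s n) u" for n unfolding wpre_def by blast
  then obtain b where b: "lt r b u" "\<And>n. (b, s n) \<notin> r" using assms(2) unfolding omega_cof_def by blast
  then have "lt r (s n) b" for n using su not_le lt_field by blast
  then show "\<exists>a\<in>wpre r u. \<forall>n. lt r (s n) a" using b unfolding wpre_def by blast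
qed

text \<open>No component diverges at a limit of uncountable cofinality: the countably many times
  after which it exceeds 0, 1, 2, ... would be bounded by a time \<open>a\<close> below
  \<open>u\<close>, and its value at \<open>a\<close> would exceed itself.\<close>

lemma ex_liminf:
  assumes "is_lim u" "\<not> omega_cof u"
  shows "liminf_is r u (\<lambda>b. f b i) (f u i)"
proof -
  have sc: "sigma_closed r (wpre r u)" by (rule sigma_closed_wpre[OF assms])
  define Q where "Q x \<longleftrightarrow> (\<forall>g. lt r g u \<longrightarrow> (\<exists>b. (g, b) \<in> r \<and> lt r b u \<and> f b i \<le> x))" for x
  have "\<exists>x. Q x"
  proof (rule ccontr)
    assume "\<nexists>x. Q x"
    then have "\<forall>x. \<exists>g. lt r g u \<and> (\<forall>b. (g, b) \<in> r \<and> lt r b u \<longrightarrow> x < f b i)"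
      unfolding Q_def by (meson not_less)
    then obtain g where g: "\<And>x. lt r (g x) u" "\<And>x b. (g x, b) \<in> r \<Longrightarrow> lt r b u \<Longrightarrow> x < f b i"
      by metis
    have "range g \<subseteq> wpre r u" using g(1) unfolding wpre_def by blast
    then obtain a where "lt r a u" "\<And>n. lt r (g n) a" using sc unfolding sigma_closed_def wpre_def by blast
    then have "f a i < f a i" using g(2)[of "f a i" a] lt_imp_le by blast
    then show False by simp
  qed
  then have Q: "Q (LEAST x. Q x)" by (rule LeastI_ex)
  define x where "x = (LEAST x. Q x)"
  obtain g where g: "lt r g u" "\<forall>b. (g, b) \<in> r \<and> lt r b u \<longrightarrow> x \<le> f b i"
  proof (cases x)
    case 0
    then show ?thesis using that assms(1) unfolding is_lim_def by blast
  next
    case (Suc y)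
    have "\<not> Q y" using Suc not_less_Least[of y Q] unfolding x_def by simp
    then obtain g where "lt r g u" "\<forall>b. (g, b) \<in> r \<and> lt r b u \<longrightarrow> \<not> f b i \<le> y" unfolding Q_def by blast
    then show ?thesis using that Suc by (meson not_less_eq_eq)
  qed
  have "\<exists>b. (h, b) \<in> r \<and> lt r b u \<and> f b i = x" if h: "lt r h u" for h
  proof -
    define k where "k = (if (g, h) \<in> r then h else g)"
    have k: "lt r k u" "(g, k) \<in> r" "(h, k) \<in> r"
      using h g(1) lt_field total[of g h] refl lt_imp_le unfolding k_def by auto
    then obtain b where "(k, b) \<in> r" "lt r b u" "f b i \<le> x" using Q unfolding Q_def x_def by blast
    then show ?thesis using g(2) k trans le_antisym by metis
  qed
  then have "liminf_is r u (\<lambda>b. f b i) x" unfolding liminf_is_def using g by blast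
  moreover have "f u i = x"
    using f_lim assms(1) lim_val_eq[OF calculation] unfolding is_lim_def by metis
  ultimately show ?thesis by simp
qed

text \<open>Below a limit of uncountable cofinality the limit configuration is attained: interleave
  \<open>\<omega>\<close> many times at which the components attain their inferior limits.\<close>

lemma loop_point:
  assumes "is_lim u" "\<not> omega_cof u" "lt r b0 u"
  obtains b where "(b0, b) \<in> r" "lt r b u" "f b = f u"
    "\<And>s i. (b, s) \<in> r \<Longrightarrow> lt r s u \<Longrightarrow> f u i \<le> f s i"
proof -
  let ?A = "wpre r u"
  have sc: "sigma_closed r ?A" by (rule sigma_closed_wpre[OF assms(1,2)])
  have "\<forall>i. \<exists>g. lt r g u \<and> (\<forall>b. (g, b) \<in> r \<and> lt r b u \<longrightarrow> f u i \<le> f b i)"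
    using ex_liminf[OF assms(1,2)] unfolding liminf_is_def by blast
  then obtain g where g: "\<And>i. lt r (g i) u" "\<And>i b. (g i, b) \<in> r \<Longrightarrow> lt r b u \<Longrightarrow> f u i \<le> f b i"
    by metis
  have "range (case_nat b0 g) \<subseteq> ?A" using g(1) assms(3) unfolding wpre_def by (auto split: nat.splits)
  then obtain h where h: "lt r h u" "\<And>n. lt r (case_nat b0 g n) h"
    using sc unfolding sigma_closed_def wpre_def by blast
  have hb: "lt r b0 h" using h(2)[of 0] by simp
  have hg: "lt r (g i) h" for i using h(2)[of "Suc i"] by simp
  have low: "f u i \<le> f s i" if "(h, s) \<in> r" "lt r s u" for s i
    using g(2)[of i s] hg[of i] that trans lt_imp_le by blast
  \<comment> \<open>\<open>fst (prod_decode n)\<close> lists every component infinitely often, so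
    each one attains its limit value cofinally below the supremum of \<open>t\<close>.\<close>
  have "\<exists>t. \<forall>n. (lt r (t n) u \<and> (h, t n) \<in> r) \<and>
       (lt r (t n) (t (Suc n)) \<and> f (t (Suc n)) (fst (prod_decode n)) = f u (fst (prod_decode n)))"
  proof (rule dependent_nat_choice)
    show "\<exists>x. lt r x u \<and> (h, x) \<in> r" using h refl lt_field by blast
  next
    fix x and n :: nat assume x: "lt r x u \<and> (h, x) \<in> r"
    obtain y where y: "is_succ_of r y x" "(y, u) \<in> r" using ex_succ x by blast
    then have "lt r y u" using assms(1) unfolding is_lim_def lt_def by blast
    then obtain z where "(y, z) \<in> r" "lt r z u" "f z (fst (prod_decode n)) = f u (fst (prod_decode n))"
      using ex_liminf[OF assms(1,2), of "fst (prod_decode n)"] unfolding liminf_is_def by blast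
    moreover have "lt r x y" using y unfolding is_succ_of_def by blast
    ultimately show "\<exists>z. (lt r z u \<and> (h, z) \<in> r) \<and> lt r x z \<and> f z (fst (prod_decode n)) = f u (fst (prod_decode n))"
      using x trans lt_le_trans lt_imp_le by blast
  qed
  then obtain t where t: "\<And>n. lt r (t n) u" "\<And>n. (h, t n) \<in> r" "\<And>n. lt r (t n) (t (Suc n))"
    "\<And>n. f (t (Suc n)) (fst (prod_decode n)) = f u (fst (prod_decode n))" by blast
  have "range t \<subseteq> ?A" using t(1) unfolding wpre_def by blast
  then obtain b where b: "b \<in> ?A" "\<And>n. lt r (t n) b" "\<And>c. lt r c b \<Longrightarrow> \<exists>n. (c, t n) \<in> r"
    "\<not> (\<exists>c. is_succ_of r b c)"
    using sup_seq[of ?A t] sc t(3) \<open>range t \<subseteq> ?A\<close> by metis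
  have bu: "lt r b u" using b(1) unfolding wpre_def by blast
  have "f b i = f u i" for i
  proof -
    have "liminf_is r b (\<lambda>c. f c i) (f u i)"
      unfolding liminf_is_def
    proof (intro conjI allI impI)
      show "\<exists>g. lt r g b \<and> (\<forall>c. (g, c) \<in> r \<and> lt r c b \<longrightarrow> f u i \<le> f c i)"
        using b(2)[of 0] t(2)[of 0] low bu lt_trans trans by metis
      fix c assume "lt r c b"
      then obtain n where n: "(c, t n) \<in> r" using b(3) by blast
      define k where "k = prod_encode (i, n)"
      have k: "n \<le> k" unfolding k_def by (rule le_prod_encode_2)
      have mono: "(t n, t k) \<in> r" using k
      proof (induction rule: dec_induct)
        case base show ?case using refl lt_field t by blast
      next
        case (step m) then show ?case using trans lt_imp_le t(3) by blast
      qed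
      then have "(c, t (Suc k)) \<in> r" using n trans lt_imp_le t(3) by blast
      moreover have "f (t (Suc k)) i = f u i" using t(4)[of k] unfolding k_def by simp
      ultimately show "\<exists>d. (c, d) \<in> r \<and> lt r d b \<and> f d i = f u i" using b(2) by blast
    qed
    then show ?thesis using f_lim[OF b(2) b(4)] lim_val_eq by metis
  qed
  moreover have hb': "(h, b) \<in> r" using b(2) t(2) trans lt_imp_le by blast
  moreover have "(b0, b) \<in> r" using hb hb' trans lt_imp_le by blast
  ultimately show ?thesis using that bu low trans by blast
qed

text \<open>A halting run passes no limit of uncountable cofinality. At the first such limit
  \<open>u\<close> the configuration \<open>c\<close> is already attained at some \<open>b\<close>
  below \<open>u\<close>, with no component falling below \<open>c\<close> from there to
  \<open>u\<close>. Whatever is reachable from \<open>c\<close> by an abstract run is then realised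
  below \<open>u\<close> and does not halt. On the other hand the returns to \<open>c\<close> never
  end, which contradicts that they are bounded by the halting time.\<close>

lemma halting_trun:
  assumes "\<And>a. a \<in> Field r \<Longrightarrow> (z, a) \<in> r \<and> (a, M) \<in> r"
    and "z \<in> Field r" "M \<in> Field r"
    and "H (f M)" "\<And>a. a \<in> Field r \<Longrightarrow> a \<noteq> M \<Longrightarrow> \<not> H (f a)"
  shows "trun G (f z) (f ` wseg r z M) (f M)"
proof (cases "\<exists>a\<in>Field r. is_lim a \<and> \<not> omega_cof a")
  case False
  then show ?thesis using timeline_trun assms(1,3) field by meson
next
  case True
  then have "{a\<in>Field r. is_lim a \<and> \<not> omega_cof a} \<noteq> {}" by blast
  from least[OF _ this] obtain u where u: "u \<in> Field r" "is_lim u" "\<not> omega_cof u"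
    "\<And>a. a \<in> Field r \<Longrightarrow> is_lim a \<Longrightarrow> \<not> omega_cof a \<Longrightarrow> (u, a) \<in> r" by blast
  define c where "c = f u"
  have "\<exists>b. lt r b u" using u(2) unfolding is_lim_def by blast
  then obtain b where b: "lt r b u" "f b = c" "\<And>s i. (b, s) \<in> r \<Longrightarrow> lt r s u \<Longrightarrow> c i \<le> f s i"
    using loop_point[OF u(2,3)] unfolding c_def by metis
  have reach: "\<exists>t. (b, t) \<in> r \<and> lt r t u \<and> f t = d" if "trun G c V d" for V d
    using trun_timeline[OF sigma_closed_wpre[OF u(2,3)] that] b unfolding wpre_def by blast
  have nH: "\<not> H d" if "trun G c V d" for V d
    using reach[OF that] assms(5)[of _] assms(1) lt_field u(1) antisym unfolding lt_def by metis
  \<comment> \<open>The returns to \<open>c\<close> with nothing below \<open>c\<close> since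
    \<open>b\<close>. A supremum of such returns has inferior limit \<open>c\<close> and is again in
    \<open>L\<close>; for the supremum \<open>v\<close> of all of them a later member
    \<open>w\<close> will be found.\<close>
  define L where "L = {v \<in> Field r. (b, v) \<in> r \<and> f v = c \<and> (\<forall>s i. (b, s) \<in> r \<and> (s, v) \<in> r \<longrightarrow> c i \<le> f s i)}"
  have bL: "b \<in> L" unfolding L_def using b refl lt_field antisym by (auto dest: antisym)
  let ?U = "{w \<in> Field r. \<forall>v\<in>L. (v, w) \<in> r}"
  have "M \<in> ?U" using assms(1,3) unfolding L_def by blast
  then have "?U \<subseteq> Field r" "?U \<noteq> {}" by blast+
  from least[OF this] obtain v where v: "v \<in> ?U" "\<And>w. w \<in> ?U \<Longrightarrow> (v, w) \<in> r" by blast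
  have ex_above: "\<exists>w\<in>L. (s, w) \<in> r" if "lt r s v" for s
  proof (rule ccontr)
    assume "\<not> (\<exists>w\<in>L. (s, w) \<in> r)"
    then have "s \<in> ?U" using that lt_field total lt_imp_le unfolding L_def by blast
    then show False using v(2) that antisym unfolding lt_def by blast
  qed
  have "v \<in> L"
  proof (rule ccontr)
    assume vL: "v \<notin> L"
    then have lv: "lt r w v" if "w \<in> L" for w using v(1) that unfolding lt_def by blast
    have bv: "lt r b v" using bL lv by blast
    have "\<not> is_succ_of r v w" for w
    proof
      assume w: "is_succ_of r v w"
      then obtain x where x: "x \<in> L" "(w, x) \<in> r" using ex_above unfolding is_succ_of_def by blast
      then have "x = w" using lv[OF x(1)] w is_succ_le antisym by blast
      have "\<forall>y\<in>L. (y, w) \<in> r" using lv w is_succ_le by blast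
      then have "w \<in> ?U" using x field by blast
      then show False using v(2) w antisym unfolding is_succ_of_def lt_def by blast
    qed
    moreover have low: "c i \<le> f s i" if "(b, s) \<in> r" "lt r s v" for s i
      using ex_above[OF that(2)] that(1) unfolding L_def by blast
    have "f v = c"
    proof
      fix i
      have "liminf_is r v (\<lambda>b. f b i) (c i)" unfolding liminf_is_def
      proof (intro conjI allI impI)
        show "\<exists>g. lt r g v \<and> (\<forall>b. (g, b) \<in> r \<and> lt r b v \<longrightarrow> c i \<le> f b i)" using bv low by blast
        fix g assume "lt r g v"
        then obtain w where "w \<in> L" "(g, w) \<in> r" using ex_above by blast
        then show "\<exists>b. (g, b) \<in> r \<and> lt r b v \<and> f b i = c i" using lv unfolding L_def by blast
      qed
      then show "f v i = c i" using f_lim[OF bv] calculation lim_val_eq by metis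
    qed
    moreover have "c i \<le> f s i" if "(b, s) \<in> r" "(s, v) \<in> r" for s i
      using that low[of s i] \<open>f v = c\<close> unfolding lt_def by blast
    ultimately show False using vL bv v(1) lt_imp_le unfolding L_def by blast
  qed
  then have vc: "f v = c" "(b, v) \<in> r" "v \<in> Field r"
    "\<And>s i. (b, s) \<in> r \<Longrightarrow> (s, v) \<in> r \<Longrightarrow> c i \<le> f s i" unfolding L_def by blast+
  have vM: "(v, M) \<in> r" using assms(1) vc(3) by blast
  \<comment> \<open>Without a further limit of uncountable cofinality the halting configuration
    would be reachable from \<open>c\<close> by an abstract run.\<close>
  have "{a\<in>Field r. lt r v a \<and> is_lim a \<and> \<not> omega_cof a} \<noteq> {}"
  proof
    assume n: "{a\<in>Field r. lt r v a \<and> is_lim a \<and> \<not> omega_cof a} = {}"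
    have "trun G (f v) (f ` wseg r v M) (f M)"
      by (rule timeline_trun[OF vM]) (use n lt_field in blast)
    then show False using nH vc(1) assms(4) by metis
  qed
  from least[OF _ this] obtain w where w: "w \<in> Field r" "lt r v w" "is_lim w" "\<not> omega_cof w"
    "\<And>a. a \<in> Field r \<Longrightarrow> lt r v a \<Longrightarrow> is_lim a \<Longrightarrow> \<not> omega_cof a \<Longrightarrow> (w, a) \<in> r" by blast
  have rw: "trun G c (f ` wseg r v s) (f s)" if "(v, s) \<in> r" "lt r s w" for s
    unfolding vc(1)[symmetric]
  proof (rule timeline_trun[OF that(1)])
    fix a assume a: "lt r v a" "(a, s) \<in> r" "is_lim a"
    then have "lt r a w" using that(2) le_lt_trans by blast
    then show "omega_cof a" using w(5)[of a] a lt_field antisym unfolding lt_def by blast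
  qed
  have low: "c i \<le> f s i" if "(v, s) \<in> r" "lt r s w" for s i
    using reach[OF rw[OF that]] b(3) by metis
  obtain d where d: "(v, d) \<in> r" "lt r d w" "f d = f w" "\<And>s i. (d, s) \<in> r \<Longrightarrow> lt r s w \<Longrightarrow> f w i \<le> f s i"
    using loop_point[OF w(3,4,2)] by metis
  obtain e where e: "(b, e) \<in> r" "lt r e u" "f e = f w" using reach[OF rw[OF d(1,2)]] d(3) by metis
  \<comment> \<open>The configuration of \<open>w\<close> occurs at \<open>e\<close> below
    \<open>u\<close>, after which component \<open>i\<close> returns to \<open>c i\<close>. This
    stretch is copied to times after \<open>d\<close> and below \<open>w\<close>, where no component
    is less than in \<open>f w\<close>.\<close>
  have "f w i \<le> c i" for i
  proof -
    have "lt r e u" by fact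
    then obtain s where s: "(e, s) \<in> r" "lt r s u" "f s i = c i"
      using ex_liminf[OF u(2,3), of i] unfolding liminf_is_def c_def by blast
    have lim: "omega_cof a" if "lt r e a" "(a, s) \<in> r" "is_lim a" for a
      using u(4)[of a] that s(2) lt_field lt_le_trans le_lt_trans lt_irrefl by blast
    have "trun G (f w) (f ` wseg r e s) (f s)" using timeline_trun[OF s(1) lim] e(3) by simp
    then obtain t where "(d, t) \<in> r" "lt r t w" "f t = f s"
      using trun_timeline[OF sigma_closed_wpre[OF w(3,4)], of "f w" _ "f s" d] d(2,3) unfolding wpre_def by blast
    then show ?thesis using d(4) s(3) by metis
  qed
  then have wc: "f w = c" using low[OF d(1,2)] d(3) by (metis antisym_conv ext)
  have "w \<in> L" unfolding L_def
  proof (clarsimp, intro conjI allI impI)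
    show "w \<in> Field r" "(b, w) \<in> r" "f w = c" using w wc vc(2) trans lt_imp_le by blast+
    fix s i assume s: "(b, s) \<in> r \<and> (s, w) \<in> r"
    consider "(s, v) \<in> r" | "(v, s) \<in> r" "lt r s w" | "s = w"
      using s total[of s v] vc(3) field lt_imp_le unfolding lt_def by blast
    then show "c i \<le> f s i" using vc(4) low wc s by cases auto
  qed
  then show ?thesis using v(1) w(2) antisym unfolding lt_def by blast
qed

end

subsection \<open>The type of countable ordinals\<close>

definition wrel :: "nat set rel" where
  "wrel = (SOME r. well_order_on UNIV r)"

lemma wrel: "well_order_on UNIV wrel"
  unfolding wrel_def by (rule someI_ex[OF well_order_on])

interpretation wrel: wo wrel
  by standard (use wrel well_order_on_Well_order in blast)

lemma Field_wrel [simp]: "Field wrel = UNIV"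
  using wrel well_order_on_Field by blast

lemma uncountable_UNIV_nat_set: "uncountable (UNIV :: nat set set)"
  by (metis Cantors_theorem Pow_UNIV empty_not_UNIV range_from_nat_into)

text \<open>A copy of the first uncountable ordinal. It lives inside \<open>nat set\<close> because
  \<open>halts_with\<close> indexes runs by relations on that type.\<close>

typedef om = "{a. countable {b. lt wrel b a}}"
proof -
  obtain m where "\<forall>a. (m, a) \<in> wrel" using wrel.least[of UNIV] by auto
  then have "{b. lt wrel b m} = {}" using wrel.antisym unfolding lt_def by blast
  then show ?thesis by (auto intro: exI[of _ m])
qed

instantiation om :: wellorder
begin

definition less_eq_om :: "om \<Rightarrow> om \<Rightarrow> bool" where
  "less_eq_om a b \<longleftrightarrow> (Rep_om a, Rep_om b) \<in> wrel"

definition less_om :: "om \<Rightarrow> om \<Rightarrow> bool" where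
  "less_om a b \<longleftrightarrow> lt wrel (Rep_om a) (Rep_om b)"

instance
proof
  fix a b c :: om
  show "(a < b) = (a \<le> b \<and> \<not> b \<le> a)"
    unfolding less_om_def less_eq_om_def lt_def
    using wrel.antisym[of "Rep_om a" "Rep_om b"] wrel.refl[of "Rep_om a"] by auto
  show "a \<le> a" unfolding less_eq_om_def using wrel.refl[of "Rep_om a"] by simp
  show "a \<le> b \<Longrightarrow> b \<le> c \<Longrightarrow> a \<le> c"
    unfolding less_eq_om_def using wrel.trans[of "Rep_om a" "Rep_om b" "Rep_om c"] by blast
  show "a \<le> b \<Longrightarrow> b \<le> a \<Longrightarrow> a = b"
    unfolding less_eq_om_def using wrel.antisym[of "Rep_om a" "Rep_om b"] by (simp add: Rep_om_inject)
  show "a \<le> b \<or> b \<le> a"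
    unfolding less_eq_om_def using wrel.total[of "Rep_om a" "Rep_om b"] by (auto simp: lt_def)
next
  fix P :: "om \<Rightarrow> bool" and a :: om
  assume step: "\<And>x. (\<And>y. y < x \<Longrightarrow> P y) \<Longrightarrow> P x"
  have "wf (inv_image {(a, b). lt wrel a b} Rep_om)" by (rule wf_inv_image[OF wrel.wf_lt])
  then show "P a"
    by (induction a rule: wf_induct_rule) (use step in \<open>auto simp: less_om_def inv_image_def\<close>)
qed

end

lemma countable_om: "countable {b::om. b < a}"
proof -
  have "Rep_om ` {b. b < a} \<subseteq> {b. lt wrel b (Rep_om a)}" unfolding less_om_def by blast
  moreover have "countable {b. lt wrel b (Rep_om a)}" using Rep_om by blast
  ultimately have "countable (Rep_om ` {b. b < a})" using countable_subset by blast
  then show ?thesis by (rule countable_image_inj_on) (simp add: inj_on_def Rep_om_inject)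
qed

lemma uncountable_om: "uncountable (UNIV :: om set)"
proof
  assume "countable (UNIV :: om set)"
  then have c: "countable (range Rep_om)" by blast
  then have "- range Rep_om \<noteq> {}" using uncountable_UNIV_nat_set by (metis double_complement Compl_empty_eq)
  from wrel.least[OF _ this] obtain m where m: "m \<notin> range Rep_om"
    "\<And>a. a \<notin> range Rep_om \<Longrightarrow> (m, a) \<in> wrel" by auto
  have "{b. lt wrel b m} \<subseteq> range Rep_om" using m(2) wrel.antisym unfolding lt_def by blast
  then have "m \<in> {a. countable {b. lt wrel b a}}" using c countable_subset by blast
  then show False using m(1) type_definition.Rep_range[OF type_definition_om] by blast
qed

lemma bounded_om:
  assumes "countable (B :: om set)" shows "\<exists>a. \<forall>b\<in>B. b < a"
proof (rule ccontr)
  assume "\<nexists>a. \<forall>b\<in>B. b < a"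
  then have "UNIV \<subseteq> (\<Union>b\<in>B. insert b {c. c < b})" by (auto simp: not_less order_le_less)
  moreover have "countable (\<Union>b\<in>B. insert b {c. c < b})" using assms countable_om by simp
  ultimately show False using uncountable_om countable_subset by blast
qed

definition rom :: "om rel" where "rom = {(a, b). a \<le> b}"

lemma lt_rom [simp]: "lt rom a b \<longleftrightarrow> a < b"
  unfolding rom_def lt_def by auto

lemma in_rom [simp]: "(a, b) \<in> rom \<longleftrightarrow> a \<le> b"
  unfolding rom_def by auto

lemma Field_rom [simp]: "Field rom = UNIV"
  unfolding Field_def by (auto simp: Domain_iff)

interpretation rom: wo rom
proof
  have "rom - Id = {(a, b). a < b}" unfolding rom_def by auto
  then have "wf (rom - Id)" using wf by simp
  then show "Well_order rom"
    unfolding order_on_defs total_on_def refl_on_def trans_def antisym_def by (auto)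
qed

lemma is_succ_rom: "is_succ_of rom a b \<longleftrightarrow> b < a \<and> (\<forall>c<a. c \<le> b)"
  unfolding is_succ_of_def by (auto simp: not_less not_le)

lemma sigma_closed_rom: "sigma_closed rom UNIV"
  unfolding sigma_closed_def using bounded_om[of "range s" for s :: "nat \<Rightarrow> om"] by auto

lemma liminf_is_cong:
  "(\<And>b. lt r b a \<Longrightarrow> v b = w b) \<Longrightarrow> liminf_is r a v n \<longleftrightarrow> liminf_is r a w n"
  unfolding liminf_is_def by (metis (full_types))

lemma lim_val_cong:
  assumes "\<And>b. lt r b a \<Longrightarrow> v b = w b" shows "lim_val r a v = lim_val r a w"
proof -
  have "liminf_is r a v = liminf_is r a w" using liminf_is_cong[of r a v w] assms by blast
  then show ?thesis unfolding lim_val_def by metis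
qed

definition om0 :: om where "om0 = (LEAST x. True)"

lemma om0_le [simp]: "om0 \<le> a"
  unfolding om0_def by (simp add: Least_le)

text \<open>The run through all countable ordinals, whether or not it halts. Abstract runs are
  exactly its initial segments (\<open>trun_iff\<close>), so they can be compared by comparing
  times.\<close>

definition orun :: "(vec \<Rightarrow> vec) \<Rightarrow> vec \<Rightarrow> om \<Rightarrow> vec" where
  "orun G c = wfrec {(a, b). a < b} (\<lambda>F a. if a = om0 then c
     else if \<exists>b. is_succ_of rom a b then G (F (THE b. is_succ_of rom a b))
     else (\<lambda>i. lim_val rom a (\<lambda>b. F b i)))"

lemma orun_rec: "orun G c a = (if a = om0 then c
     else if \<exists>b. is_succ_of rom a b then G (orun G c (THE b. is_succ_of rom a b))
     else (\<lambda>i. lim_val rom a (\<lambda>b. orun G c b i)))"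
proof -
  have the: "(THE b. is_succ_of rom a b) < a" if "is_succ_of rom a b" for b
    using that theI[of "is_succ_of rom a" b] rom.is_succ_unique is_succ_rom by metis
  show ?thesis
    unfolding orun_def
    by (subst wfrec[OF wf]) (auto simp: cut_apply the fun_eq_iff intro!: lim_val_cong)
qed

lemma orun_om0 [simp]: "orun G c om0 = c"
  by (subst orun_rec) simp

interpretation orun: timeline rom G "orun G c" for G c
proof
  show "run_on G rom (orun G c)"
    unfolding run_on_def
  proof (intro conjI ballI allI impI)
    show "Well_order rom" by (rule rom.wo)
  next
    fix a b assume s: "is_succ_of rom a b"
    then have "a \<noteq> om0" unfolding is_succ_rom using om0_le[of b] leD by blast
    moreover have "(THE b. is_succ_of rom a b) = b" using s rom.is_succ_unique by blast
    ultimately show "orun G c a = G (orun G c b)" using s orun_rec[of G c a] by auto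
  next
    fix a assume a: "(\<exists>b. lt rom b a) \<and> (\<nexists>b. is_succ_of rom a b)"
    then have "a \<noteq> om0" using om0_le by (auto simp: not_less[symmetric])
    then show "orun G c a = (\<lambda>i. lim_val rom a (\<lambda>b. orun G c b i))" using a orun_rec[of G c a] by auto
  qed
qed

text \<open>An enumeration of the countably many predecessors is cofinal; \<open>omega_cof\<close>
  does not ask for monotonicity.\<close>

lemma omega_cof_rom: "orun.is_lim a \<Longrightarrow> orun.omega_cof a"
proof -
  assume "orun.is_lim a"
  then have ne: "{b. b < a} \<noteq> {}" unfolding orun.is_lim_def by auto
  have r: "range (from_nat_into {b. b < a}) = {b. b < a}"
    by (rule range_from_nat_into[OF ne countable_om])
  show ?thesis unfolding orun.omega_cof_def
  proof (intro exI[of _ "from_nat_into {b. b < a}"] conjI allI impI)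
    show "lt rom (from_nat_into {b. b < a} n) a" for n using from_nat_into[OF ne, of n] by simp
    fix b assume "lt rom b a"
    then have "b \<in> range (from_nat_into {b. b < a})" using r by auto
    then show "\<exists>n. (b, from_nat_into {b. b < a} n) \<in> rom" by auto
  qed
qed

lemma wseg_rom [simp]: "wseg rom s t = {s..<t}"
  unfolding wseg_def by auto

lemma orun_trun: "s \<le> t \<Longrightarrow> trun G (orun G c s) (orun G c ` {s..<t}) (orun G c t)"
  using orun.timeline_trun[of s t G c] omega_cof_rom by simp

lemma trun_orun:
  "trun G (orun G c s) V d \<Longrightarrow> \<exists>t\<ge>s. orun G c t = d \<and> V = orun G c ` {s..<t}"
  using orun.trun_timeline[OF sigma_closed_rom, of G "orun G c s" V d s c] by auto

lemma trun_iff: "trun G c V d \<longleftrightarrow> (\<exists>t. orun G c t = d \<and> V = orun G c ` {..<t})"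
proof -
  have "{om0..<t} = {..<t}" for t by auto
  then show ?thesis using trun_orun[of G c om0] orun_trun[of om0 _ G c] by fastforce
qed

subsection \<open>Halting runs\<close>

text \<open>\<open>limit_config\<close> treats the active line and the registers alike, so the line
  is stored as component 0 and register i as component i + 1.\<close>

definition vec :: "config \<Rightarrow> vec" where
  "vec c = case_nat (fst c) (snd c)"

definition unvec :: "vec \<Rightarrow> config" where
  "unvec v = (v 0, \<lambda>i. v (Suc i))"

lemma unvec_vec [simp]: "unvec (vec c) = c"
  unfolding vec_def unvec_def by simp

definition vstep :: "program \<Rightarrow> nat set \<Rightarrow> vec \<Rightarrow> vec" where
  "vstep P x v = vec (step P x (unvec v))"

lemma limit_config_vec:
  "vec (limit_config r a f) = (\<lambda>i. lim_val r a (\<lambda>b. vec (f b) i))"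
  unfolding limit_config_def vec_def by (auto split: nat.splits)

lemma halting_run_trun:
  assumes "halting_run P x c0 r f" "m \<in> Field r" "\<forall>a\<in>Field r. (a, m) \<in> r"
  shows "\<exists>V. trun (vstep P x) (vec c0) V (vec (f m)) \<and> length P \<le> fst (f m)"
proof -
  obtain z M where zM: "Well_order r" "z \<in> Field r" "M \<in> Field r"
        "\<forall>a\<in>Field r. (z, a) \<in> r \<and> (a, M) \<in> r" "f z = c0"
        "\<forall>a\<in>Field r. a \<noteq> z \<longrightarrow>
           (if (\<exists>b. is_succ_of r a b)
            then f a = step P x (f (THE b. is_succ_of r a b))
            else f a = limit_config r a f)"
        "\<forall>a\<in>Field r. a \<noteq> M \<longrightarrow> \<not> halted P (f a)" "halted P (f M)"
    using assms(1) unfolding halting_run_def by blast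
  interpret wo r by standard fact
  have mM: "m = M" using assms(2,3) zM(3,4) antisym by blast
  have nz: "a \<noteq> z" if "lt r b a" for a b using that zM(4) antisym unfolding lt_def
    by (metis FieldI1)
  interpret timeline r "vstep P x" "vec \<circ> f"
  proof
    show "run_on (vstep P x) r (vec \<circ> f)"
      unfolding run_on_def
    proof (intro conjI ballI allI impI)
      show "Well_order r" by fact
    next
      fix a b assume a: "a \<in> Field r" "is_succ_of r a b"
      then have "a \<noteq> z" using nz unfolding is_succ_of_def by blast
      moreover have "(THE b. is_succ_of r a b) = b" using a is_succ_unique by blast
      ultimately have "f a = step P x (f b)" using zM(6) a by metis
      then show "(vec \<circ> f) a = vstep P x ((vec \<circ> f) b)" unfolding vstep_def by simp
    next
      fix a assume a: "a \<in> Field r" "(\<exists>b. lt r b a) \<and> (\<nexists>b. is_succ_of r a b)"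
      then have "a \<noteq> z" using nz by blast
      then have "f a = limit_config r a f" using zM(6) a by auto
      then show "(vec \<circ> f) a = (\<lambda>i. lim_val r a (\<lambda>b. (vec \<circ> f) b i))"
        using limit_config_vec[of r a f] by (simp add: o_def)
    qed
  qed
  have "trun (vstep P x) ((vec \<circ> f) z) ((vec \<circ> f) ` wseg r z M) ((vec \<circ> f) M)"
    by (rule halting_trun[where H = "\<lambda>v. halted P (unvec v)"]) (use zM in auto)
  then show ?thesis using zM(5,8) mM unfolding halted_def by auto
qed

lemma trun_fixed: "G c = c \<Longrightarrow> trun G c V d \<Longrightarrow> d = c \<and> V \<subseteq> {c}"
proof (rotate_tac, induction rule: trun.induct)
  case (trun_lim c V)
  have c: "c n = c 0" for n by (induction n) (use trun_lim in auto)
  then have V: "V n = {c 0}" for n using trun_lim(2,3)[of n] trun_lim.prems by (metis subset_singletonD)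
  have "lim_vec V = c 0" by (rule ext, rule lim_vec_const) (auto simp: V)
  then show ?case using V by auto
qed auto

text \<open>The run over the countable ordinals is cut at its first halting time \<open>t\<close>,
  since \<open>halting_run\<close> allows no earlier halted configuration. It is carried to
  \<open>nat set\<close> as the restriction of \<open>wrel\<close> to the times up to
  \<open>t\<close>.\<close>

lemma trun_halts_with:
  assumes "trun (vstep P x) (vec c0) V d" "length P \<le> d 0"
  shows "halts_with P x c0 (d (Suc 0))"
proof -
  define F where "F = orun (vstep P x) (vec c0)"
  obtain t0 where t0: "F t0 = d" using assms(1) unfolding trun_iff F_def by blast
  define t where "t = (LEAST t. length P \<le> F t 0)"
  have t: "length P \<le> F t 0" unfolding t_def by (rule LeastI[of _ t0]) (simp add: t0 assms(2))
  have nh: "\<not> length P \<le> F s 0" if "s < t" for s using that not_less_Least unfolding t_def by blast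
  have stay: "vstep P x (F t) = F t" using t unfolding vstep_def step_def halted_def unvec_def
    by (simp add: vec_def fun_eq_iff split: nat.splits)
  have after: "F s = F t" if "t \<le> s" for s
    using trun_fixed[of "vstep P x" "F t", OF stay] orun_trun[OF that, of "vstep P x" "vec c0"] unfolding F_def by blast
  have Ft: "F t = d" using after[of t0] nh[of t0] t0 assms(2) by (cases "t \<le> t0") (auto simp: not_le)
  define r where "r = Restr wrel (Rep_om ` {..t})"
  define f where "f q = unvec (F (Abs_om q))" for q
  have r_iff: "(Rep_om a, Rep_om b) \<in> r \<longleftrightarrow> a \<le> b \<and> b \<le> t" for a b
  proof -
    have "Rep_om c \<in> Rep_om ` {..t} \<longleftrightarrow> c \<le> t" for c by (auto simp: Rep_om_inject)
    then show ?thesis unfolding r_def by (auto simp: less_eq_om_def[symmetric])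
  qed
  have lt_iff: "lt r (Rep_om a) (Rep_om b) \<longleftrightarrow> a < b \<and> b \<le> t" for a b
    unfolding lt_def r_iff by (auto simp: Rep_om_inject)
  have rRep: "x \<in> range Rep_om \<and> y \<in> range Rep_om" if "(x, y) \<in> r" for x y
    using that unfolding r_def by auto
  have ltRep: "x \<in> range Rep_om \<and> y \<in> range Rep_om" if "lt r x y" for x y
    using that rRep unfolding lt_def by blast
  have Fr: "Field r = Rep_om ` {..t}"
  proof
    show "Field r \<subseteq> Rep_om ` {..t}" unfolding r_def Field_def by auto
    show "Rep_om ` {..t} \<subseteq> Field r" using r_iff unfolding Field_def by blast
  qed
  have succ: "is_succ_of r (Rep_om a) y \<longleftrightarrow> (\<exists>b. y = Rep_om b \<and> is_succ_of rom a b)" if "a \<le> t" for a y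
  proof -
    have "is_succ_of r (Rep_om a) (Rep_om b) \<longleftrightarrow> is_succ_of rom a b" for b
    proof -
      have "(\<exists>g. lt r (Rep_om b) g \<and> lt r g (Rep_om a)) \<longleftrightarrow> (\<exists>g. b < g \<and> g < a)"
      proof
        assume "\<exists>g. lt r (Rep_om b) g \<and> lt r g (Rep_om a)"
        then obtain g where g: "lt r (Rep_om b) g" "lt r g (Rep_om a)" by blast
        then obtain g' where "g = Rep_om g'" using ltRep by blast
        then show "\<exists>g. b < g \<and> g < a" using g lt_iff by blast
      next
        assume "\<exists>g. b < g \<and> g < a"
        then obtain g where "b < g" "g < a" by blast
        then have "lt r (Rep_om b) (Rep_om g) \<and> lt r (Rep_om g) (Rep_om a)" using lt_iff that by auto
        then show "\<exists>g. lt r (Rep_om b) g \<and> lt r g (Rep_om a)" by blast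
      qed
      then show ?thesis unfolding is_succ_of_def using lt_iff that by simp
    qed
    moreover have "y \<in> range Rep_om" if "is_succ_of r (Rep_om a) y"
      using that ltRep unfolding is_succ_of_def by blast
    ultimately show ?thesis by auto
  qed
  have lim: "liminf_is r (Rep_om a) v n \<longleftrightarrow> liminf_is rom a (\<lambda>b. v (Rep_om b)) n" if "a \<le> t" for a v n
  proof -
    have ltc: "lt r y (Rep_om a) \<longleftrightarrow> (\<exists>b. y = Rep_om b \<and> b < a)" for y
    proof
      assume y: "lt r y (Rep_om a)"
      then obtain b where "y = Rep_om b" using ltRep by blast
      then show "\<exists>b. y = Rep_om b \<and> b < a" using y lt_iff by blast
    qed (use lt_iff that in auto)
    have exl: "(\<exists>y. lt r y (Rep_om a) \<and> Q y) \<longleftrightarrow> (\<exists>b<a. Q (Rep_om b))" for Q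
      unfolding ltc by blast
    have seg: "(Rep_om g, y) \<in> r \<and> lt r y (Rep_om a) \<longleftrightarrow> (\<exists>b. y = Rep_om b \<and> g \<le> b \<and> b < a)" for g y
      unfolding ltc using r_iff that by auto
    have all: "(\<forall>y. lt r y (Rep_om a) \<longrightarrow> Q y) \<longleftrightarrow> (\<forall>b<a. Q (Rep_om b))" for Q
      using exl[of "\<lambda>y. \<not> Q y"] by blast
    have ex: "(\<exists>y. (Rep_om g, y) \<in> r \<and> lt r y (Rep_om a) \<and> Q y) \<longleftrightarrow> (\<exists>b. g \<le> b \<and> b < a \<and> Q (Rep_om b))" for g Q
      using seg[of g] by metis
    have fa: "(\<forall>y. (Rep_om g, y) \<in> r \<and> lt r y (Rep_om a) \<longrightarrow> Q y) \<longleftrightarrow> (\<forall>b. g \<le> b \<and> b < a \<longrightarrow> Q (Rep_om b))" for g Q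
      using seg[of g] by metis
    show ?thesis unfolding liminf_is_def exl all ex fa by simp
  qed
  have limv: "lim_val r (Rep_om a) v = lim_val rom a (\<lambda>b. v (Rep_om b))" if "a \<le> t" for a v
  proof -
    have "liminf_is r (Rep_om a) v = liminf_is rom a (\<lambda>b. v (Rep_om b))" using lim that by blast
    then show ?thesis unfolding lim_val_def by metis
  qed
  have f_Rep: "f (Rep_om a) = unvec (F a)" for a unfolding f_def by (simp add: Rep_om_inverse)
  have run: "if \<exists>b. is_succ_of r q b then f q = step P x (f (THE b. is_succ_of r q b))
          else f q = limit_config r q f" if q: "q \<in> Field r" "q \<noteq> Rep_om om0" for q
  proof -
    obtain a where a: "q = Rep_om a" "a \<le> t" using q(1) unfolding Fr by auto
    have a0: "a \<noteq> om0" using a q(2) by auto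
    show "if \<exists>b. is_succ_of r q b then f q = step P x (f (THE b. is_succ_of r q b))
          else f q = limit_config r q f"
    proof (cases "\<exists>b. is_succ_of rom a b")
      case True
      then obtain b where b: "is_succ_of rom a b" by blast
      have "is_succ_of r q = (\<lambda>y. y = Rep_om b)"
        using succ[OF a(2)] b rom.is_succ_unique unfolding a by blast
      moreover have "F a = vstep P x (F b)" unfolding F_def using orun.f_succ[OF b] .
      ultimately show ?thesis unfolding a f_Rep by (simp add: f_Rep vstep_def)
    next
      case False
      then have ns: "\<not> (\<exists>b. is_succ_of r q b)" using succ[OF a(2)] a by blast
      have "om0 < a" using a0 om0_le[of a] by (simp add: order_less_le)
      then have "F a = (\<lambda>i. lim_val rom a (\<lambda>b. F b i))"
        unfolding F_def using orun.f_lim[of om0 a] False by simp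
      moreover have "limit_config r q f = unvec (\<lambda>i. lim_val rom a (\<lambda>b. F b i))"
        unfolding limit_config_def a limv[OF a(2)] f_Rep by (simp add: unvec_def)
      ultimately show ?thesis using ns unfolding a f_Rep by simp
    qed
  qed
  have "halting_run P x c0 r f"
    unfolding halting_run_def
  proof (rule conjI, goal_cases)
    case 1
    show "Well_order r" unfolding r_def by (rule Well_order_Restr[OF wrel.wo])
  next
    case 2
    show ?case
    proof (rule exI[of _ "Rep_om om0"], rule exI[of _ "Rep_om t"], intro conjI)
    show "Rep_om om0 \<in> Field r" "Rep_om t \<in> Field r" unfolding Fr by auto
    show "\<forall>a\<in>Field r. (Rep_om om0, a) \<in> r \<and> (a, Rep_om t) \<in> r" unfolding Fr using r_iff by auto
    show "f (Rep_om om0) = c0" unfolding f_Rep F_def by simp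
    show "halted P (f (Rep_om t))" unfolding f_Rep halted_def using t by (simp add: unvec_def)
    show "\<forall>a\<in>Field r. a \<noteq> Rep_om t \<longrightarrow> \<not> halted P (f a)"
      unfolding Fr halted_def using nh f_Rep by (auto simp: unvec_def Rep_om_inject)
    show "\<forall>a\<in>Field r. a \<noteq> Rep_om om0 \<longrightarrow> (if (\<exists>b. is_succ_of r a b)
            then f a = step P x (f (THE b. is_succ_of r a b)) else f a = limit_config r a f)"
      using run by blast
    qed
  qed
  moreover have "snd (f (Rep_om t)) 0 = d (Suc 0)" unfolding f_Rep Ft by (simp add: unvec_def)
  moreover have "Rep_om t \<in> Field r" "\<forall>a\<in>Field r. (a, Rep_om t) \<in> r" unfolding Fr using r_iff by auto
  ultimately show ?thesis unfolding halts_with_def by blast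
qed

theorem halts_with_iff:
  "halts_with P x c0 i \<longleftrightarrow> (\<exists>V d. trun (vstep P x) (vec c0) V d \<and> length P \<le> d 0 \<and> d (Suc 0) = i)"
proof
  assume "halts_with P x c0 i"
  then obtain r :: "nat set rel" and f m where rf: "halting_run P x c0 r f" "m \<in> Field r"
    "\<forall>a\<in>Field r. (a, m) \<in> r" "snd (f m) 0 = i" unfolding halts_with_def by blast
  then show "\<exists>V d. trun (vstep P x) (vec c0) V d \<and> length P \<le> d 0 \<and> d (Suc 0) = i"
    using halting_run_trun[OF rf(1-3)] rf(4) by (metis old.nat.simps(4) old.nat.simps(5) vec_def)
next
  assume "\<exists>V d. trun (vstep P x) (vec c0) V d \<and> length P \<le> d 0 \<and> d (Suc 0) = i"
  then show "halts_with P x c0 i" using trun_halts_with by blast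
qed

section \<open>Register machine programming\<close>

lemma is_liminf_image:
  assumes "\<And>n v. v \<in> V n \<Longrightarrow> \<phi> v j = v i + k"
  shows "is_liminf (\<lambda>n. \<phi> ` V n) j (x + k) \<longleftrightarrow> is_liminf V i x"
proof -
  have "(\<forall>v\<in>\<phi> ` V n. x + k \<le> v j) = (\<forall>v\<in>V n. x \<le> v i)" for n using assms[of _ n] by auto
  moreover have "(\<exists>v\<in>\<phi> ` V n. v j = x + k) = (\<exists>v\<in>V n. v i = x)" for n using assms[of _ n] by auto
  ultimately show ?thesis unfolding is_liminf_def by simp
qed

text \<open>Transport of runs along maps each of whose components is constant or a shifted
  component of the argument; shifted components have to be bounded since divergent
  components are reset to 0.\<close>

lemma trun_map:
  assumes "trun G c V d"
    and "\<And>v. v \<in> V \<Longrightarrow> \<phi> (G v) = H (\<phi> v)"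
    and "\<And>v j. \<phi> v j = (case p j of None \<Rightarrow> q j | Some i \<Rightarrow> v i + k j)"
    and "\<And>j i. p j = Some i \<Longrightarrow> k j \<noteq> 0 \<Longrightarrow> \<exists>B. \<forall>v\<in>V. v i \<le> (B::nat)"
  shows "trun H (\<phi> c) (\<phi> ` V) (\<phi> d)"
  using assms(1,2,4)
proof (induction rule: trun.induct)
  case (trun_refl c)
  show ?case using trun.trun_refl by simp
next
  case (trun_step c V d)
  have "trun H (\<phi> c) (\<phi> ` V) (\<phi> d)" by (rule trun_step.IH) (use trun_step.prems in auto, meson)
  then have "trun H (\<phi> c) (insert (\<phi> d) (\<phi> ` V)) (H (\<phi> d))" by (rule trun.trun_step)
  then show ?case using trun_step.prems(1)[of d] by simp
next
  case (trun_lim c V)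
  have "trun H (\<phi> (c n)) (\<phi> ` V n) (\<phi> (c (Suc n)))" for n
    by (rule trun_lim.IH) (use trun_lim.prems in auto, meson)
  then have "trun H (\<phi> (c 0)) (\<Union>n. \<phi> ` V n) (lim_vec (\<lambda>n. \<phi> ` V n))"
    using trun.trun_lim[of H "\<lambda>n. \<phi> (c n)" "\<lambda>n. \<phi> ` V n"] trun_lim(2) by blast
  moreover have "lim_vec (\<lambda>n. \<phi> ` V n) j = \<phi> (lim_vec V) j" for j
  proof (cases "p j")
    case None
    have "lim_vec (\<lambda>n. \<phi> ` V n) j = q j"
      by (rule lim_vec_const) (use trun_lim(2) assms(3) None in auto)
    then show ?thesis using assms(3)[of "lim_vec V" j] None by simp
  next
    case (Some i)
    have im: "is_liminf (\<lambda>n. \<phi> ` V n) j (x + k j) \<longleftrightarrow> is_liminf V i x" for x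
      by (rule is_liminf_image) (use assms(3) Some in auto)
    show ?thesis
    proof (cases "\<exists>x. is_liminf V i x")
      case True
      then obtain x where "is_liminf V i x" by blast
      then show ?thesis using im[of x] lim_vec_eq assms(3)[of "lim_vec V" j] Some by simp
    next
      case False
      have "k j = 0"
      proof (rule ccontr)
        assume "k j \<noteq> 0"
        then obtain B where "\<forall>v\<in>(\<Union>n. V n). v i \<le> B" using trun_lim.prems(2) Some by blast
        then have "\<forall>N. \<exists>n\<ge>N. \<exists>v\<in>V n. v i \<le> B" using trun_lim(2) by (metis UNIV_I UN_I all_not_in_conv order_refl)
        then show False using ex_is_liminf False by blast
      qed
      then have "\<not> is_liminf (\<lambda>n. \<phi> ` V n) j x" for x using im[of x] False by simp
      then show ?thesis using False lim_vec_none assms(3)[of "lim_vec V" j] Some \<open>k j = 0\<close> by simp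
    qed
  qed
  ultimately show ?case by (simp add: image_UN fun_eq_iff[symmetric]) (metis ext)
qed

abbreviation cfg :: "nat \<Rightarrow> (nat \<Rightarrow> nat) \<Rightarrow> vec" where
  "cfg l R \<equiv> case_nat l R"

lemma vstep_halt: "length P \<le> v 0 \<Longrightarrow> vstep P w v = v"
  unfolding vstep_def step_def halted_def by (simp add: unvec_def) (simp add: vec_def fun_eq_iff split: nat.splits)

lemma vstep_exec:
  "l < length P \<Longrightarrow> vstep P w (cfg l R) = vec (exec w (P ! l) (l, R))"
  unfolding vstep_def step_def halted_def unvec_def by simp

lemma cfg_eta: "v = cfg (v 0) (\<lambda>i. v (Suc i))"
  by (auto split: nat.splits)

lemma cfg_eq [simp]: "cfg l R = cfg l' R' \<longleftrightarrow> l = l' \<and> R = R'"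
  by (auto simp: fun_eq_iff split: nat.splits)

text \<open>Both configurations lie on the same run over the countable ordinals, and the earlier one
  never changes again.\<close>

lemma trun_unique:
  assumes "trun G c V d" "trun G c W e" "G d = d" "G e = e"
  shows "d = e"
proof -
  obtain t where t: "orun G c t = d" using assms(1) trun_iff by blast
  obtain s where s: "orun G c s = e" using assms(2) trun_iff by blast
  show ?thesis
  proof (cases "s \<le> t")
    case True
    then show ?thesis using orun_trun[OF True, of G c] trun_fixed[of G e] s t assms(4) by metis
  next
    case False
    then have "t \<le> s" by simp
    then show ?thesis using orun_trun[of t s G c] trun_fixed[of G d] s t assms(3) by metis
  qed
qed

text \<open>A run may linger at a halted configuration; this cuts it where \<open>H\<close> is first
  reached.\<close>

lemma trun_first:
  assumes "trun G c V d" "H d" "\<And>v. H v \<Longrightarrow> G v = v"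
  shows "\<exists>W\<subseteq>V. trun G c W d \<and> (\<forall>v\<in>W. \<not> H v)"
proof -
  obtain t0 where t0: "orun G c t0 = d" "V = orun G c ` {..<t0}" using assms(1) trun_iff by metis
  define t where "t = (LEAST t. H (orun G c t))"
  have t: "H (orun G c t)" unfolding t_def by (rule LeastI[of _ t0]) (simp add: t0 assms(2))
  have nh: "\<not> H (orun G c s)" if "s < t" for s using that not_less_Least unfolding t_def by blast
  have tt: "t \<le> t0" unfolding t_def by (rule Least_le) (simp add: t0 assms(2))
  have "d = orun G c t" using orun_trun[OF tt, of G c] trun_fixed[of G "orun G c t"] t0 assms(3)[OF t] by auto
  then show ?thesis using nh tt t0(2) by (intro exI[of _ "orun G c ` {..<t}"]) (auto simp: trun_iff)
qed

section \<open>Relocation and composition of programs\<close>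

fun rl :: "nat \<Rightarrow> nat \<Rightarrow> instr \<Rightarrow> instr" where
  "rl a b (Zero n) = Zero (n + b)"
| "rl a b (Inc n) = Inc (n + b)"
| "rl a b (Copy i j) = Copy (i + b) (j + b)"
| "rl a b (JumpEq i j k) = JumpEq (i + b) (j + b) (k + a)"
| "rl a b (OracleJump i k) = OracleJump (i + b) (k + a)"

fun ibd :: "instr \<Rightarrow> nat" where
  "ibd (Zero n) = Suc n"
| "ibd (Inc n) = Suc n"
| "ibd (Copy i j) = Suc (max i j)"
| "ibd (JumpEq i j k) = Suc (max i j)"
| "ibd (OracleJump i k) = Suc i"

definition regs_below :: "nat \<Rightarrow> program \<Rightarrow> bool" where
  "regs_below N C \<longleftrightarrow> (\<forall>I\<in>set C. ibd I \<le> N)"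

lemma ex_regs_below: "\<exists>N. \<forall>M\<ge>N. regs_below M C"
proof -
  have "\<forall>M \<ge> Max (insert 0 (ibd ` set C)). regs_below M C" unfolding regs_below_def by auto
  then show ?thesis by blast
qed

text \<open>\<open>blk S C w R R'\<close>: executing \<open>C\<close> from registers \<open>R\<close> reaches its end with registers \<open>R'\<close>,
  the registers in \<open>S\<close> being constant throughout.\<close>

definition blk :: "nat set \<Rightarrow> program \<Rightarrow> nat set \<Rightarrow> (nat \<Rightarrow> nat) \<Rightarrow> (nat \<Rightarrow> nat) \<Rightarrow> bool" where
  "blk S C w R R' \<longleftrightarrow> (\<exists>V. trun (vstep C w) (cfg 0 R) V (cfg (length C) R') \<and>
     (\<forall>v\<in>V. v 0 < length C \<and> (\<forall>i\<in>S. v (Suc i) = R i))) \<and> (\<forall>i\<in>S. R' i = R i)"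

lemma blkI:
  assumes "trun (vstep C w) (cfg 0 R) V (cfg (length C) R')"
    and "\<And>v i. v \<in> V \<Longrightarrow> i \<in> S \<Longrightarrow> v (Suc i) = R i" "\<And>i. i \<in> S \<Longrightarrow> R' i = R i"
  shows "blk S C w R R'"
proof -
  obtain W where "W \<subseteq> V" "trun (vstep C w) (cfg 0 R) W (cfg (length C) R')" "\<forall>v\<in>W. \<not> length C \<le> v 0"
    using trun_first[OF assms(1), of "\<lambda>v. length C \<le> v 0"] vstep_halt by auto
  then show ?thesis unfolding blk_def using assms(2,3) by (meson not_le subsetD)
qed

lemma blk_unique: "blk S C w R X \<Longrightarrow> blk T C w R Y \<Longrightarrow> X = Y"
  unfolding blk_def using trun_unique[of "vstep C w" "cfg 0 R" _ "cfg (length C) X" _ "cfg (length C) Y"]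
  by (auto simp: vstep_halt)

lemma blk_mono: "blk S C w R X \<Longrightarrow> T \<subseteq> S \<Longrightarrow> blk T C w R X"
  unfolding blk_def by (metis subsetD)

text \<open>Places a configuration of a subprogram into its host: lines are shifted by
  \<open>a\<close>, and its registers follow \<open>b\<close> registers that keep the contents
  \<open>Q\<close>.\<close>

definition emb :: "nat \<Rightarrow> nat \<Rightarrow> (nat \<Rightarrow> nat) \<Rightarrow> vec \<Rightarrow> vec" where
  "emb a b Q v j = (if j = 0 then v 0 + a else if j \<le> b then Q (j - 1) else v (j - b))"

lemma emb_cfg: "emb a b Q (cfg l R) = cfg (l + a) (\<lambda>i. if i < b then Q i else R (i - b))"
  by (auto simp: emb_def fun_eq_iff Suc_diff_le split: nat.splits)

lemma blk_embed:
  assumes "blk S C w (\<lambda>i. Q (i + b)) R'"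
    and "a + length C \<le> length P" "\<And>l. l < length C \<Longrightarrow> P ! (a + l) = rl a b (C ! l)"
  shows "\<exists>V. trun (vstep P w) (cfg a Q) V (cfg (a + length C) (\<lambda>i. if i < b then Q i else R' (i - b))) \<and>
     (\<forall>v\<in>V. (\<forall>i<b. v (Suc i) = Q i) \<and> (\<forall>i\<in>S. v (Suc (i + b)) = Q (i + b)))"
proof -
  let ?R = "\<lambda>i. Q (i + b)"
  obtain V where V: "trun (vstep C w) (cfg 0 ?R) V (cfg (length C) R')"
     "\<And>v. v \<in> V \<Longrightarrow> v 0 < length C" "\<And>v i. v \<in> V \<Longrightarrow> i\<in>S \<Longrightarrow> v (Suc i) = ?R i"
    using assms(1) unfolding blk_def by blast
  have "trun (vstep P w) (emb a b Q (cfg 0 ?R)) (emb a b Q ` V) (emb a b Q (cfg (length C) R'))"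
  proof (rule trun_map[OF V(1), where p = "\<lambda>j. if j = 0 then Some 0 else if j \<le> b then None else Some (j - b)"
        and q = "\<lambda>j. Q (j - 1)" and k = "\<lambda>j. if j = 0 then a else 0"])
    fix v assume v: "v \<in> V"
    define l R where "l = v 0" and "R = (\<lambda>i. v (Suc i))"
    have vl: "v = cfg l R" unfolding l_def R_def by (rule cfg_eta)
    have l: "l < length C" using V(2)[OF v] unfolding l_def .
    have "vstep P w (emb a b Q v) = vec (exec w (rl a b (C ! l)) (l + a, \<lambda>i. if i < b then Q i else R (i - b)))"
      unfolding vl emb_cfg using l assms(2) assms(3)[of l] by (subst vstep_exec) (auto simp: add.commute)
    moreover have "emb a b Q (vstep C w v) = vec (exec w (rl a b (C ! l)) (l + a, \<lambda>i. if i < b then Q i else R (i - b)))"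
      unfolding vl vstep_exec[OF l] vec_def
      by (cases "C ! l") (auto simp: emb_cfg fun_eq_iff split: nat.splits)
    ultimately show "emb a b Q (vstep C w v) = vstep P w (emb a b Q v)" by simp
  next
    fix v j show "emb a b Q v j = (case if j = 0 then Some 0 else if j \<le> b then None else Some (j - b) of
          None \<Rightarrow> Q (j - 1) | Some i \<Rightarrow> v i + (if j = 0 then a else 0))"
      unfolding emb_def by auto
  next
    \<comment> \<open>Only the line number is shifted, and it is bounded by the length of the
      program.\<close>
    fix j i assume "(if j = 0 then Some 0 else if j \<le> b then None else Some (j - b)) = Some i"
      "(if j = 0 then a else 0) \<noteq> 0"
    then have "i = 0" by (auto split: if_splits)
    then show "\<exists>B. \<forall>v\<in>V. v i \<le> B" using V(2) by (auto intro!: exI[of _ "length C"] less_imp_le)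
  qed
  moreover have "emb a b Q (cfg 0 ?R) = cfg a Q" unfolding emb_cfg by auto
  ultimately show ?thesis unfolding emb_cfg
    by (intro exI[of _ "emb a b Q ` V"]) (auto simp: emb_def V(3) add.commute)
qed

text \<open>Replacing the registers that the program does not mention by fixed contents commutes
  with each of its instructions.\<close>

lemma blk_indep:
  assumes "blk S C w R R'" "regs_below N C" "\<And>i. i < N \<Longrightarrow> Q i = R i"
  shows "blk (S \<union> {N..}) C w Q (\<lambda>i. if i < N then R' i else Q i)"
proof -
  define \<phi> where "\<phi> v j = (if j \<le> N then v j else Q (j - 1))" for v :: vec and j
  have cf: "\<phi> (cfg l X) = cfg l (\<lambda>i. if i < N then X i else Q i)" for l X
    unfolding \<phi>_def by (auto split: nat.splits)
  obtain V where V: "trun (vstep C w) (cfg 0 R) V (cfg (length C) R')"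
     "\<And>v. v \<in> V \<Longrightarrow> v 0 < length C" "\<And>v i. v \<in> V \<Longrightarrow> i\<in>S \<Longrightarrow> v (Suc i) = R i"
     "\<And>i. i \<in> S \<Longrightarrow> R' i = R i"
    using assms(1) unfolding blk_def by blast
  have "trun (vstep C w) (\<phi> (cfg 0 R)) (\<phi> ` V) (\<phi> (cfg (length C) R'))"
  proof (rule trun_map[OF V(1), where p = "\<lambda>j. if j \<le> N then Some j else None"
        and q = "\<lambda>j. Q (j - 1)" and k = "\<lambda>j. 0"])
    fix v assume v: "v \<in> V"
    define l X where "l = v 0" and "X = (\<lambda>i. v (Suc i))"
    have vl: "v = cfg l X" unfolding l_def X_def by (rule cfg_eta)
    have l: "l < length C" using V(2)[OF v] unfolding l_def .
    then have "ibd (C ! l) \<le> N" using assms(2) unfolding regs_below_def by auto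
    then show "\<phi> (vstep C w v) = vstep C w (\<phi> v)"
      unfolding vl cf vstep_exec[OF l] vec_def
      by (cases "C ! l") (auto simp: cf fun_eq_iff split: nat.splits)
  qed (auto simp: \<phi>_def)
  moreover have "\<phi> (cfg 0 R) = cfg 0 Q" unfolding cf using assms(3) by auto
  ultimately have "trun (vstep C w) (cfg 0 Q) (\<phi> ` V) (cfg (length C) (\<lambda>i. if i < N then R' i else Q i))"
    unfolding cf by simp
  then show ?thesis
    by (rule blkI) (use V(3,4) assms(3) in \<open>auto simp: \<phi>_def\<close>)
qed

definition seqp :: "program \<Rightarrow> program \<Rightarrow> program" (infixr ";;" 60) where
  "A ;; B = A @ map (rl (length A) 0) B"

lemma rl_0 [simp]: "rl 0 0 I = I" by (cases I) auto

lemma length_seqp [simp]: "length (A ;; B) = length A + length B"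
  unfolding seqp_def by simp

lemma blk_seqp:
  assumes "blk S A w R R1" "blk S B w R1 R2"
  shows "blk S (A ;; B) w R R2"
proof -
  have 1: "\<exists>V. trun (vstep (A ;; B) w) (cfg 0 R) V (cfg (length A) R1) \<and> (\<forall>v\<in>V. \<forall>i\<in>S. v (Suc i) = R i)"
    using blk_embed[of S A w R 0 R1 0 "A ;; B"] assms(1) by (simp add: seqp_def nth_append)
  have 2: "\<exists>V. trun (vstep (A ;; B) w) (cfg (length A) R1) V (cfg (length A + length B) R2) \<and> (\<forall>v\<in>V. \<forall>i\<in>S. v (Suc i) = R1 i)"
    using blk_embed[of S B w R1 0 R2 "length A" "A ;; B"] assms(2) by (simp add: seqp_def nth_append)
  obtain V W where V: "trun (vstep (A ;; B) w) (cfg 0 R) V (cfg (length A) R1)" "\<forall>v\<in>V. \<forall>i\<in>S. v (Suc i) = R i"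
    and W: "trun (vstep (A ;; B) w) (cfg (length A) R1) W (cfg (length A + length B) R2)" "\<forall>v\<in>W. \<forall>i\<in>S. v (Suc i) = R1 i"
    using 1 2 by blast
  have "\<forall>i\<in>S. R1 i = R i" "\<forall>i\<in>S. R2 i = R1 i" using assms unfolding blk_def by blast+
  then show ?thesis using trun_trans[OF W(1) V(1)] V(2) W(2)
    by (intro blkI[of _ _ _ "V \<union> W"]) auto
qed

lemma blk_Nil: "blk S [] w R R"
  by (rule blkI[of _ _ _ "{}"]) (auto intro: trun_refl)

lemma blk_Copy: "j \<notin> S \<Longrightarrow> blk S [Copy i j] w R (R(j := R i))"
  by (rule blkI[of _ _ _ "{cfg 0 R}"])
     (use trun_step1[of "vstep [Copy i j] w" "cfg 0 R"] in \<open>auto simp: vstep_exec vec_def\<close>)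

lemma blk_shift:
  assumes "blk S C w (\<lambda>i. Q (i + b)) R'"
  shows "blk ({..<b} \<union> (\<lambda>i. i + b) ` S) (map (rl 0 b) C) w Q (\<lambda>i. if i < b then Q i else R' (i - b))"
proof -
  have S: "\<forall>i\<in>S. R' i = Q (i + b)" using assms unfolding blk_def by blast
  have "\<exists>V. trun (vstep (map (rl 0 b) C) w) (cfg 0 Q) V (cfg (length C) (\<lambda>i. if i < b then Q i else R' (i - b))) \<and>
     (\<forall>v\<in>V. (\<forall>i<b. v (Suc i) = Q i) \<and> (\<forall>i\<in>S. v (Suc (i + b)) = Q (i + b)))"
    using blk_embed[OF assms, of 0 "map (rl 0 b) C"] by simp
  then show ?thesis using S by (elim exE conjE, intro blkI) auto
qed

definition seqs :: "program list \<Rightarrow> program" where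
  "seqs Cs = foldr seqp Cs []"

lemma seqs_simps [simp]: "seqs [] = []" "seqs (C # Cs) = C ;; seqs Cs"
  unfolding seqs_def by auto

lemma blk_seqs:
  assumes "\<And>k. k < n \<Longrightarrow> blk S (Cs k) w (R k) (R (Suc k))"
  shows "blk S (seqs (map Cs [0..<n])) w (R 0) (R n)"
proof -
  have "blk S (seqs (map Cs [n - k..<n])) w (R (n - k)) (R n)" if "k \<le> n" for k
    using that
  proof (induction k)
    case 0
    then show ?case using blk_Nil by simp
  next
    case (Suc k)
    then have "[n - Suc k..<n] = (n - Suc k) # [n - k..<n]"
      by (metis Suc_diff_Suc Suc_le_lessD diff_less upt_conv_Cons zero_less_Suc order_less_le_trans)
    moreover have "Suc (n - Suc k) = n - k" using Suc.prems by simp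
    ultimately show ?case using Suc assms[of "n - Suc k"] blk_seqp by auto
  qed
  from this[of n] show ?thesis by simp
qed

lemma blk_seqs_ex:
  assumes "\<And>k R. k < n \<Longrightarrow> I k R \<Longrightarrow> \<exists>R'. blk S (Cs k) w R R' \<and> I (Suc k) R'" "I 0 R"
  shows "\<exists>R'. blk S (seqs (map Cs [0..<n])) w R R' \<and> I n R'"
proof -
  have "\<exists>f. \<forall>k. ((k \<le> n \<longrightarrow> I k (f k)) \<and> (k = 0 \<longrightarrow> f k = R)) \<and> (k < n \<longrightarrow> blk S (Cs k) w (f k) (f (Suc k)))"
    by (rule dependent_nat_choice) (use assms in \<open>auto simp: Suc_le_eq\<close>)
  then obtain f where "\<And>k. k \<le> n \<Longrightarrow> I k (f k)" "f 0 = R" "\<And>k. k < n \<Longrightarrow> blk S (Cs k) w (f k) (f (Suc k))"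
    by auto
  then show ?thesis using blk_seqs[of n S Cs w f] by auto
qed

subsection \<open>Computable functions of the register contents\<close>

text \<open>All registers count as arguments, so no work register may be assumed empty.
  \<open>computes_indep\<close> shows that only finitely many of them matter.\<close>

definition computes :: "program \<Rightarrow> (nat set \<Rightarrow> (nat \<Rightarrow> nat) \<Rightarrow> nat) \<Rightarrow> bool" where
  "computes C f \<longleftrightarrow> (\<forall>w R. \<exists>R'. blk {} C w R R' \<and> R' 0 = f w R)"

definition cf :: "(nat set \<Rightarrow> (nat \<Rightarrow> nat) \<Rightarrow> nat) \<Rightarrow> bool" where
  "cf f \<longleftrightarrow> (\<exists>C. computes C f)"

lemma computes_indep:
  assumes "computes C f" "regs_below N C" "0 < N" "\<And>i. i < N \<Longrightarrow> Q i = R i"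
  shows "f w Q = f w R"
proof -
  obtain X where X: "blk {} C w R X" "X 0 = f w R" using assms(1) unfolding computes_def by blast
  obtain Y where Y: "blk {} C w Q Y" "Y 0 = f w Q" using assms(1) unfolding computes_def by blast
  have "Y = (\<lambda>i. if i < N then X i else Q i)" using blk_indep[OF X(1) assms(2,4)] Y blk_unique by blast
  then show ?thesis using X Y assms(3) by auto
qed

text \<open>Layout: the arguments stay in the registers below \<open>N\<close>, a copy of them is
  processed in the next \<open>N\<close> registers, and the result goes to register
  \<open>2 * N + d\<close>. Successive calls thus see the same arguments and keep each other's
  results.\<close>

definition call :: "nat \<Rightarrow> program \<Rightarrow> nat \<Rightarrow> program" where
  "call N C d = seqs (map (\<lambda>i. [Copy i (N + i)]) [0..<N]) ;; map (rl 0 N) C ;; [Copy N (2 * N + d)]"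

lemma blk_call:
  assumes "computes C f" "regs_below N C" "0 < N"
  shows "\<exists>Q'. blk ({..<N} \<union> ({2*N..} - {2*N+d})) (call N C d) w Q Q' \<and> Q' (2*N+d) = f w Q"
proof -
  let ?S = "{..<N} \<union> ({2*N..} - {2*N+d})"
  define Q1 where "Q1 k = (\<lambda>i. if N \<le> i \<and> i < N + k then Q (i - N) else Q i)" for k
  have "blk ?S (seqs (map (\<lambda>i. [Copy i (N + i)]) [0..<N])) w (Q1 0) (Q1 N)"
  proof (rule blk_seqs)
    fix k assume "k < N"
    then have "(Q1 k)(N + k := Q1 k k) = Q1 (Suc k)" "N + k \<notin> ?S" by (auto simp: Q1_def fun_eq_iff)
    then show "blk ?S [Copy k (N + k)] w (Q1 k) (Q1 (Suc k))"
      using blk_Copy[of "N + k" ?S k w "Q1 k"] by simp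
  qed
  moreover have "Q1 0 = Q" by (auto simp: Q1_def)
  ultimately have 1: "blk ?S (seqs (map (\<lambda>i. [Copy i (N + i)]) [0..<N])) w Q (Q1 N)" by simp
  obtain X where X: "blk {} C w Q X" "X 0 = f w Q" using assms(1) unfolding computes_def by blast
  have "blk ({} \<union> {N..}) C w (\<lambda>i. Q1 N (i + N)) (\<lambda>i. if i < N then X i else Q1 N (i + N))"
    by (rule blk_indep[OF X(1) assms(2)]) (auto simp: Q1_def)
  from blk_shift[OF this] obtain Y where
    Y: "blk ({..<N} \<union> (\<lambda>i. i + N) ` ({} \<union> {N..})) (map (rl 0 N) C) w (Q1 N) Y" "Y N = X 0"
    using assms(3) by (auto)
  have "?S \<subseteq> {..<N} \<union> (\<lambda>i. i + N) ` ({} \<union> {N..})"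
  proof
    fix x assume "x \<in> ?S"
    then consider "x < N" | "x = (x - N) + N" "N \<le> x - N" by auto
    then show "x \<in> {..<N} \<union> (\<lambda>i. i + N) ` ({} \<union> {N..})"
    proof cases
      case 2
      then show ?thesis by (intro UnI2 image_eqI[of _ _ "x - N"]) auto
    qed auto
  qed
  then have 2: "blk ?S (map (rl 0 N) C) w (Q1 N) Y" using Y(1) blk_mono by blast
  have 3: "blk ?S [Copy N (2 * N + d)] w Y (Y(2*N+d := Y N))" by (rule blk_Copy) simp
  have "blk ?S (call N C d) w Q (Y(2*N+d := Y N))"
    unfolding call_def by (rule blk_seqp[OF 1 blk_seqp[OF 2 3]])
  then show ?thesis using Y(2) X(2) by auto
qed

lemma ex_common_bound: "\<exists>N>0. N \<ge> K \<and> (\<forall>i<(m::nat). regs_below N (C i))"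
proof -
  obtain f where f: "\<And>i M. M \<ge> f i \<Longrightarrow> regs_below M (C i)"
    using choice[of "\<lambda>i N. \<forall>M\<ge>N. regs_below M (C i)"] ex_regs_below by blast
  let ?N = "Max (f ` {..<m} \<union> {Suc K})"
  have "Suc K \<le> ?N" "\<And>i. i < m \<Longrightarrow> f i \<le> ?N" by auto
  moreover have "0 < ?N" "K \<le> ?N" using calculation(1) by linarith+
  ultimately show ?thesis using f by (intro exI[of _ ?N]) blast
qed

lemma blk_calls:
  assumes "\<And>i. i < m \<Longrightarrow> computes (C i) (g i)" "\<And>i. i < m \<Longrightarrow> regs_below N (C i)" "0 < N"
  shows "\<exists>Q'. blk {..<N} (seqs (map (\<lambda>i. call N (C i) i) [0..<m])) w Q Q' \<and> (\<forall>i<m. Q' (2*N+i) = g i w Q)"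
proof -
  have "\<exists>R'. blk {..<N} (seqs (map (\<lambda>i. call N (C i) i) [0..<m])) w Q R' \<and>
    ((\<forall>i<N. R' i = Q i) \<and> (\<forall>i<m. R' (2*N+i) = g i w Q))"
  proof (rule blk_seqs_ex[where I = "\<lambda>k R. (\<forall>i<N. R i = Q i) \<and> (\<forall>i<k. R (2*N+i) = g i w Q)"])
    fix k R assume k: "k < m" and R: "(\<forall>i<N. R i = Q i) \<and> (\<forall>i<k. R (2*N+i) = g i w Q)"
    obtain R' where R': "blk ({..<N} \<union> ({2*N..} - {2*N+k})) (call N (C k) k) w R R'" "R' (2*N+k) = g k w R"
      using blk_call[OF assms(1,2)[OF k] assms(3)] by blast
    have "g k w R = g k w Q" by (rule computes_indep[OF assms(1,2)[OF k] assms(3)]) (use R in blast)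
    moreover have same: "R' i = R i" if "i \<in> {..<N} \<union> ({2*N..} - {2*N+k})" for i
      using R'(1) that unfolding blk_def by blast
    then have "R' i = Q i" if "i < N" for i using R that by auto
    moreover have "R' (2*N+i) = g i w Q" if "i < k" for i
      using R that same[of "2*N+i"] by auto
    ultimately show "\<exists>R'. blk {..<N} (call N (C k) k) w R R' \<and>
        (\<forall>i<N. R' i = Q i) \<and> (\<forall>i<Suc k. R' (2*N+i) = g i w Q)"
      using R' blk_mono[OF R'(1), of "{..<N}"] by (auto simp: less_Suc_eq intro!: exI[of _ R'])
  qed auto
  then show ?thesis by blast
qed

text \<open>All arguments are computed before any register is overwritten. Although there are
  infinitely many \<open>g i\<close>, only \<open>M\<close> of them are called, where
  \<open>F\<close> mentions only registers below \<open>M\<close>.\<close>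

theorem cf_run:
  assumes "\<And>w e. \<exists>X. blk {} F w (\<lambda>i. g i w e) X \<and> X 0 = out w e" "\<And>i. cf (g i)"
  shows "cf out"
proof -
  obtain C where C: "\<And>i. computes (C i) (g i)" using assms(2) unfolding cf_def by metis
  obtain M where M: "0 < M" "regs_below M F" using ex_common_bound[of 0 1 "\<lambda>_. F"] by auto
  obtain N where N: "0 < N" "M \<le> N" "\<And>i. i < M \<Longrightarrow> regs_below N (C i)"
    using ex_common_bound[of M M C] by auto
  define P where "P = seqs (map (\<lambda>i. call N (C i) i) [0..<M]) ;; seqs (map (\<lambda>i. [Copy (2*N+i) i]) [0..<M]) ;; F"
  have "computes P out"
    unfolding computes_def
  proof (intro allI)
    fix w R
    obtain Q where Q: "blk {..<N} (seqs (map (\<lambda>i. call N (C i) i) [0..<M])) w R Q"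
      "\<And>i. i < M \<Longrightarrow> Q (2*N+i) = g i w R"
      using blk_calls[of M C g N w R] C N(1,3) by auto
    define Q1 where "Q1 k = (\<lambda>i. if i < k then Q (2*N+i) else Q i)" for k
    have "blk {} (seqs (map (\<lambda>i. [Copy (2*N+i) i]) [0..<M])) w (Q1 0) (Q1 M)"
    proof (rule blk_seqs)
      fix k assume "k < M"
      then have "(Q1 k)(k := Q1 k (2*N+k)) = Q1 (Suc k)" by (auto simp: Q1_def fun_eq_iff)
      then show "blk {} [Copy (2 * N + k) k] w (Q1 k) (Q1 (Suc k))"
        using blk_Copy[of k "{}" "2*N+k" w "Q1 k"] by simp
    qed
    moreover have "Q1 0 = Q" by (simp add: Q1_def)
    moreover obtain X where X: "blk {} F w (\<lambda>i. g i w R) X" "X 0 = out w R" using assms(1) by blast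
    moreover have "blk ({} \<union> {M..}) F w (Q1 M) (\<lambda>i. if i < M then X i else Q1 M i)"
      by (rule blk_indep[OF X(1) M(2)]) (simp add: Q1_def Q(2))
    then have "blk {} F w (Q1 M) (\<lambda>i. if i < M then X i else Q1 M i)" using blk_mono by blast
    ultimately have "blk {} P w R (\<lambda>i. if i < M then X i else Q1 M i)"
      unfolding P_def using blk_seqp blk_mono[OF Q(1), of "{}"] by fastforce
    then show "\<exists>R'. blk {} P w R R' \<and> R' 0 = out w R"
      using X(2) M(1) by (intro exI[of _ "\<lambda>i. if i < M then X i else Q1 M i"] conjI) simp_all
  qed
  then show ?thesis unfolding cf_def by blast
qed

theorem cf_subst:
  assumes "cf f" "\<And>i. cf (g i)"
  shows "cf (\<lambda>w e. f w (\<lambda>i. g i w e))"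
proof -
  obtain F where "computes F f" using assms(1) unfolding cf_def by blast
  then have "\<exists>X. blk {} F w (\<lambda>i. g i w e) X \<and> X 0 = f w (\<lambda>i. g i w e)" for w e
    unfolding computes_def by blast
  then show ?thesis using assms(2) by (rule cf_run)
qed

subsection \<open>Transfinite loops\<close>

definition env_step :: "nat \<Rightarrow> (nat \<Rightarrow> (nat \<Rightarrow> nat) \<Rightarrow> nat) \<Rightarrow> (nat \<Rightarrow> nat) \<Rightarrow> (nat \<Rightarrow> nat)" where
  "env_step m g e = (\<lambda>i. if i < m then g i e else e i)"

definition loopp :: "nat \<Rightarrow> nat \<Rightarrow> (nat \<Rightarrow> program) \<Rightarrow> program" where
  "loopp N m C = (let A = seqs (map (\<lambda>i. call N (C i) i) [0..<Suc m]); L = length A in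
     A @ [Zero N, JumpEq (2*N+m) N (L + 3), JumpEq 0 0 (L + 4 + m)] @
     map (\<lambda>i. Copy (2*N+i) i) [0..<m] @ [JumpEq 0 0 0])"

text \<open>Besides the result of a pass, \<open>loop_run\<close> needs that in its course each
  environment register shows only its old or its new value: otherwise intermediate values could
  spoil the inferior limits.\<close>

lemma loop_iteration:
  assumes C: "\<And>i. i \<le> m \<Longrightarrow> computes (C i) (g i)" "\<And>i. i \<le> m \<Longrightarrow> regs_below N (C i)"
    and N: "0 < N" "m \<le> N" and QE: "\<And>i. i < N \<Longrightarrow> Q i = e i"
    and P: "P = loopp N m C"
  shows "if g m w e = 0
    then \<exists>V Q'. trun (vstep P w) (cfg 0 Q) V (cfg 0 Q') \<and> (\<forall>i<N. Q' i = env_step m (\<lambda>i. g i w) e i) \<and> cfg 0 Q \<in> V \<and>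
      (\<forall>v\<in>V. \<forall>i<N. v (Suc i) \<in> {e i, env_step m (\<lambda>i. g i w) e i})
    else \<exists>V Q'. trun (vstep P w) (cfg 0 Q) V (cfg (length P) Q') \<and> (\<forall>i<N. Q' i = e i)"
proof -
  define A where "A = seqs (map (\<lambda>i. call N (C i) i) [0..<Suc m])"
  define L where "L = length A"
  have P': "P = A @ [Zero N, JumpEq (2*N+m) N (L + 3), JumpEq 0 0 (L + 4 + m)] @
     map (\<lambda>i. Copy (2*N+i) i) [0..<m] @ [JumpEq 0 0 0]"
    unfolding P loopp_def Let_def A_def L_def by simp
  have lenP: "length P = L + 4 + m" unfolding P' L_def by simp
  have nth: "P ! L = Zero N" "P ! (Suc L) = JumpEq (2*N+m) N (L + 3)"
    "P ! (Suc (Suc L)) = JumpEq 0 0 (L + 4 + m)"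
    "\<And>i. i < m \<Longrightarrow> P ! (L + 3 + i) = Copy (2*N+i) i" "P ! (L + 3 + m) = JumpEq 0 0 0"
    unfolding P' L_def by (simp_all add: nth_append)
  obtain Q1 where Q1: "blk {..<N} A w Q Q1" "\<And>i. i < Suc m \<Longrightarrow> Q1 (2*N+i) = g i w Q"
    using blk_calls[of "Suc m" C g N w Q] C N(1) unfolding A_def by auto
  have gQ: "g i w Q = g i w e" if "i \<le> m" for i
    using computes_indep[OF C[OF that] N(1)] QE by blast
  have Q1N: "Q1 i = Q i" if "i < N" for i using Q1(1) that unfolding blk_def by blast
  obtain V1 where V1: "trun (vstep P w) (cfg 0 Q) V1 (cfg L Q1)" "\<And>v i. v \<in> V1 \<Longrightarrow> i < N \<Longrightarrow> v (Suc i) = Q i"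
    using blk_embed[of "{..<N}" A w Q 0 Q1 0 P] Q1(1) by (auto simp: L_def P' nth_append)
  define Q2 where "Q2 = Q1(N := 0)"
  define X where "X = (if g m w e = 0 then L + 3 else Suc (Suc L))"
  have "vstep P w (cfg L Q1) = cfg (Suc L) Q2" by (simp add: vstep_exec lenP nth vec_def Q2_def)
  moreover have "vstep P w (cfg (Suc L) Q2) = cfg X Q2"
    using Q1(2)[of m] gQ[of m] N by (auto simp: vstep_exec lenP nth vec_def Q2_def X_def)
  ultimately have V2: "trun (vstep P w) (cfg 0 Q) (insert (cfg (Suc L) Q2) (insert (cfg L Q1) V1)) (cfg X Q2)"
    using trun_step[OF trun_step[OF V1(1)]] by simp
  have Q2N: "Q2 i = e i" if "i < N" for i using that QE Q1N by (simp add: Q2_def)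
  show ?thesis
  proof (cases "g m w e = 0")
    case False
    have "vstep P w (cfg X Q2) = cfg (length P) Q2" using False by (simp add: vstep_exec lenP nth vec_def X_def)
    then show ?thesis using False trun_step[OF V2] Q2N by auto
  next
    case True
    define Q3 where "Q3 k = (\<lambda>i. if i < k then Q2 (2*N+i) else Q2 i)" for k
    have Q3v: "Q3 k i \<in> {e i, env_step m (\<lambda>i. g i w) e i}" if "k \<le> m" "i < N" for k i
      using that Q2N Q1(2)[of i] gQ[of i] N by (auto simp: Q3_def env_step_def Q2_def)
    have "\<exists>V. trun (vstep P w) (cfg (L + 3) Q2) V (cfg (L + 3 + k) (Q3 k)) \<and>
        (\<forall>v\<in>V. \<forall>i<N. v (Suc i) \<in> {e i, env_step m (\<lambda>i. g i w) e i})" if "k \<le> m" for k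
      using that
    proof (induction k)
      case 0
      have "Q3 0 = Q2" by (simp add: Q3_def)
      then show ?case using trun_refl by (intro exI[of _ "{}"]) auto
    next
      case (Suc k)
      then obtain V where V: "trun (vstep P w) (cfg (L + 3) Q2) V (cfg (L + 3 + k) (Q3 k))"
        "\<forall>v\<in>V. \<forall>i<N. v (Suc i) \<in> {e i, env_step m (\<lambda>i. g i w) e i}" by auto
      have "(Q3 k)(k := Q3 k (2*N+k)) = Q3 (Suc k)" using Suc.prems N by (auto simp: Q3_def fun_eq_iff)
      then have "vstep P w (cfg (L + 3 + k) (Q3 k)) = cfg (L + 3 + Suc k) (Q3 (Suc k))"
        using Suc.prems nth(4)[of k] by (simp add: vstep_exec lenP vec_def del: fun_upd_apply)
      then show ?case using trun_step[OF V(1)] V(2) Q3v[of k] Suc.prems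
        by (intro exI[of _ "insert (cfg (L + 3 + k) (Q3 k)) V"]) auto
    qed
    from this[of m] obtain V3 where V3: "trun (vstep P w) (cfg (L + 3) Q2) V3 (cfg (L + 3 + m) (Q3 m))"
        "\<forall>v\<in>V3. \<forall>i<N. v (Suc i) \<in> {e i, env_step m (\<lambda>i. g i w) e i}" by auto
    have "vstep P w (cfg (L + 3 + m) (Q3 m)) = cfg 0 (Q3 m)" by (simp add: vstep_exec lenP nth vec_def)
    then have V4: "trun (vstep P w) (cfg (L + 3) Q2) (insert (cfg (L + 3 + m) (Q3 m)) V3) (cfg 0 (Q3 m))"
      using trun_step[OF V3(1)] by simp
    define V where "V = insert (cfg (Suc L) Q2) (insert (cfg L Q1) V1) \<union> insert (cfg (L + 3 + m) (Q3 m)) V3"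
    have V: "trun (vstep P w) (cfg 0 Q) V (cfg 0 (Q3 m))"
      unfolding V_def by (rule trun_trans[OF V4]) (use V2 True in \<open>simp add: X_def\<close>)
    have "cfg 0 Q \<in> V" using trun_start[OF V] unfolding V_def by blast
    moreover have "\<forall>i<N. Q3 m i = env_step m (\<lambda>i. g i w) e i"
      using Q2N Q1(2) gQ N by (auto simp: Q3_def env_step_def Q2_def)
    moreover have "\<forall>v\<in>V. \<forall>i<N. v (Suc i) \<in> {e i, env_step m (\<lambda>i. g i w) e i}"
      unfolding V_def using V3(2) Q3v[of m] V1(2) QE Q1N Q2N by auto
    ultimately show ?thesis using V True by auto
  qed
qed

lemma loop_run:
  assumes C: "\<And>i. i \<le> m \<Longrightarrow> computes (C i) (g i)" "\<And>i. i \<le> m \<Longrightarrow> regs_below N (C i)"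
    and N: "0 < N" "m \<le> N" and P: "P = loopp N m C"
    and run: "trun (env_step m (\<lambda>i. g i w)) e W e'" "\<And>v. v \<in> W \<Longrightarrow> g m w v = 0"
    and QE: "\<And>i. i < N \<Longrightarrow> Q i = e i"
  shows "\<exists>V Q'. trun (vstep P w) (cfg 0 Q) V (cfg 0 Q') \<and> (\<forall>i<N. Q' i = e' i) \<and>
    (\<forall>v\<in>V. \<forall>i<N. \<exists>u\<in>insert e' W. v (Suc i) = u i) \<and>
    (\<forall>u\<in>W. \<exists>v\<in>V. v 0 = 0 \<and> (\<forall>i<N. v (Suc i) = u i))"
  using run QE
proof (induction arbitrary: Q rule: trun.induct)
  case (trun_refl e)
  show ?case by (intro exI[of _ "{}"] exI[of _ Q]) (use trun_refl trun.trun_refl in auto)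
next
  case (trun_step e W d)
  let ?d = "env_step m (\<lambda>i. g i w) d"
  obtain V Q1 where V: "trun (vstep P w) (cfg 0 Q) V (cfg 0 Q1)" "\<forall>i<N. Q1 i = d i"
    "\<forall>v\<in>V. \<forall>i<N. \<exists>u\<in>insert d W. v (Suc i) = u i"
    "\<forall>u\<in>W. \<exists>v\<in>V. v 0 = 0 \<and> (\<forall>i<N. v (Suc i) = u i)"
    using trun_step.IH[of Q] trun_step.prems by blast
  have "g m w d = 0" using trun_step.prems(1)[of d] by simp
  then obtain V2 Q2 where V2: "trun (vstep P w) (cfg 0 Q1) V2 (cfg 0 Q2)" "\<forall>i<N. Q2 i = ?d i" "cfg 0 Q1 \<in> V2"
     "\<forall>v\<in>V2. \<forall>i<N. v (Suc i) \<in> {d i, ?d i}"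
    using loop_iteration[where C = C and g = g and N = N and m = m and Q = Q1 and e = d and P = P and w = w,
      OF _ _ N _ P] C V(2) by auto
  have t: "trun (vstep P w) (cfg 0 Q) (V \<union> V2) (cfg 0 Q2)" by (rule trun_trans[OF V2(1) V(1)])
  show ?case
  proof (intro exI[of _ "V \<union> V2"] exI[of _ Q2] conjI ballI allI impI)
    fix v i assume "v \<in> V \<union> V2" "i < N"
    then show "\<exists>u\<in>insert ?d (insert d W). v (Suc i) = u i" using V(3) V2(4) by blast
  next
    fix u assume "u \<in> insert d W"
    then show "\<exists>v\<in>V \<union> V2. v 0 = 0 \<and> (\<forall>i<N. v (Suc i) = u i)"
    proof
      assume "u = d"
      then show ?thesis using V2(3) V(2) by (intro bexI[of _ "cfg 0 Q1"]) auto
    qed (use V(4) in blast)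
  qed (use t V2 in auto)
next
  case (trun_lim c W)
  let ?T = "\<lambda>n V Q Q'. trun (vstep P w) (cfg 0 Q) V (cfg 0 Q') \<and>
    (\<forall>v\<in>V. \<forall>i<N. \<exists>u\<in>insert (c (Suc n)) (W n). v (Suc i) = u i) \<and>
    (\<forall>u\<in>W n. \<exists>v\<in>V. v 0 = 0 \<and> (\<forall>i<N. v (Suc i) = u i))"
  have "\<exists>q. \<forall>n. ((\<forall>i<N. q n i = c n i) \<and> (n = 0 \<longrightarrow> q n = Q)) \<and> (\<exists>V. ?T n V (q n) (q (Suc n)))"
  proof (rule dependent_nat_choice)
    show "\<exists>x. (\<forall>i<N. x i = c 0 i) \<and> (0 = (0::nat) \<longrightarrow> x = Q)" using trun_lim.prems(2) by blast
  next
    fix x n assume "(\<forall>i<N. x i = c n i) \<and> (n = 0 \<longrightarrow> x = Q)"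
    then show "\<exists>y. ((\<forall>i<N. y i = c (Suc n) i) \<and> (Suc n = 0 \<longrightarrow> y = Q)) \<and> (\<exists>V. ?T n V x y)"
    proof -
      have "\<exists>V Q'. trun (vstep P w) (cfg 0 x) V (cfg 0 Q') \<and> (\<forall>i<N. Q' i = c (Suc n) i) \<and>
         (\<forall>v\<in>V. \<forall>i<N. \<exists>u\<in>insert (c (Suc n)) (W n). v (Suc i) = u i) \<and>
         (\<forall>u\<in>W n. \<exists>v\<in>V. v 0 = 0 \<and> (\<forall>i<N. v (Suc i) = u i))"
        by (rule trun_lim.IH) (use trun_lim.prems(1) \<open>(\<forall>i<N. x i = c n i) \<and> _\<close> in auto)
      then show ?thesis by blast
    qed
  qed
  then obtain q V where q: "\<And>n i. i < N \<Longrightarrow> q n i = c n i" "q 0 = Q" "\<And>n. ?T n (V n) (q n) (q (Suc n))"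
    by metis
  have ne: "V n \<noteq> {}" for n using q(3)[of n] trun_lim(2)[of n] by blast
  have t: "trun (vstep P w) (cfg 0 (q 0)) (\<Union>n. V n) (lim_vec V)"
    by (rule trun.trun_lim[of _ "\<lambda>n. cfg 0 (q n)"]) (use q(3) ne in auto)
  have line: "lim_vec V 0 = 0"
  proof (rule lim_vec_eq)
    show "is_liminf V 0 0" unfolding is_liminf_def using q(3) trun_lim(2) by (metis (no_types, lifting) ex_in_conv le0 order_refl)
  qed
  have cW: "c n \<in> W n" for n using trun_start[OF trun_lim(1)] trun_lim(2) by blast
  have reg: "lim_vec V (Suc i) = lim_vec W i" if i: "i < N" for i
  proof (rule lim_vec_cong)
    fix x
    \<comment> \<open>A block of the machine may already show the environment
      \<open>c (Suc n)\<close>, which belongs to the next block of the abstract loop.\<close>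
    have up: "\<exists>u\<in>W n \<union> W (Suc n). v (Suc i) = u i" if "v \<in> V n" for v n
      using q(3)[of n] that i cW[of "Suc n"] by blast
    have dn: "\<exists>v\<in>V n. v (Suc i) = u i" if "u \<in> W n" for u n using q(3)[of n] that i by blast
    have "(\<exists>M. \<forall>n\<ge>M. \<forall>v\<in>V n. x \<le> v (Suc i)) \<longleftrightarrow> (\<exists>M. \<forall>n\<ge>M. \<forall>v\<in>W n. x \<le> v i)" (is "?L \<longleftrightarrow> ?R")
    proof
      assume ?L then show ?R using dn by metis
    next
      assume ?R
      then obtain M where M: "\<forall>n\<ge>M. \<forall>v\<in>W n. x \<le> v i" by blast
      have "x \<le> v (Suc i)" if "n \<ge> M" "v \<in> V n" for n v
        using up[OF that(2)] M that(1) by (metis UnE le_SucI)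
      then show ?L by blast
    qed
    moreover have "(\<forall>M. \<exists>n\<ge>M. \<exists>v\<in>V n. v (Suc i) = x) \<longleftrightarrow> (\<forall>M. \<exists>n\<ge>M. \<exists>v\<in>W n. v i = x)" (is "?L \<longleftrightarrow> ?R")
    proof
      assume L: ?L
      show ?R
      proof
        fix M
        obtain n v where "n \<ge> M" "v \<in> V n" "v (Suc i) = x" using L by blast
        then show "\<exists>n\<ge>M. \<exists>v\<in>W n. v i = x" using up[of v n] by (metis UnE le_SucI)
      qed
    next
      assume ?R then show ?L using dn by metis
    qed
    ultimately show "is_liminf V (Suc i) x \<longleftrightarrow> is_liminf W i x" unfolding is_liminf_def by simp
  qed
  have lv: "lim_vec V = cfg 0 (\<lambda>i. lim_vec V (Suc i))" using cfg_eta[of "lim_vec V"] line by simp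
  show ?case
  proof (intro exI[of _ "\<Union>n. V n"] exI[of _ "\<lambda>i. lim_vec V (Suc i)"] conjI ballI allI impI)
    show "trun (vstep P w) (cfg 0 Q) (\<Union>n. V n) (cfg 0 (\<lambda>i. lim_vec V (Suc i)))"
      using t unfolding q(2) by (subst (asm) lv)
    show "lim_vec V (Suc i) = lim_vec W i" if "i < N" for i by (rule reg[OF that])
    fix v i assume "v \<in> (\<Union>n. V n)" "i < N"
    then obtain n where "v \<in> V n" by blast
    then obtain u where "u \<in> insert (c (Suc n)) (W n)" "v (Suc i) = u i" using q(3)[of n] \<open>i < N\<close> by blast
    then show "\<exists>u\<in>insert (lim_vec W) (\<Union>n. W n). v (Suc i) = u i" using cW[of "Suc n"] by blast
  next
    fix u assume "u \<in> (\<Union>n. W n)"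
    then obtain n where "u \<in> W n" by blast
    then obtain v where "v \<in> V n" "v 0 = 0 \<and> (\<forall>i<N. v (Suc i) = u i)" using q(3)[of n] by blast
    then show "\<exists>v\<in>\<Union>n. V n. v 0 = 0 \<and> (\<forall>i<N. v (Suc i) = u i)" by blast
  qed
qed

text \<open>From here on transfinite iteration is available for functions, without mention of
  programs. The components below \<open>m\<close> are updated simultaneously, and a nonzero value of
  \<open>g m\<close> ends the loop.\<close>

theorem cf_loop:
  assumes "\<And>i. i \<le> m \<Longrightarrow> cf (g i)" "\<And>i. cf (\<lambda>w e. ini w e i)"
    and "\<And>w e. \<exists>W e'. trun (env_step m (\<lambda>i. g i w)) (ini w e) W e' \<and> (\<forall>v\<in>W. g m w v = 0) \<and> g m w e' \<noteq> 0 \<and> out w e = e' 0"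
  shows "cf out"
proof -
  have "\<forall>i. \<exists>C. i \<le> m \<longrightarrow> computes C (g i)" using assms(1) unfolding cf_def by blast
  then obtain C where C: "\<And>i. i \<le> m \<Longrightarrow> computes (C i) (g i)" by metis
  obtain N where N: "0 < N" "m \<le> N" "\<And>i. i \<le> m \<Longrightarrow> regs_below N (C i)"
    using ex_common_bound[of m "Suc m" C] by (auto simp: less_Suc_eq_le)
  have "\<exists>X. blk {} (loopp N m C) w (ini w e) X \<and> X 0 = out w e" for w e
  proof -
    obtain W e' where W: "trun (env_step m (\<lambda>i. g i w)) (ini w e) W e'" "\<And>v. v\<in>W \<Longrightarrow> g m w v = 0" "g m w e' \<noteq> 0" "out w e = e' 0"
      using assms(3) by blast
    obtain V Q where V: "trun (vstep (loopp N m C) w) (cfg 0 (ini w e)) V (cfg 0 Q)" "\<And>i. i < N \<Longrightarrow> Q i = e' i"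
      using loop_run[where C = C and g = g and N = N and m = m and Q = "ini w e", OF _ _ N(1,2) HOL.refl W(1,2)]
        C N(3) by blast
    obtain V' Q' where V': "trun (vstep (loopp N m C) w) (cfg 0 Q) V' (cfg (length (loopp N m C)) Q')" "\<forall>i<N. Q' i = e' i"
      using loop_iteration[where C = C and g = g and N = N and m = m and Q = Q and e = e'
        and P = "loopp N m C" and w = w, OF _ _ N(1,2) _ HOL.refl] C N(3) V(2) W(3) by auto
    have "blk {} (loopp N m C) w (ini w e) Q'"
      by (rule blkI[OF trun_trans[OF V'(1) V(1)]]) auto
    then show ?thesis using V'(2) N(1) W(4) by auto
  qed
  then show ?thesis by (rule cf_run[where g = "\<lambda>i w e. ini w e i"]) (rule assms(2))
qed

lemma reach_step: "\<exists>V. trun G (G c) V d \<Longrightarrow> \<exists>V. trun G c V d"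
  using trun_Cons by blast

lemma reach_refl: "c = d \<Longrightarrow> \<exists>V. trun G c V d"
  using trun_refl by blast

section \<open>Elementary computable functions\<close>

lemma cf_prog:
  assumes "\<And>w R. \<exists>R'. (\<exists>V. trun (vstep C w) (cfg 0 R) V (cfg (length C) R')) \<and> R' 0 = f w R"
  shows "cf f"
proof -
  have "\<exists>R'. blk {} C w R R' \<and> R' 0 = f w R" for w R
  proof -
    obtain V R' where "trun (vstep C w) (cfg 0 R) V (cfg (length C) R')" "R' 0 = f w R" using assms by blast
    then show ?thesis using blkI[of C w R V R' "{}"] by auto
  qed
  then show ?thesis unfolding cf_def computes_def by blast
qed

lemma cf_var: "cf (\<lambda>w e. e i)"
proof (rule cf_prog[of "[Copy i 0]"], rule exI, rule conjI)
  fix w R show "\<exists>V. trun (vstep [Copy i 0] w) (cfg 0 R) V (cfg (length [Copy i 0]) (R(0 := R i)))"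
    by (rule reach_step, rule reach_refl) (simp add: vstep_exec vec_def)
qed simp

lemma cf_Suc0: "cf (\<lambda>w e. Suc (e 0))"
proof (rule cf_prog[of "[Inc 0]"], rule exI, rule conjI)
  fix w R show "\<exists>V. trun (vstep [Inc 0] w) (cfg 0 R) V (cfg (length [Inc 0]) (R(0 := Suc (R 0))))"
    by (rule reach_step, rule reach_refl) (simp add: vstep_exec vec_def)
qed simp

lemma cf_zero: "cf (\<lambda>w e. 0)"
proof (rule cf_prog[of "[Zero 0]"], rule exI, rule conjI)
  fix w R show "\<exists>V. trun (vstep [Zero 0] w) (cfg 0 R) V (cfg (length [Zero 0]) (R(0 := 0)))"
    by (rule reach_step, rule reach_refl) (simp add: vstep_exec vec_def)
qed simp

lemma cf_if_eq0: "cf (\<lambda>w e. if e 0 = e (Suc 0) then e 2 else e 3)"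
proof (rule cf_prog, rule exI, rule conjI)
  let ?C = "[JumpEq 0 (Suc 0) 3, Copy 3 0, JumpEq 0 0 4, Copy 2 0]"
  fix w R
  have st: "vstep ?C w (cfg 0 X) = cfg (if X 0 = X (Suc 0) then 3 else 1) X"
    "vstep ?C w (cfg 1 X) = cfg 2 (X(0 := X 3))" "vstep ?C w (cfg 2 X) = cfg 4 X"
    "vstep ?C w (cfg 3 X) = cfg 4 (X(0 := X 2))" for X
    by (simp_all add: vstep_exec vec_def eval_nat_numeral)
  have "\<exists>V. trun (vstep ?C w) (cfg 0 R) V (cfg 4 (R(0 := if R 0 = R (Suc 0) then R 2 else R 3)))"
  proof (cases "R 0 = R (Suc 0)")
    case True
    have s: "vstep ?C w (cfg 0 R) = cfg 3 R" using st(1)[of R] True by simp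
    show ?thesis
      by (rule reach_step, unfold s, rule reach_step, unfold st(4), rule reach_refl, simp add: True)
  next
    case False
    have s: "vstep ?C w (cfg 0 R) = cfg 1 R" using st(1)[of R] False by simp
    show ?thesis
      by (rule reach_step, unfold s, rule reach_step, unfold st(2), rule reach_step, unfold st(3),
          rule reach_refl, simp add: False)
  qed
  moreover have "length ?C = 4" by simp
  ultimately show "\<exists>V. trun (vstep ?C w) (cfg 0 R) V (cfg (length ?C) (R(0 := if R 0 = R (Suc 0) then R 2 else R 3)))"
    by metis
qed simp

lemma cf_oracle0: "cf (\<lambda>w e. if e 0 \<in> w then 1 else 0)"
proof (rule cf_prog, rule exI, rule conjI)
  let ?C = "[OracleJump 0 3, Zero 0, JumpEq 0 0 5, Zero 0, Inc 0]"
  fix w R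
  have st: "vstep ?C w (cfg 0 X) = cfg (if X 0 \<in> w then 3 else 1) X"
    "vstep ?C w (cfg 1 X) = cfg 2 (X(0 := 0))" "vstep ?C w (cfg 2 X) = cfg 5 X"
    "vstep ?C w (cfg 3 X) = cfg 4 (X(0 := 0))" "vstep ?C w (cfg 4 X) = cfg 5 (X(0 := Suc (X 0)))" for X
    by (simp_all add: vstep_exec vec_def eval_nat_numeral)
  have "\<exists>V. trun (vstep ?C w) (cfg 0 R) V (cfg 5 (R(0 := if R 0 \<in> w then 1 else 0)))"
  proof (cases "R 0 \<in> w")
    case True
    have s: "vstep ?C w (cfg 0 R) = cfg 3 R" using st(1)[of R] True by simp
    show ?thesis
      by (rule reach_step, unfold s, rule reach_step, unfold st(4), rule reach_step, unfold st(5),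
          rule reach_refl, simp add: True)
  next
    case False
    have s: "vstep ?C w (cfg 0 R) = cfg 1 R" using st(1)[of R] False by simp
    show ?thesis
      by (rule reach_step, unfold s, rule reach_step, unfold st(2), rule reach_step, unfold st(3),
          rule reach_refl, simp add: False)
  qed
  moreover have "length ?C = 5" by simp
  ultimately show "\<exists>V. trun (vstep ?C w) (cfg 0 R) V (cfg (length ?C) (R(0 := if R 0 \<in> w then 1 else 0)))"
    by metis
qed simp

section \<open>Closure properties of the computable functions\<close>

lemma cf_cong:
  assumes "cf f" "\<And>w e. f w e = g w e" shows "cf g"
proof -
  have "f = g" using assms(2) by (intro ext)
  then show ?thesis using assms(1) by simp
qed

text \<open>Environments act as de Bruijn stacks: a bound variable occupies component 0 and the
  others are shifted. The closure lemmas below use this convention for binders.\<close>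

lemma cf_app: "cf (\<lambda>w e. f w (\<lambda>i. e (Suc i)) (e 0)) \<Longrightarrow> cf a \<Longrightarrow> cf (\<lambda>w e. f w e (a w e))"
proof -
  assume f: "cf (\<lambda>w e. f w (\<lambda>i. e (Suc i)) (e 0))" and a: "cf a"
  show ?thesis
    by (rule cf_cong[OF cf_subst[OF f, of "case_nat a (\<lambda>i w e. e i)"]])
       (auto split: nat.splits intro: cf_var a)
qed

lemma cf_app2:
  assumes "cf (\<lambda>w e. f w (\<lambda>i. e (Suc (Suc i))) (e 0) (e 1))" "cf a" "cf b"
  shows "cf (\<lambda>w e. f w e (a w e) (b w e))"
proof -
  show ?thesis
    by (rule cf_cong[OF cf_subst[OF assms(1), of "case_nat a (case_nat b (\<lambda>i w e. e i))"]])
       (auto split: nat.splits intro: cf_var assms)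
qed

lemma cf_env: "cf f \<Longrightarrow> (\<And>i. cf (\<lambda>w e. t e i)) \<Longrightarrow> cf (\<lambda>w e. f w (t e))"
  using cf_subst[of f "\<lambda>i w e. t e i"] by simp

lemma cf_Suc: "cf a \<Longrightarrow> cf (\<lambda>w e. Suc (a w e))"
  using cf_app[of "\<lambda>w e x. Suc x"] cf_Suc0 by blast

lemma cf_const: "cf (\<lambda>w e. k)"
  by (induction k) (auto intro: cf_zero cf_Suc)

lemma cf_if_eq:
  assumes "cf a" "cf b" "cf c" "cf d"
  shows "cf (\<lambda>w e. if a w e = b w e then c w e else d w e)"
proof -
  show ?thesis
    by (rule cf_cong[OF cf_subst[OF cf_if_eq0, of "case_nat a (case_nat b (case_nat c (case_nat d (\<lambda>i w e. e i))))"]])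
       (auto simp: numeral_2_eq_2 numeral_3_eq_3 split: nat.splits intro: cf_var assms)
qed

definition cp :: "(nat set \<Rightarrow> (nat \<Rightarrow> nat) \<Rightarrow> bool) \<Rightarrow> bool" where
  "cp A \<longleftrightarrow> cf (\<lambda>w e. if A w e then 1 else 0)"

named_theorems cfi

lemmas [cfi] = cf_var cf_const cf_Suc

lemma cf_if [cfi]: "cp A \<Longrightarrow> cf c \<Longrightarrow> cf d \<Longrightarrow> cf (\<lambda>w e. if A w e then c w e else d w e)"
  unfolding cp_def
  by (rule cf_cong[OF cf_if_eq[of "\<lambda>w e. if A w e then 1 else 0" "\<lambda>w e. 1" c d]]) (auto intro: cf_const)

lemma cp_cong: "cp A \<Longrightarrow> (\<And>w e. A w e = B w e) \<Longrightarrow> cp B"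
  unfolding cp_def by (erule cf_cong) simp

lemma cp_eq [cfi]: "cf a \<Longrightarrow> cf b \<Longrightarrow> cp (\<lambda>w e. a w e = b w e)"
  unfolding cp_def by (intro cf_if_eq cf_const)

lemma cp_const [cfi]: "cp (\<lambda>w e. b)"
  unfolding cp_def by (cases b) (auto intro: cf_const)

lemma cp_if [cfi]:
  assumes "cp A" "cp B" "cp C" shows "cp (\<lambda>w e. if A w e then B w e else C w e)"
  unfolding cp_def
  by (rule cf_cong[OF cf_if[OF assms(1) assms(2,3)[unfolded cp_def]]]) auto

lemma cp_not [cfi]: "cp A \<Longrightarrow> cp (\<lambda>w e. \<not> A w e)"
  by (rule cp_cong[OF cp_if[of A "\<lambda>w e. False" "\<lambda>w e. True"]]) (auto intro: cp_const)

lemma cp_conj [cfi]: "cp A \<Longrightarrow> cp B \<Longrightarrow> cp (\<lambda>w e. A w e \<and> B w e)"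
  by (rule cp_cong[OF cp_if[of A B "\<lambda>w e. False"]]) (auto intro: cp_const)

lemma cp_disj [cfi]: "cp A \<Longrightarrow> cp B \<Longrightarrow> cp (\<lambda>w e. A w e \<or> B w e)"
  by (rule cp_cong[OF cp_if[of A "\<lambda>w e. True" B]]) (auto intro: cp_const)

lemma cp_imp [cfi]: "cp A \<Longrightarrow> cp B \<Longrightarrow> cp (\<lambda>w e. A w e \<longrightarrow> B w e)"
  by (rule cp_cong[OF cp_if[of A B "\<lambda>w e. True"]]) (auto intro: cp_const)

lemma cp_iff [cfi]: "cp A \<Longrightarrow> cp B \<Longrightarrow> cp (\<lambda>w e. A w e = B w e)"
  by (rule cp_cong[OF cp_if[of A B "\<lambda>w e. \<not> B w e"]]) (auto intro: cp_not)

lemma cf_case_nat [cfi]: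
  "cf a \<Longrightarrow> (\<And>j. cf (\<lambda>w e. b w e j)) \<Longrightarrow> cf (\<lambda>w e. case_nat (a w e) (b w e) i)"
  by (cases i) auto

lemma cp_app: "cp (\<lambda>w e. A w (\<lambda>i. e (Suc i)) (e 0)) \<Longrightarrow> cf a \<Longrightarrow> cp (\<lambda>w e. A w e (a w e))"
  unfolding cp_def using cf_app[of "\<lambda>w e x. if A w e x then 1 else 0" a] by simp

lemma cp_env: "cp A \<Longrightarrow> (\<And>i. cf (\<lambda>w e. t e i)) \<Longrightarrow> cp (\<lambda>w e. A w (t e))"
  unfolding cp_def using cf_env[of "\<lambda>w e. if A w e then 1 else 0" t] by simp

lemma cp_oracle [cfi]: "cf a \<Longrightarrow> cp (\<lambda>w e. a w e \<in> w)"
  unfolding cp_def using cf_app[of "\<lambda>w e x. if x \<in> w then 1 else 0" a] cf_oracle0 by simp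

subsection \<open>Unbounded search\<close>

lemma trun_funpow: "trun G c ((\<lambda>k. (G ^^ k) c) ` {..<n}) ((G ^^ n) c)"
  by (induction n) (auto intro: trun_refl trun_step simp: lessThan_Suc)

text \<open>The loop state is \<open>(n, k)\<close> with \<open>k = Suc n\<close>; both components diverge in an unsuccessful search,
  so that the limit is recognised by \<open>k = 0\<close>.\<close>

lemma cf_Least_default:
  assumes "cp (\<lambda>w e. A w (\<lambda>i. e (Suc i)) (e 0))"
  shows "cf (\<lambda>w e. if \<exists>n. A w e n then LEAST n. A w e n else 0)"
proof -
  define g :: "nat \<Rightarrow> nat set \<Rightarrow> (nat \<Rightarrow> nat) \<Rightarrow> nat" where
    "g i w e = (if i = 0 then e (Suc 0) else if i = Suc 0 then Suc (e (Suc 0))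
       else if e (Suc 0) = 0 \<or> A w (\<lambda>i. e (Suc (Suc i))) (e 0) then 1 else 0)" for i w e
  define ini where "ini w e = case_nat 0 (case_nat 1 e)" for w :: "nat set" and e :: "nat \<Rightarrow> nat"
  have iter: "(env_step 2 (\<lambda>i. g i w) ^^ n) (ini w e) = case_nat n (case_nat (Suc n) e)" for n w e
    by (induction n) (auto simp: ini_def env_step_def g_def fun_eq_iff split: nat.splits)
  have stop: "g 2 w (case_nat n (case_nat k e)) = (if k = 0 \<or> A w e n then 1 else 0)" for w n k e
    by (simp add: g_def)
  show ?thesis
  proof (rule cf_loop[where m = 2 and g = g and ini = ini])
    fix i :: nat
    have "cp (\<lambda>w e. A w (\<lambda>i. e (Suc (Suc i))) (e 0))"
      by (rule cp_cong[OF cp_env[OF assms, of "\<lambda>e. case_nat (e 0) (\<lambda>i. e (Suc (Suc i)))"]])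
         (auto intro!: cfi)
    then have "cf (\<lambda>w e. if e (Suc 0) = 0 \<or> A w (\<lambda>i. e (Suc (Suc i))) (e 0) then 1 else 0)"
      by (intro cfi)
    then show "cf (g i)" unfolding g_def by (cases "i = 0"; cases "i = Suc 0") (simp_all add: cfi)
    show "cf (\<lambda>w e. ini w e i)" unfolding ini_def by (intro cfi)
  next
    fix w e
    show "\<exists>W e'. trun (env_step 2 (\<lambda>i. g i w)) (ini w e) W e' \<and> (\<forall>v\<in>W. g 2 w v = 0) \<and>
            g 2 w e' \<noteq> 0 \<and> (if \<exists>n. A w e n then LEAST n. A w e n else 0) = e' 0"
    proof (cases "\<exists>n. A w e n")
      case True
      define n where "n = (LEAST n. A w e n)"
      have n: "A w e n" "\<And>k. k < n \<Longrightarrow> \<not> A w e k"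
        unfolding n_def using True LeastI_ex not_less_Least by blast+
      show ?thesis
        using trun_funpow[of "env_step 2 (\<lambda>i. g i w)" "ini w e" n] unfolding iter n_def[symmetric]
        by - (intro exI conjI, assumption, use True n in \<open>auto simp: stop\<close>)
    next
      case False
      let ?G = "env_step 2 (\<lambda>i. g i w)"
      define c where "c n = case_nat n (case_nat (Suc n) e)" for n
      have t: "trun ?G (c 0) (\<Union>n. {c n}) (lim_vec (\<lambda>n. {c n}))"
      proof (rule trun_lim)
        fix n show "trun ?G (c n) {c n} (c (Suc n))"
          using trun_step1[of ?G "c n"] iter[of "Suc n" w e] iter[of n w e] by (simp add: c_def)
      qed auto
      have "lim_vec (\<lambda>n. {c n}) (Suc (Suc i)) = e i" for i
        by (rule lim_vec_const) (auto simp: c_def)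
      moreover have "lim_vec (\<lambda>n. {c n}) i = 0" if "i < 2" for i
      proof (rule lim_vec_none)
        fix x
        have "\<not> (\<exists>n\<ge>Suc x. \<exists>v\<in>{c n}. v i = x)" using that
          by (auto simp: c_def less_Suc_eq numeral_2_eq_2)
        then show "\<not> is_liminf (\<lambda>n. {c n}) i x" unfolding is_liminf_def by blast
      qed
      ultimately have "lim_vec (\<lambda>n. {c n}) = case_nat 0 (case_nat 0 e)"
        by (auto simp: fun_eq_iff split: nat.splits)
      then show ?thesis using t False
        by (intro exI[of _ "\<Union>n. {c n}"] exI[of _ "case_nat 0 (case_nat 0 e)"])
           (auto simp: stop c_def ini_def)
    qed
  qed
qed

text \<open>An unsuccessful search also ends, at a limit. Testing its default answer 0 tells the two
  cases apart.\<close>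

lemma cp_ex [cfi]:
  assumes "cp (\<lambda>w e. A w (\<lambda>i. e (Suc i)) (e 0))"
  shows "cp (\<lambda>w e. \<exists>n. A w e n)"
proof -
  have "cp (\<lambda>w e. A w e (if \<exists>n. A w e n then LEAST n. A w e n else 0))"
    by (rule cp_app[OF assms cf_Least_default[OF assms]])
  moreover have "A w e (if \<exists>n. A w e n then LEAST n. A w e n else 0) \<longleftrightarrow> (\<exists>n. A w e n)" for w e
    using LeastI_ex[of "A w e"] by auto
  ultimately show ?thesis by simp
qed

lemma cp_all [cfi]:
  assumes "cp (\<lambda>w e. A w (\<lambda>i. e (Suc i)) (e 0))"
  shows "cp (\<lambda>w e. \<forall>n. A w e n)"
  using cp_not[OF cp_ex[OF cp_not[OF assms]]] by simp

text \<open>Functions are computed by searching for the value in a decidable graph, which replaces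
  explicit programs below.\<close>

lemma cf_graph:
  assumes "cp (\<lambda>w e. A w (\<lambda>i. e (Suc i)) (e 0))" "\<And>w e n. A w e n \<longleftrightarrow> n = f w e"
  shows "cf f"
  using cf_Least_default[OF assms(1)] unfolding assms(2) by (simp add: Least_equality)

lemma cf_funpow:
  assumes "cf (\<lambda>w e. f w (\<lambda>i. e (Suc i)) (e 0))" "cf n" "cf a"
  shows "cf (\<lambda>w e. (f w e ^^ n w e) (a w e))"
proof -
  define g :: "nat \<Rightarrow> nat set \<Rightarrow> (nat \<Rightarrow> nat) \<Rightarrow> nat" where
    "g i w e = (if i = 0 then f w (\<lambda>i. e (Suc (Suc (Suc i)))) (e 0) else if i = Suc 0 then Suc (e (Suc 0))
       else if e (Suc 0) = e (Suc (Suc 0)) then 1 else 0)" for i w e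
  define ini where "ini w e = case_nat (a w e) (case_nat 0 (case_nat (n w e) e))" for w e
  have iter: "(env_step 2 (\<lambda>i. g i w) ^^ k) (ini w e) =
      case_nat ((f w e ^^ k) (a w e)) (case_nat k (case_nat (n w e) e))" for k w e
  proof (induction k)
    case (Suc k)
    have "env_step 2 (\<lambda>i. g i w) (case_nat x (case_nat k (case_nat l e))) =
      case_nat (f w e x) (case_nat (Suc k) (case_nat l e))" for x l
      by (auto simp: env_step_def g_def fun_eq_iff numeral_2_eq_2 split: nat.splits)
    then show ?case using Suc by simp
  qed (simp add: ini_def)
  have stop: "g 2 w (case_nat x (case_nat k (case_nat l e))) = (if k = l then 1 else 0)" for w x l k e
    by (simp add: g_def numeral_2_eq_2)
  show ?thesis
  proof (rule cf_loop[where m = 2 and g = g and ini = ini])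
    fix i :: nat
    have "cf (\<lambda>w e. f w (\<lambda>i. e (Suc (Suc (Suc i)))) (e 0))"
      by (rule cf_cong[OF cf_env[OF assms(1), of "\<lambda>e. case_nat (e 0) (\<lambda>i. e (Suc (Suc (Suc i))))"]])
         (auto intro!: cfi)
    then show "cf (g i)" unfolding g_def by (cases "i = 0"; cases "i = Suc 0") (simp_all add: cfi)
    show "cf (\<lambda>w e. ini w e i)" unfolding ini_def by (intro cfi assms)
  next
    fix w e
    show "\<exists>W e'. trun (env_step 2 (\<lambda>i. g i w)) (ini w e) W e' \<and> (\<forall>v\<in>W. g 2 w v = 0) \<and>
            g 2 w e' \<noteq> 0 \<and> (f w e ^^ n w e) (a w e) = e' 0"
      using trun_funpow[of "env_step 2 (\<lambda>i. g i w)" "ini w e" "n w e"] unfolding iter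
      by - (intro exI conjI, assumption, auto simp: stop)
  qed
qed

subsection \<open>Arithmetic\<close>

lemma cf_add [cfi]: assumes "cf a" "cf b" shows "cf (\<lambda>w e. a w e + b w e)"
proof -
  have "cf (\<lambda>w e. (Suc ^^ b w e) (a w e))" by (rule cf_funpow) (intro cfi assms)+
  then show ?thesis by (simp add: Suc_funpow add.commute)
qed

lemma cf_mult [cfi]: assumes "cf a" "cf b" shows "cf (\<lambda>w e. a w e * b w e)"
proof -
  have 1: "cf (\<lambda>w e. ((\<lambda>x. x + e 0) ^^ e (Suc 0)) 0)"
    by (rule cf_funpow) (intro cfi)+
  have 2: "((\<lambda>x. x + m) ^^ n) 0 = m * n" for m n :: nat by (induction n) auto
  have "cf (\<lambda>w e. e 0 * e (Suc 0))" using 1 unfolding 2 .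
  then show ?thesis using cf_app2[of "\<lambda>w e x y. x * y" a b] assms by simp
qed

lemma cp_less [cfi]: assumes "cf a" "cf b" shows "cp (\<lambda>w e. a w e < b w e)"
proof -
  have "cp (\<lambda>w e. \<exists>k. e 0 + Suc k = e (Suc 0))" by (intro cfi)
  then have "cf (\<lambda>w e. if e 0 < e (Suc 0) then 1 else 0)"
    unfolding cp_def by (rule cf_cong) (simp add: less_iff_Suc_add eq_commute)
  then show ?thesis unfolding cp_def using cf_app2[of "\<lambda>w e x y. if x < y then 1 else 0" a b] assms by simp
qed

lemma cp_le [cfi]: "cf a \<Longrightarrow> cf b \<Longrightarrow> cp (\<lambda>w e. a w e \<le> b w e)"
  unfolding not_less[symmetric] by (intro cfi)

lemma cf_fun1: "cf (\<lambda>w e. f (e 0)) \<Longrightarrow> cf a \<Longrightarrow> cf (\<lambda>w e. f (a w e))"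
  by (rule cf_app[of "\<lambda>w e. f"])

lemma cf_fun2: "cf (\<lambda>w e. f (e 0) (e (Suc 0))) \<Longrightarrow> cf a \<Longrightarrow> cf b \<Longrightarrow> cf (\<lambda>w e. f (a w e) (b w e))"
  using cf_app2[of "\<lambda>w e. f"] by simp

lemma cf_minus [cfi]: assumes "cf a" "cf b" shows "cf (\<lambda>w e. a w e - b w e)"
proof (rule cf_fun2[OF _ assms, of minus])
  show "cf (\<lambda>w e. e 0 - e (Suc 0))"
  proof (rule cf_graph)
    show "cp (\<lambda>w e. if e (Suc 0) \<le> e (Suc (Suc 0)) then e 0 = 0 else e (Suc 0) = e 0 + e (Suc (Suc 0)))"
      by (intro cfi)
    show "(if e 0 \<le> e (Suc 0) then n = 0 else e 0 = n + e (Suc 0)) \<longleftrightarrow> n = e 0 - e (Suc 0)" for e :: "nat \<Rightarrow> nat" and n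
      by (cases "e 0 \<le> e (Suc 0)") auto
  qed
qed

subsection \<open>Codes of finite sequences\<close>

lemma cf_prod_encode [cfi]: assumes "cf a" "cf b" shows "cf (\<lambda>w e. prod_encode (a w e, b w e))"
proof -
  have tri: "cf (\<lambda>w e. triangle (e 0))"
  proof (rule cf_graph)
    show "cp (\<lambda>w e. 2 * e 0 = e (Suc 0) * Suc (e (Suc 0)))" by (intro cfi)
    have "2 * triangle m = m * Suc m" for m by (induction m) auto
    then have "2 * n = m * Suc m \<longleftrightarrow> 2 * n = 2 * triangle m" for m n by simp
    then show "2 * n = e 0 * Suc (e 0) \<longleftrightarrow> n = triangle (e 0)" for n and e :: "nat \<Rightarrow> nat"
      by simp
  qed
  have "cf (\<lambda>w e. triangle (e 0 + e (Suc 0)) + e 0)" by (intro cfi cf_fun1[OF tri])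
  then have "cf (\<lambda>w e. prod_encode (e 0, e (Suc 0)))" by (simp add: prod_encode_def)
  then show ?thesis by (rule cf_fun2[OF _ assms, of "\<lambda>x y. prod_encode (x, y)"])
qed

lemma cf_fst_prod_decode [cfi]: assumes "cf a" shows "cf (\<lambda>w e. fst (prod_decode (a w e)))"
proof (rule cf_fun1[OF _ assms, of "\<lambda>x. fst (prod_decode x)"], rule cf_graph)
  show "cp (\<lambda>w e. \<exists>m. prod_encode (e 0, m) = e (Suc 0))" by (intro cfi)
  show "(\<exists>m. prod_encode (n, m) = e 0) \<longleftrightarrow> n = fst (prod_decode (e 0))" for n and e :: "nat \<Rightarrow> nat"
    by (metis fst_conv prod.collapse prod_decode_inverse prod_encode_inverse)
qed

lemma cf_snd_prod_decode [cfi]: assumes "cf a" shows "cf (\<lambda>w e. snd (prod_decode (a w e)))"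
proof (rule cf_fun1[OF _ assms, of "\<lambda>x. snd (prod_decode x)"], rule cf_graph)
  show "cp (\<lambda>w e. \<exists>m. prod_encode (m, e 0) = e (Suc 0))" by (intro cfi)
  show "(\<exists>m. prod_encode (m, n) = e 0) \<longleftrightarrow> n = snd (prod_decode (e 0))" for n and e :: "nat \<Rightarrow> nat"
    by (metis snd_conv prod.collapse prod_decode_inverse prod_encode_inverse)
qed

definition lenc :: "nat \<Rightarrow> nat" where "lenc z = length (list_decode z)"

definition sel :: "nat \<Rightarrow> nat \<Rightarrow> nat" where
  "sel z i = (if i < length (list_decode z) then list_decode z ! i else 0)"

text \<open>The \<open>- 1\<close> undoes the \<open>Suc\<close> in \<open>list_encode\<close>. For
  \<open>z = 0\<close> it is harmless, as 0 decodes to the pair of zeros and the empty list is its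
  own tail.\<close>

definition tlc :: "nat \<Rightarrow> nat" where "tlc z = snd (prod_decode (z - 1))"

lemma prod_decode_0: "prod_decode 0 = (0, 0)"
  using prod_encode_inverse[of "(0, 0)"] by (simp add: prod_encode_def)

lemma list_decode_tlc: "list_decode (tlc z) = tl (list_decode z)"
  by (cases z) (auto simp: tlc_def prod_decode_0 split: prod.splits)

lemma list_decode_tlc_funpow: "list_decode ((tlc ^^ i) z) = drop i (list_decode z)"
  by (induction i) (auto simp: list_decode_tlc drop_Suc tl_drop)

lemma list_decode_eq_Nil: "list_decode z = [] \<longleftrightarrow> z = 0"
  by (metis list_decode.simps(1) list_decode_inverse)

lemma sel_alt: "sel z i = fst (prod_decode ((tlc ^^ i) z - 1))"
proof (cases "i < length (list_decode z)")
  case True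
  define y where "y = (tlc ^^ i) z"
  have y: "list_decode y = list_decode z ! i # drop (Suc i) (list_decode z)"
    unfolding y_def list_decode_tlc_funpow using Cons_nth_drop_Suc[OF True] by simp
  then obtain m where "y = Suc m" by (cases y) auto
  then have "fst (prod_decode (y - 1)) = list_decode z ! i" using y by (auto split: prod.splits)
  then show ?thesis using True unfolding sel_def y_def by simp
next
  case False
  then have "list_decode ((tlc ^^ i) z) = []" unfolding list_decode_tlc_funpow by simp
  then have "(tlc ^^ i) z = 0" unfolding list_decode_eq_Nil .
  then show ?thesis using False by (simp add: sel_def prod_decode_0)
qed

lemma cf_sel [cfi]: assumes "cf a" "cf b" shows "cf (\<lambda>w e. sel (a w e) (b w e))"
proof -
  have "cf (\<lambda>w e. fst (prod_decode ((tlc ^^ e (Suc 0)) (e 0) - 1)))"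
    unfolding tlc_def by (intro cfi cf_funpow)
  then show ?thesis unfolding sel_alt by (rule cf_fun2[OF _ assms, of "\<lambda>x y. fst (prod_decode ((tlc ^^ y) x - 1))"])
qed

lemma cf_lenc [cfi]: assumes "cf a" shows "cf (\<lambda>w e. lenc (a w e))"
proof (rule cf_fun1[OF _ assms, of lenc], rule cf_graph)
  show "cp (\<lambda>w e. (tlc ^^ e 0) (e (Suc 0)) = 0 \<and> (\<forall>m. m < e 0 \<longrightarrow> (tlc ^^ m) (e (Suc 0)) \<noteq> 0))"
    unfolding tlc_def by (intro cfi cf_funpow)
  have "(tlc ^^ n) z = 0 \<longleftrightarrow> lenc z \<le> n" for n z
    unfolding list_decode_eq_Nil[symmetric] list_decode_tlc_funpow lenc_def by simp
  then show "(tlc ^^ n) (e 0) = 0 \<and> (\<forall>m. m < n \<longrightarrow> (tlc ^^ m) (e 0) \<noteq> 0) \<longleftrightarrow> n = lenc (e 0)"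
    for n and e :: "nat \<Rightarrow> nat"
    by (metis le_antisym linorder_not_le order_refl)
qed

lemma code_eqI: "lenc m = lenc n \<Longrightarrow> (\<And>i. i < lenc n \<Longrightarrow> sel m i = sel n i) \<Longrightarrow> m = n"
proof -
  assume "lenc m = lenc n" "\<And>i. i < lenc n \<Longrightarrow> sel m i = sel n i"
  then have "list_decode m = list_decode n" by (intro nth_equalityI) (auto simp: lenc_def sel_def)
  then show "m = n" using list_decode_inverse by metis
qed

lemma lenc_encode [simp]: "lenc (list_encode xs) = length xs" by (simp add: lenc_def)

lemma sel_encode: "sel (list_encode xs) i = (if i < length xs then xs ! i else 0)" by (simp add: sel_def)

lemma sel_encode_nth [simp]: "i < length xs \<Longrightarrow> sel (list_encode xs) i = xs ! i" by (simp add: sel_def)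

lemma list_decode_alt: "list_decode z = map (sel z) [0..<lenc z]"
  by (intro nth_equalityI) (auto simp: lenc_def sel_def)

lemma cp_mem_list_decode [cfi]: assumes "cf a" "cf b" shows "cp (\<lambda>w e. a w e \<in> set (list_decode (b w e)))"
proof -
  have "cp (\<lambda>w e. \<exists>i. i < lenc (e (Suc 0)) \<and> sel (e (Suc 0)) i = e 0)" by (intro cfi)
  then have "cp (\<lambda>w e. e 0 \<in> set (list_decode (e (Suc 0))))"
    by (rule cp_cong) (auto simp: in_set_conv_nth lenc_def sel_def)
  then show ?thesis unfolding cp_def
    using cf_fun2[of "\<lambda>x y. if x \<in> set (list_decode y) then 1 else 0" a b] assms by simp
qed

lemma cf_shift: "cf f \<Longrightarrow> cf (\<lambda>w e. f w (\<lambda>i. e (Suc i)))"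
  using cf_env[of f "\<lambda>e i. e (Suc i)"] cf_var by simp

lemma cf_skip1: "cf (\<lambda>w e. f w (\<lambda>i. e (Suc i)) (e 0)) \<Longrightarrow> cf (\<lambda>w e. f w (\<lambda>i. e (Suc (Suc i))) (e 0))"
  by (rule cf_cong[OF cf_env[of _ "\<lambda>e. case_nat (e 0) (\<lambda>i. e (Suc (Suc i)))"]]) (auto intro!: cfi)

lemma cf_tab [cfi]:
  assumes "cf (\<lambda>w e. f w (\<lambda>i. e (Suc i)) (e 0))" "cf n"
  shows "cf (\<lambda>w e. list_encode (map (f w e) [0..<n w e]))"
proof (rule cf_graph)
  show "cp (\<lambda>w e. lenc (e 0) = n w (\<lambda>i. e (Suc i)) \<and>
      (\<forall>i. i < lenc (e 0) \<longrightarrow> sel (e 0) i = f w (\<lambda>i. e (Suc i)) i))"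
    by (intro cfi cf_shift[OF assms(2)] cf_skip1[OF assms(1)])
  show "lenc m = n w e \<and> (\<forall>i. i < lenc m \<longrightarrow> sel m i = f w e i) \<longleftrightarrow>
    m = list_encode (map (f w e) [0..<n w e])" for m w e
  proof
    assume h: "lenc m = n w e \<and> (\<forall>i. i < lenc m \<longrightarrow> sel m i = f w e i)"
    show "m = list_encode (map (f w e) [0..<n w e])"
    proof (rule code_eqI)
      show "lenc m = lenc (list_encode (map (f w e) [0..<n w e]))" using h by simp
      fix i assume "i < lenc (list_encode (map (f w e) [0..<n w e]))"
      then have "i < n w e" by simp
      then show "sel m i = sel (list_encode (map (f w e) [0..<n w e])) i" using h by (simp add: sel_encode)
    qed
  qed simp
qed

lemma cf_list_encode_Cons [cfi]:
  "cf a \<Longrightarrow> cf (\<lambda>w e. list_encode (l w e)) \<Longrightarrow> cf (\<lambda>w e. list_encode (a w e # l w e))"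
  unfolding list_encode.simps by (rule cf_Suc, rule cf_prod_encode)

lemma cf_snoc [cfi]: assumes "cf a" "cf b" shows "cf (\<lambda>w e. list_encode (list_decode (a w e) @ [b w e]))"
proof -
  have "cf (\<lambda>w e. list_encode (map (\<lambda>i. if i < lenc (e 0) then sel (e 0) i else e (Suc 0)) [0..<Suc (lenc (e 0))]))"
    by (intro cfi)
  then have "cf (\<lambda>w e. list_encode (list_decode (e 0) @ [e (Suc 0)]))"
    by (rule cf_cong) (auto intro!: arg_cong[of _ _ list_encode] nth_equalityI simp: nth_append lenc_def sel_def simp del: upt_Suc)
  then show ?thesis by (rule cf_fun2[OF _ assms, of "\<lambda>x y. list_encode (list_decode x @ [y])"])
qed

lemma cf_butlast [cfi]: assumes "cf a" shows "cf (\<lambda>w e. list_encode (butlast (list_decode (a w e))))"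
proof -
  have "cf (\<lambda>w e. list_encode (map (\<lambda>i. sel (e 0) i) [0..<lenc (e 0) - 1]))" by (intro cfi)
  then have "cf (\<lambda>w e. list_encode (butlast (list_decode (e 0))))"
    by (rule cf_cong) (auto intro!: arg_cong[of _ _ list_encode] nth_equalityI simp: nth_butlast lenc_def sel_def)
  then show ?thesis by (rule cf_fun1[OF _ assms, of "\<lambda>x. list_encode (butlast (list_decode x))"])
qed

lemma list_encode_snoc: "list_encode s < list_encode (s @ [x])"
proof (induction s)
  case (Cons a s)
  have "prod_encode (m, n) < prod_encode (m, k)" if "n < k" for m n k
  proof -
    have "mono triangle" by (simp add: mono_iff_le_Suc)
    then have "triangle (m + Suc n) \<le> triangle (m + k)"
      using monoD[of triangle "m + Suc n" "m + k"] that by simp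
    then show ?thesis by (simp add: prod_encode_def)
  qed
  then show ?case using Cons by simp
qed simp

text \<open>Premises are smaller than the code of the list containing them; this bounds the part of
  a strategy that \<open>cp_ind\<close> has to inspect for a given rule.\<close>

lemma le_sel: "t \<in> set (list_decode z) \<Longrightarrow> t < z"
proof -
  have "t \<in> set xs \<Longrightarrow> t < list_encode xs" for xs
  proof (induction xs)
    case (Cons a xs)
    then show ?case
      using le_prod_encode_1[of a "list_encode xs"] le_prod_encode_2[of "list_encode xs" a] by auto
  qed simp
  from this[of "list_decode z"] show "t \<in> set (list_decode z) \<Longrightarrow> t < z" by simp
qed

subsection \<open>Search for an infinite path\<close>

text \<open>Well-foundedness of the tree above \<open>s\<close>, given inductively so that a
  successful search can be followed by rule induction. A node outside \<open>T\<close> is a dead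
  end, whatever lies beyond it.\<close>

inductive noPath :: "(nat list \<Rightarrow> bool) \<Rightarrow> nat list \<Rightarrow> bool" for T where
  "(T s \<Longrightarrow> \<forall>k. noPath T (s @ [k])) \<Longrightarrow> noPath T s"

lemma noPath_iff: "noPath T [] \<longleftrightarrow> \<not> (\<exists>f. \<forall>n. T (map f [0..<n]))"
proof
  assume np: "noPath T []"
  show "\<not> (\<exists>f. \<forall>n. T (map f [0..<n]))"
  proof
    assume "\<exists>f. \<forall>n. T (map f [0..<n])"
    then obtain f where f: "\<And>n. T (map f [0..<n])" by blast
    have "noPath T s \<Longrightarrow> \<forall>n. s \<noteq> map f [0..<n]" for s
    proof (induction rule: noPath.induct)
      case (1 s)
      show ?case
      proof (rule allI, rule notI)
        fix n assume s: "s = map f [0..<n]"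
        then have "\<forall>m. s @ [f n] \<noteq> map f [0..<m]" using 1 f by blast
        then show False using s by (metis list.simps(8,9) map_append upt_Suc_append le0)
      qed
    qed
    from this[OF np] show False by (metis list.simps(8) upt_0)
  qed
next
  assume nf: "\<not> (\<exists>f. \<forall>n. T (map f [0..<n]))"
  show "noPath T []"
  proof (rule ccontr)
    assume np: "\<not> noPath T []"
    have step: "T s \<and> (\<exists>k. \<not> noPath T (s @ [k]))" if "\<not> noPath T s" for s
      using that noPath.intros by blast
    have "\<exists>s. \<forall>n. (\<not> noPath T (s n) \<and> length (s n) = n) \<and> (\<exists>k. s (Suc n) = s n @ [k])"
      by (rule dependent_nat_choice) (use np step in force)+
    then obtain s where s: "\<And>n. \<not> noPath T (s n)" "\<And>n. length (s n) = n" "\<And>n. \<exists>k. s (Suc n) = s n @ [k]"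
      by blast
    define f where "f n = s (Suc n) ! n" for n
    have "s n = map f [0..<n]" for n
    proof (induction n)
      case 0
      then show ?case using s(2)[of 0] by simp
    next
      case (Suc n)
      obtain k where "s (Suc n) = s n @ [k]" using s(3) by blast
      then have "s (Suc n) = s n @ [f n]" unfolding f_def using s(2)[of n] by (metis nth_append_length)
      then show ?case using Suc by simp
    qed
    then have "T (map f [0..<n])" for n using step[OF s(1), of n] by simp
    then show False using nf by blast
  qed
qed

text \<open>Depth-first search. In the state \<open>(X, Y, a, b)\<close> the current node \<open>s\<close> is kept as
  \<open>X = Suc (list_encode s)\<close>, so that \<open>X = 0\<close> at a limit signals an infinite path; \<open>Y\<close> tells
  whether \<open>s\<close> is entered (0), left (1), or about to pass to its child \<open>k\<close> (\<open>k + 2\<close>). The pair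
  \<open>(a, b)\<close> alternates between \<open>(0, 1)\<close> and \<open>(1, 0)\<close> and hence equals \<open>(0, 0)\<close> exactly at limits.
  Since codes grow along the tree, \<open>X\<close> returns to \<open>s\<close> at a limit of passes through its children.\<close>

definition dfs :: "(nat \<Rightarrow> bool) \<Rightarrow> nat \<Rightarrow> (nat \<Rightarrow> nat) \<Rightarrow> nat" where
  "dfs T i v = (let X = v 0; Y = v (Suc 0); a = v (Suc (Suc 0)); b = v (Suc (Suc (Suc 0))) in
     if i = 0 then
       if a = b \<or> Y = 0 then X
       else if Y = 1 then Suc (list_encode (butlast (list_decode (X - 1))))
       else Suc (list_encode (list_decode (X - 1) @ [Y - 2]))
     else if i = Suc 0 then
       if a = b then 1
       else if Y = 0 then if T (X - 1) then 2 else 1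
       else if Y = 1 then sel (X - 1) (lenc (X - 1) - 1) + 3
       else 0
     else if i = Suc (Suc 0) then b
     else if i = Suc (Suc (Suc 0)) then if a = b then 1 else a
     else if a = b \<and> X = 0 \<or> a \<noteq> b \<and> X = 1 \<and> Y = 1 then 1 else 0)"

abbreviation dst :: "nat \<Rightarrow> nat \<Rightarrow> nat \<Rightarrow> nat \<Rightarrow> (nat \<Rightarrow> nat) \<Rightarrow> nat \<Rightarrow> nat" where
  "dst X Y a b e \<equiv> case_nat X (case_nat Y (case_nat a (case_nat b e)))"

abbreviation node :: "nat list \<Rightarrow> nat" where "node s \<equiv> Suc (list_encode s)"

context
  fixes T :: "nat \<Rightarrow> bool" and e :: "nat \<Rightarrow> nat"
begin

abbreviation "dfsG \<equiv> env_step 4 (dfs T)"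

lemma dfs_step:
  "dfsG (dst X Y a b e) = dst (dfs T 0 (dst X Y a b e)) (dfs T (Suc 0) (dst X Y a b e))
     (dfs T (Suc (Suc 0)) (dst X Y a b e)) (dfs T (Suc (Suc (Suc 0))) (dst X Y a b e)) e"
  by (auto simp: env_step_def fun_eq_iff split: nat.splits)

lemma dfs_steps:
  "a \<noteq> b \<Longrightarrow> dfsG (dst (node s) 0 a b e) = dst (node s) (if T (list_encode s) then 2 else 1) b a e"
  "a \<noteq> b \<Longrightarrow> dfsG (dst (node s) (Suc (Suc k)) a b e) = dst (node (s @ [k])) 0 b a e"
  "a \<noteq> b \<Longrightarrow> dfsG (dst (node (s @ [k])) 1 a b e) = dst (node s) (Suc (Suc (Suc k))) b a e"
  "dfsG (dst (node s) Y 0 0 e) = dst (node s) 1 0 1 e"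
  by (subst dfs_step, simp add: dfs_def Let_def)+

text \<open>The two states of the limit detector \<open>(a, b)\<close> away from limits.\<close>

definition tog :: "nat \<Rightarrow> nat \<Rightarrow> bool" where "tog a b \<longleftrightarrow> a = 0 \<and> b = 1 \<or> a = 1 \<and> b = 0"

text \<open>That the search stays in the subtree of \<open>s\<close> is recorded only as a lower
  bound on the node code, which is what the inferior limit of that component needs.\<close>

definition sub :: "nat list \<Rightarrow> vec set \<Rightarrow> bool" where
  "sub s V \<longleftrightarrow> (\<forall>v\<in>V. node s \<le> v 0 \<and> dfs T 4 v = 0 \<and> (\<exists>X Y a b. v = dst X Y a b e))"

text \<open>Each detector component has been 0 somewhere in the block, so both are 0 at a limit of
  such blocks.\<close>

definition alt :: "vec set \<Rightarrow> bool" where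
  "alt V \<longleftrightarrow> (\<exists>v\<in>V. v (Suc (Suc 0)) = 0) \<and> (\<exists>v\<in>V. v (Suc (Suc (Suc 0))) = 0)"

lemma alt_two:
  assumes "tog a b" "dst X Y a b e \<in> V" "dst X' Y' b a e \<in> V" shows "alt V"
proof -
  have "dst X Y a b e (Suc (Suc 0)) = a" "dst X Y a b e (Suc (Suc (Suc 0))) = b"
    "dst X' Y' b a e (Suc (Suc 0)) = b" "dst X' Y' b a e (Suc (Suc (Suc 0))) = a" by simp_all
  then show ?thesis using assms unfolding alt_def tog_def by metis
qed

lemma dfs_4 [simp]: "dfs T 4 (dst X Y a b e) = (if a = b \<and> X = 0 \<or> a \<noteq> b \<and> X = 1 \<and> Y = 1 then 1 else 0)"
  by (simp add: dfs_def Let_def)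

lemma dfs_limit:
  assumes "\<And>n. sub s (V n)" "\<And>n. alt (V n)"
  shows "\<exists>Y. lim_vec V = dst (lim_vec V 0) Y 0 0 e"
proof -
  have ne: "V n \<noteq> {}" for n using assms(2)[of n] unfolding alt_def by blast
  have "lim_vec V (Suc (Suc 0)) = 0"
    by (rule lim_vec_eq) (use assms(2) in \<open>auto simp: is_liminf_def alt_def\<close>)
  moreover have "lim_vec V (Suc (Suc (Suc 0))) = 0"
    by (rule lim_vec_eq) (use assms(2) in \<open>auto simp: is_liminf_def alt_def\<close>)
  moreover have "lim_vec V (Suc (Suc (Suc (Suc i)))) = e i" for i
  proof (rule lim_vec_const[OF ne])
    fix n v assume "v \<in> V n"
    then obtain X Y a b where "v = dst X Y a b e" using assms(1)[of n] unfolding sub_def by blast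
    then show "v (Suc (Suc (Suc (Suc i)))) = e i" by simp
  qed
  ultimately have "lim_vec V = dst (lim_vec V 0) (lim_vec V (Suc 0)) 0 0 e"
    by (auto simp: fun_eq_iff split: nat.splits)
  then show ?thesis by blast
qed

lemma dfs_child:
  assumes "tog a b" "trun dfsG (dst (node (s @ [k])) 0 b a e) V (dst (node (s @ [k])) 1 c d e)"
    "sub (s @ [k]) V" "tog c d" "V \<noteq> {}"
  shows "\<exists>W. trun dfsG (dst (node s) (Suc (Suc k)) a b e) W (dst (node s) (Suc (Suc (Suc k))) d c e) \<and>
    sub s W \<and> alt W \<and> dst (node s) (Suc (Suc k)) a b e \<in> W"
proof -
  have ab: "a \<noteq> b" "c \<noteq> d" using assms(1,4) unfolding tog_def by auto
  let ?W = "insert (dst (node s) (Suc (Suc k)) a b e) (insert (dst (node (s @ [k])) 1 c d e) V)"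
  have "trun dfsG (dst (node (s @ [k])) 0 b a e) (insert (dst (node (s @ [k])) 1 c d e) V)
      (dst (node s) (Suc (Suc (Suc k))) d c e)"
    using trun_step[OF assms(2)] dfs_steps(3)[OF ab(2)] by simp
  then have "trun dfsG (dst (node s) (Suc (Suc k)) a b e) ?W (dst (node s) (Suc (Suc (Suc k))) d c e)"
    using trun_Cons[of dfsG "dst (node s) (Suc (Suc k)) a b e"] dfs_steps(2)[OF ab(1)] by simp
  moreover have "node s < node (s @ [k])" using list_encode_snoc by simp
  then have "sub s ?W" using assms(3) unfolding sub_def by (fastforce simp: ab)
  moreover have "dst (node (s @ [k])) 0 b a e \<in> V" using trun_start[OF assms(2,5)] .
  then have "alt ?W" by (intro alt_two[OF assms(1)]) blast+
  ultimately show ?thesis by blast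
qed

text \<open>The visits to the children 0, 1, 2, ... form the blocks of a limit. There the node code
  is that of \<open>s\<close> again and the detector shows \<open>(0, 0)\<close>; the next step sets
  the mode to leaving, whatever the limit value of \<open>Y\<close> is.\<close>

lemma dfs_noPath:
  assumes "noPath (\<lambda>s. T (list_encode s)) s" "tog a b"
  shows "\<exists>V c d. trun dfsG (dst (node s) 0 a b e) V (dst (node s) 1 c d e) \<and> sub s V \<and> tog c d \<and> V \<noteq> {}"
  using assms
proof (induction arbitrary: a b rule: noPath.induct)
  case (1 s)
  have ab: "a \<noteq> b" "tog b a" using 1(2) unfolding tog_def by auto
  show ?case
  proof (cases "T (list_encode s)")
    case False
    have "trun dfsG (dst (node s) 0 a b e) {dst (node s) 0 a b e} (dst (node s) 1 b a e)"
      using trun_step1[of dfsG "dst (node s) 0 a b e"] dfs_steps(1)[OF ab(1)] False by simp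
    moreover have "sub s {dst (node s) 0 a b e}" unfolding sub_def by (auto simp: ab)
    ultimately show ?thesis using ab by blast
  next
    case True
    have IH: "\<And>k a b. tog a b \<Longrightarrow> \<exists>V c d. trun dfsG (dst (node (s @ [k])) 0 a b e) V (dst (node (s @ [k])) 1 c d e) \<and>
        sub (s @ [k]) V \<and> tog c d \<and> V \<noteq> {}"
      using 1(1) True by blast
    let ?R = "\<lambda>k q q'. \<exists>W. trun dfsG (dst (node s) (Suc (Suc k)) (fst q) (snd q) e) W
        (dst (node s) (Suc (Suc (Suc k))) (fst q') (snd q') e) \<and>
        sub s W \<and> alt W \<and> dst (node s) (Suc (Suc k)) (fst q) (snd q) e \<in> W"
    have "\<exists>q. \<forall>k. (tog (fst (q k)) (snd (q k)) \<and> (k = 0 \<longrightarrow> q k = (b, a))) \<and> ?R k (q k) (q (Suc k))"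
    proof (rule dependent_nat_choice)
      show "\<exists>x. tog (fst x) (snd x) \<and> (0 = (0::nat) \<longrightarrow> x = (b, a))" using ab(2) by auto
    next
      fix x and k :: nat assume x: "tog (fst x) (snd x) \<and> (k = 0 \<longrightarrow> x = (b, a))"
      then have "tog (snd x) (fst x)" unfolding tog_def by auto
      then obtain V c d where V: "trun dfsG (dst (node (s @ [k])) 0 (snd x) (fst x) e) V (dst (node (s @ [k])) 1 c d e)"
        "sub (s @ [k]) V" "tog c d" "V \<noteq> {}" using IH by blast
      have "tog d c" using V(3) unfolding tog_def by auto
      then show "\<exists>y. (tog (fst y) (snd y) \<and> (Suc k = 0 \<longrightarrow> y = (b, a))) \<and> ?R k x y"
        using dfs_child[OF conjunct1[OF x] V] by (intro exI[of _ "(d, c)"]) simp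
    qed
    then obtain q W where q: "q 0 = (b, a)"
      and W: "\<And>k. trun dfsG (dst (node s) (Suc (Suc k)) (fst (q k)) (snd (q k)) e) (W k)
        (dst (node s) (Suc (Suc (Suc k))) (fst (q (Suc k))) (snd (q (Suc k))) e)"
        "\<And>k. sub s (W k)" "\<And>k. alt (W k)" "\<And>k. dst (node s) (Suc (Suc k)) (fst (q k)) (snd (q k)) e \<in> W k"
      by metis
    have "trun dfsG (dst (node s) (Suc (Suc 0)) (fst (q 0)) (snd (q 0)) e) (\<Union>k. W k) (lim_vec W)"
    proof (rule trun_lim[of dfsG "\<lambda>k. dst (node s) (Suc (Suc k)) (fst (q k)) (snd (q k)) e"])
      show "W k \<noteq> {}" for k using W(4)[of k] by blast
    qed (rule W(1))
    moreover have l0: "lim_vec W 0 = node s"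
    proof (rule lim_vec_eq)
      have "node s \<le> v 0" if "v \<in> W n" for v n using W(2)[of n] that unfolding sub_def by blast
      moreover have "\<exists>v\<in>W n. v 0 = node s" for n using W(4)[of n] by (rule bexI[rotated]) simp
      ultimately show "is_liminf W 0 (node s)" unfolding is_liminf_def by blast
    qed
    moreover obtain Y where "lim_vec W = dst (lim_vec W 0) Y 0 0 e" using dfs_limit[of s W] W(2,3) by blast
    ultimately have t: "trun dfsG (dst (node s) 2 b a e) (\<Union>k. W k) (dst (node s) Y 0 0 e)"
      using q by (simp add: numeral_2_eq_2)
    let ?V = "insert (dst (node s) 0 a b e) (insert (dst (node s) Y 0 0 e) (\<Union>k. W k))"
    have "trun dfsG (dst (node s) 2 b a e) (insert (dst (node s) Y 0 0 e) (\<Union>k. W k)) (dst (node s) 1 0 1 e)"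
      using trun_step[OF t] dfs_steps(4) by simp
    then have "trun dfsG (dst (node s) 0 a b e) ?V (dst (node s) 1 0 1 e)"
      using trun_Cons[of dfsG "dst (node s) 0 a b e"] dfs_steps(1)[OF ab(1)] True by simp
    moreover have "sub s ?V" using W(2) ab unfolding sub_def by auto
    ultimately show ?thesis unfolding tog_def by blast
  qed
qed

text \<open>The children before the first ill-founded one are searched completely by
  \<open>dfs_noPath\<close>, so the search follows the leftmost infinite branch.\<close>

lemma dfs_Path_step:
  assumes "\<not> noPath (\<lambda>s. T (list_encode s)) s" "tog a b"
  shows "\<exists>V k c d. trun dfsG (dst (node s) 0 a b e) V (dst (node (s @ [k])) 0 c d e) \<and> sub s V \<and> tog c d \<and> alt V \<and>
    \<not> noPath (\<lambda>s. T (list_encode s)) (s @ [k])"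
proof -
  let ?P = "\<lambda>k. \<not> noPath (\<lambda>s. T (list_encode s)) (s @ [k])"
  have T: "T (list_encode s)" "\<exists>k. ?P k" using assms(1) noPath.intros[of "\<lambda>s. T (list_encode s)" s] by blast+
  define k where "k = (LEAST k. ?P k)"
  have k: "?P k" "\<And>j. j < k \<Longrightarrow> noPath (\<lambda>s. T (list_encode s)) (s @ [j])"
    unfolding k_def using LeastI_ex[OF T(2)] not_less_Least by blast+
  have ab: "a \<noteq> b" "tog b a" using assms(2) unfolding tog_def by auto
  have "\<exists>V c d. trun dfsG (dst (node s) 2 b a e) V (dst (node s) (Suc (Suc j)) c d e) \<and> sub s V \<and> tog c d" if "j \<le> k" for j
    using that
  proof (induction j)
    case 0
    then show ?case using ab(2) trun_refl[of dfsG "dst (node s) 2 b a e"]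
      by (intro exI[of _ "{}"] exI[of _ b] exI[of _ a]) (auto simp: sub_def numeral_2_eq_2)
  next
    case (Suc j)
    then obtain V c d where V: "trun dfsG (dst (node s) 2 b a e) V (dst (node s) (Suc (Suc j)) c d e)" "sub s V" "tog c d"
      by auto
    have dc: "tog d c" using V(3) unfolding tog_def by auto
    obtain W c' d' where W: "trun dfsG (dst (node (s @ [j])) 0 d c e) W (dst (node (s @ [j])) 1 c' d' e)"
      "sub (s @ [j]) W" "tog c' d'" "W \<noteq> {}"
      using dfs_noPath[OF k(2)[of j] dc] Suc.prems by auto
    obtain U where U: "trun dfsG (dst (node s) (Suc (Suc j)) c d e) U (dst (node s) (Suc (Suc (Suc j))) d' c' e)" "sub s U"
      using dfs_child[OF V(3) W] by blast
    have "sub s (V \<union> U)" using V(2) U(2) unfolding sub_def by (simp add: ball_Un)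
    moreover have "tog d' c'" using W(3) unfolding tog_def by auto
    ultimately show ?case using trun_trans[OF U(1) V(1)] by blast
  qed
  from this[of k] obtain V c d where V: "trun dfsG (dst (node s) 2 b a e) V (dst (node s) (Suc (Suc k)) c d e)" "sub s V" "tog c d"
    by auto
  have cd: "c \<noteq> d" "tog d c" using V(3) unfolding tog_def by auto
  let ?V = "insert (dst (node s) 0 a b e) (insert (dst (node s) (Suc (Suc k)) c d e) V)"
  have "trun dfsG (dst (node s) 2 b a e) (insert (dst (node s) (Suc (Suc k)) c d e) V) (dst (node (s @ [k])) 0 d c e)"
    using trun_step[OF V(1)] dfs_steps(2)[OF cd(1)] by simp
  moreover from this have "dst (node s) 2 b a e \<in> insert (dst (node s) (Suc (Suc k)) c d e) V" using trun_start by blast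
  ultimately have "trun dfsG (dst (node s) 0 a b e) ?V (dst (node (s @ [k])) 0 d c e)" "dst (node s) 2 b a e \<in> ?V"
    using trun_Cons[of dfsG "dst (node s) 0 a b e"] dfs_steps(1)[OF ab(1)] T by auto
  moreover have "sub s ?V" using V(2) ab cd unfolding sub_def by auto
  moreover have "alt ?V"
    by (rule alt_two[OF assms(2) _ \<open>dst (node s) 2 b a e \<in> ?V\<close>]) blast
  ultimately show ?thesis using cd(2) k(1) by blast
qed

lemma dfs_Path:
  assumes "\<not> noPath (\<lambda>s. T (list_encode s)) []"
  shows "\<exists>V Y. trun dfsG (dst (node []) 0 0 1 e) V (dst 0 Y 0 0 e) \<and> (\<forall>v\<in>V. dfs T 4 v = 0)"
proof -
  let ?N = "noPath (\<lambda>s. T (list_encode s))"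
  let ?R = "\<lambda>q q'. \<exists>V k. trun dfsG (dst (node (fst q)) 0 (fst (snd q)) (snd (snd q)) e) V
      (dst (node (fst q')) 0 (fst (snd q')) (snd (snd q')) e) \<and> sub (fst q) V \<and> alt V \<and> fst q' = fst q @ [k]"
  have "\<exists>q. \<forall>n. ((\<not> ?N (fst (q n)) \<and> tog (fst (snd (q n))) (snd (snd (q n)))) \<and> (n = 0 \<longrightarrow> q n = ([], 0, 1))) \<and> ?R (q n) (q (Suc n))"
  proof (rule dependent_nat_choice)
    show "\<exists>x. (\<not> ?N (fst x) \<and> tog (fst (snd x)) (snd (snd x))) \<and> (0 = (0::nat) \<longrightarrow> x = ([], 0, 1))"
      using assms by (auto simp: tog_def)
  next
    fix x and n :: nat assume x: "(\<not> ?N (fst x) \<and> tog (fst (snd x)) (snd (snd x))) \<and> (n = 0 \<longrightarrow> x = ([], 0, 1))"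
    then obtain V k c d where "trun dfsG (dst (node (fst x)) 0 (fst (snd x)) (snd (snd x)) e) V (dst (node (fst x @ [k])) 0 c d e)"
       "sub (fst x) V" "tog c d" "alt V" "\<not> ?N (fst x @ [k])" using dfs_Path_step by meson
    then show "\<exists>y. ((\<not> ?N (fst y) \<and> tog (fst (snd y)) (snd (snd y))) \<and> (Suc n = 0 \<longrightarrow> y = ([], 0, 1))) \<and> ?R x y"
      by (intro exI[of _ "(fst x @ [k], c, d)"]) auto
  qed
  then obtain q V where q: "q 0 = ([], 0, 1)" "\<And>n. \<exists>k. fst (q (Suc n)) = fst (q n) @ [k]"
    and V: "\<And>n. trun dfsG (dst (node (fst (q n))) 0 (fst (snd (q n))) (snd (snd (q n))) e) (V n)
      (dst (node (fst (q (Suc n)))) 0 (fst (snd (q (Suc n)))) (snd (snd (q (Suc n)))) e)"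
      "\<And>n. sub (fst (q n)) (V n)" "\<And>n. alt (V n)"
    by metis
  \<comment> \<open>Node codes increase strictly along the branch, so \<open>X\<close> diverges and
    is reset to 0.\<close>
  have ge: "n \<le> list_encode (fst (q n))" for n
  proof (induction n)
    case (Suc n)
    obtain k where "fst (q (Suc n)) = fst (q n) @ [k]" using q(2) by blast
    then show ?case using Suc list_encode_snoc[of "fst (q n)" k] by simp
  qed simp
  have sub0: "sub [] (V n)" for n using V(2)[of n] unfolding sub_def by fastforce
  have "lim_vec V 0 = 0"
  proof (rule lim_vec_none)
    fix x
    have "\<not> (\<exists>n\<ge>x. \<exists>v\<in>V n. v 0 = x)"
    proof
      assume "\<exists>n\<ge>x. \<exists>v\<in>V n. v 0 = x"
      then obtain n v where "n \<ge> x" "v \<in> V n" "v 0 = x" by blast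
      then show False using V(2)[of n] ge[of n] unfolding sub_def by fastforce
    qed
    then show "\<not> is_liminf V 0 x" unfolding is_liminf_def by blast
  qed
  then obtain Y where Y: "lim_vec V = dst 0 Y 0 0 e" using dfs_limit[of "[]" V] sub0 V(3) by metis
  have "V n \<noteq> {}" for n using V(3)[of n] unfolding alt_def by blast
  then have "trun dfsG (dst (node (fst (q 0))) 0 (fst (snd (q 0))) (snd (snd (q 0))) e) (\<Union>n. V n) (lim_vec V)"
    by (intro trun_lim[of dfsG "\<lambda>n. dst (node (fst (q n))) 0 (fst (snd (q n))) (snd (snd (q n))) e"] V(1))
  then have "trun dfsG (dst (node []) 0 0 1 e) (\<Union>n. V n) (dst 0 Y 0 0 e)" using q(1) Y by simp
  moreover have "\<forall>v\<in>(\<Union>n. V n). dfs T 4 v = 0" using sub0 unfolding sub_def by blast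
  ultimately show ?thesis by blast
qed

end

theorem cp_path:
  assumes "cp (\<lambda>w e. T w (\<lambda>i. e (Suc i)) (e 0))"
  shows "cp (\<lambda>w e. \<exists>f. \<forall>n. T w e (list_encode (map f [0..<n])))"
proof -
  define g where "g i w v = dfs (T w (\<lambda>i. v (Suc (Suc (Suc (Suc i)))))) i v" for i w and v :: "nat \<Rightarrow> nat"
  define ini where "ini w e = dst 1 0 0 1 e" for w :: "nat set" and e
  define out where "out w e = (if \<exists>f. \<forall>n. T w e (list_encode (map f [0..<n])) then 0 else Suc 0)" for w e
  have "cf out"
  proof (rule cf_loop[where m = 4 and g = g and ini = ini])
    fix i :: nat assume "i \<le> 4"
    have "cp (\<lambda>w v. T w (\<lambda>i. v (Suc (Suc (Suc (Suc i))))) (v 0 - 1))"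
      by (rule cp_cong[OF cp_env[OF assms, of "\<lambda>v. case_nat (v 0 - 1) (\<lambda>i. v (Suc (Suc (Suc (Suc i)))))"]])
         (auto intro!: cfi)
    then show "cf (g i)" unfolding g_def dfs_def Let_def
      by (cases "i = 0"; cases "i = Suc 0"; cases "i = Suc (Suc 0)"; cases "i = Suc (Suc (Suc 0))")
         (simp_all only: if_True if_False refl, (intro cfi | assumption)+)
  next
    fix i show "cf (\<lambda>w e. ini w e i)" unfolding ini_def by (intro cfi)
  next
    fix w e
    let ?T = "T w e"
    have g: "g i w (dst X Y a b e) = dfs ?T i (dst X Y a b e)" for i X Y a b
      unfolding g_def by simp
    \<comment> \<open>The actual loop reads the parameters of \<open>T\<close> from the tail of its
      state. This tail never changes, so the analysis with fixed parameters \<open>e\<close>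
      applies.\<close>
    have tr: "trun (env_step 4 (\<lambda>i. g i w)) (dst X Y a b e) V d \<and> (\<forall>v\<in>V. g 4 w v = dfs ?T 4 v)"
      if t: "trun (env_step 4 (dfs ?T)) (dst X Y a b e) V d" for X Y a b V d
    proof -
      have "v (Suc (Suc (Suc (Suc i)))) = e i" if "v \<in> V" for v i
        using trun_const[OF _ t, of "Suc (Suc (Suc (Suc i)))"] that by (simp add: env_step_def)
      then have "(\<lambda>i. v (Suc (Suc (Suc (Suc i))))) = e" if "v \<in> V" for v using that by blast
      then have gv: "g i w v = dfs ?T i v" if "v \<in> V" for v i using that unfolding g_def by simp
      then have "trun (env_step 4 (\<lambda>i. g i w)) (id (dst X Y a b e)) (id ` V) (id d)"
        by (intro trun_map[OF t, where p = Some and k = "\<lambda>_. 0"]) (auto simp: env_step_def)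
      then show ?thesis using gv by simp
    qed
    show "\<exists>W e'. trun (env_step 4 (\<lambda>i. g i w)) (ini w e) W e' \<and> (\<forall>v\<in>W. g 4 w v = 0) \<and> g 4 w e' \<noteq> 0 \<and> out w e = e' 0"
    proof (cases "noPath (\<lambda>s. ?T (list_encode s)) []")
      case True
      then have o: "out w e = Suc 0" unfolding out_def noPath_iff by simp
      have "tog 0 1" unfolding tog_def by simp
      from dfs_noPath[OF True this, of e] obtain V c d where
        V: "trun (env_step 4 (dfs ?T)) (dst (node []) 0 0 1 e) V (dst (node []) 1 c d e)" "sub ?T e [] V" "tog c d"
        by blast
      have "g 4 w (dst (node []) 1 c d e) \<noteq> 0" using V(3) unfolding g tog_def by auto
      then show ?thesis using tr[OF V(1)] V(2) o unfolding ini_def sub_def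
        by (intro exI[of _ V] exI[of _ "dst (node []) 1 c d e"]) auto
    next
      case False
      then have o: "out w e = 0" unfolding out_def noPath_iff by simp
      obtain V Y where V: "trun (env_step 4 (dfs ?T)) (dst (node []) 0 0 1 e) V (dst 0 Y 0 0 e)" "\<forall>v\<in>V. dfs ?T 4 v = 0"
        using dfs_Path[OF False] by blast
      have "g 4 w (dst 0 Y 0 0 e) \<noteq> 0" unfolding g by simp
      then show ?thesis using tr[OF V(1)] V(2) o unfolding ini_def
        by (intro exI[of _ V] exI[of _ "dst 0 Y 0 0 e"]) auto
    qed
  qed
  show ?thesis unfolding cp_def
    by (rule cf_cong[OF cf_if[OF cp_eq[OF \<open>cf out\<close> cf_const[of 0]] cf_const[of 1] cf_const[of 0]]]) (simp add: out_def)
qed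

section \<open>Inductive definitions\<close>

text \<open>Every premise list \<open>b\<close> with \<open>M s a b\<close> justifies \<open>s\<close> against the challenge \<open>a\<close>.\<close>

inductive ind :: "(nat \<Rightarrow> nat \<Rightarrow> nat \<Rightarrow> bool) \<Rightarrow> nat \<Rightarrow> bool" for M where
  indI: "(\<And>a. \<exists>b. M s a b \<and> (\<forall>t\<in>set (list_decode b). ind M t)) \<Longrightarrow> ind M s"

lemma indD: "ind M s \<Longrightarrow> \<exists>b. M s a b \<and> (\<forall>t\<in>set (list_decode b). ind M t)"
  by (erule ind.cases) blast

text \<open>A refutation is a function on numbers: \<open>f p = 0\<close> claims nothing, and
  \<open>f p = Suc a\<close> claims that the challenge \<open>a\<close> defeats \<open>p\<close>, so
  that every premise list justifying \<open>p\<close> against \<open>a\<close> contains another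
  refuted statement.\<close>

lemma not_ind_iff:
  "\<not> ind M c \<longleftrightarrow> (\<exists>f. 0 < f c \<and> (\<forall>p b. 0 < f p \<and> M p (f p - 1) b \<longrightarrow> (\<exists>t\<in>set (list_decode b). 0 < (f t :: nat))))"
proof
  assume c: "\<not> ind M c"
  have "\<forall>p. \<exists>a. \<not> ind M p \<longrightarrow> (\<forall>b. M p a b \<longrightarrow> (\<exists>t\<in>set (list_decode b). \<not> ind M t))"
    using indI by metis
  then obtain h where h: "\<And>p b. \<not> ind M p \<Longrightarrow> M p (h p) b \<Longrightarrow> \<exists>t\<in>set (list_decode b). \<not> ind M t" by metis
  then show "\<exists>f. 0 < f c \<and> (\<forall>p b. 0 < f p \<and> M p (f p - 1) b \<longrightarrow> (\<exists>t\<in>set (list_decode b). 0 < (f t :: nat)))"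
    using c by (intro exI[of _ "\<lambda>p. if ind M p then 0 else Suc (h p)"]) auto
next
  assume "\<exists>f. 0 < f c \<and> (\<forall>p b. 0 < f p \<and> M p (f p - 1) b \<longrightarrow> (\<exists>t\<in>set (list_decode b). 0 < (f t :: nat)))"
  then obtain f :: "nat \<Rightarrow> nat" where f: "0 < f c"
    "\<And>p b. 0 < f p \<Longrightarrow> M p (f p - 1) b \<Longrightarrow> \<exists>t\<in>set (list_decode b). 0 < f t" by blast
  have "ind M p \<Longrightarrow> f p = 0" for p
  proof (induction rule: ind.induct)
    case (indI s)
    obtain b where "M s (f s - 1) b" "\<forall>t\<in>set (list_decode b). f t = 0" using indI by blast
    then show ?case using f(2)[of s b] by fastforce
  qed
  then show "\<not> ind M c" using f(1) by fastforce
qed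

lemma cp_env3: "cp (\<lambda>w e. A w (\<lambda>i. e (Suc (Suc (Suc i)))) (e (Suc (Suc 0))) (e (Suc 0)) (e 0)) \<Longrightarrow>
    (\<And>i. cf (\<lambda>w e. t e i)) \<Longrightarrow> cf (\<lambda>w e. x e) \<Longrightarrow> cf (\<lambda>w e. y e) \<Longrightarrow> cf (\<lambda>w e. z e) \<Longrightarrow>
    cp (\<lambda>w e. A w (t e) (x e) (y e) (z e))"
  by (rule cp_cong[OF cp_env[of _ "\<lambda>e. case_nat (z e) (case_nat (y e) (case_nat (x e) (t e)))"]]) (auto intro!: cfi)

theorem cp_ind:
  assumes M: "cp (\<lambda>w e. M w (\<lambda>i. e (Suc (Suc (Suc i)))) (e (Suc (Suc 0))) (e (Suc 0)) (e 0))" and s: "cf s"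
  shows "cp (\<lambda>w e. ind (M w e) (s w e))"
proof -
  \<comment> \<open>Being a refutation of \<open>c\<close> is a closed condition on
    \<open>f\<close>: by \<open>le_sel\<close> a violation shows in an initial segment longer than
    \<open>p\<close> and \<open>b\<close>. Refutations are therefore the infinite paths through a
    decidable tree.\<close>
  define T where "T w e c z \<longleftrightarrow> (c < lenc z \<longrightarrow> 0 < sel z c) \<and>
    (\<forall>p. p < lenc z \<longrightarrow> (\<forall>b. b < lenc z \<longrightarrow> 0 < sel z p \<and> M w e p (sel z p - 1) b \<longrightarrow>
      (\<exists>t. t \<in> set (list_decode b) \<and> 0 < sel z t)))" for w e c z
  have "cp (\<lambda>w e. \<exists>f. \<forall>n. T w (\<lambda>i. e (Suc i)) (e 0) (list_encode (map f [0..<n])))"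
    unfolding T_def by (rule cp_path) (intro cfi cp_env3[OF M])
  moreover have "(\<exists>f. \<forall>n. T w e c (list_encode (map f [0..<n]))) \<longleftrightarrow> \<not> ind (M w e) c" for w e c
  proof -
    have "(\<forall>n. T w e c (list_encode (map f [0..<n]))) \<longleftrightarrow>
       0 < f c \<and> (\<forall>p b. 0 < f p \<and> M w e p (f p - 1) b \<longrightarrow> (\<exists>t\<in>set (list_decode b). 0 < f t))" (is "?L \<longleftrightarrow> ?R") for f
    proof
      assume L: ?L
      have "0 < f c" using L[rule_format, of "Suc c"] by (simp add: T_def del: upt_Suc)
      moreover have "\<exists>t\<in>set (list_decode b). 0 < f t" if pb: "0 < f p" "M w e p (f p - 1) b" for p b
      proof -
        define z where "z = list_encode (map f [0..<Suc (p + b)])"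
        have "T w e c z" using L unfolding z_def by blast
        moreover have "p < lenc z" "b < lenc z" "sel z p = f p" unfolding z_def by (simp_all del: upt_Suc)
        ultimately have "\<exists>t. t \<in> set (list_decode b) \<and> 0 < sel z t"
          using pb unfolding T_def by metis
        then obtain t where t: "t \<in> set (list_decode b)" "0 < sel z t" by blast
        have "t < Suc (p + b)" using le_sel[OF t(1)] by simp
        then show ?thesis using t unfolding z_def by (auto simp del: upt_Suc)
      qed
      ultimately show ?R by blast
    next
      assume R: ?R
      show ?L
      proof
        fix n
        have "\<exists>t. t \<in> set (list_decode b) \<and> 0 < sel (list_encode (map f [0..<n])) t"
          if pb: "p < n" "b < n" "0 < f p" "M w e p (f p - 1) b" for p b
        proof -
          obtain t where t: "t \<in> set (list_decode b)" "0 < f t" using R pb by blast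
          then have "t < n" using le_sel pb(2) by fastforce
          then show ?thesis using t by auto
        qed
        then show "T w e c (list_encode (map f [0..<n]))" using R unfolding T_def by simp
      qed
    qed
    then show ?thesis unfolding not_ind_iff by presburger
  qed
  ultimately have "cp (\<lambda>w e. \<not> ind (M w (\<lambda>i. e (Suc i))) (e 0))" by simp
  then have "cp (\<lambda>w e. ind (M w (\<lambda>i. e (Suc i))) (e 0))" using cp_not by fastforce
  then show ?thesis by (rule cp_app[of "\<lambda>w e. ind (M w e)", OF _ s])
qed

section \<open>Randomness and forcing\<close>

lemma cf_itrm_comp: "cf f \<Longrightarrow> \<exists>P. \<forall>w i. itrm_comp P w i (f w (case_nat i (\<lambda>_. 0)))"
proof -
  assume "cf f"
  then obtain C where C: "computes C f" unfolding cf_def by blast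
  have "itrm_comp C w i (f w (case_nat i (\<lambda>_. 0)))" for w i
  proof -
    obtain X where X: "blk {} C w (case_nat i (\<lambda>_. 0)) X" "X 0 = f w (case_nat i (\<lambda>_. 0))"
      using C unfolding computes_def by blast
    have "vec (init_config i) = cfg 0 (case_nat i (\<lambda>_. 0))"
      unfolding vec_def init_config_def by (auto simp: fun_eq_iff split: nat.splits)
    then show ?thesis using X unfolding itrm_comp_def halts_with_iff blk_def
      by (metis old.nat.simps(4) old.nat.simps(5) order_refl)
  qed
  then show ?thesis by blast
qed

lemma cp_decidable: "cp A \<Longrightarrow> itrm_decidable {w. A w e}"
proof -
  assume "cp A"
  then have "cp (\<lambda>w e'. A w e)" by (rule cp_env) (intro cfi)
  from cf_itrm_comp[OF this[unfolded cp_def]] obtain P where "\<forall>w i. itrm_comp P w i (if A w e then 1 else 0)"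
    by blast
  then show ?thesis unfolding itrm_decidable_def itrm_comp0_def itrm_comp_def
    by (intro exI[of _ P]) (metis mem_Collect_eq)
qed

text \<open>A number \<open>s\<close> is read as the condition \<open>s 0, \<dots>, s (lenc s - 1)\<close>, where
  \<open>s i\<close> being nonzero means that \<open>i\<close> belongs to the real.\<close>

definition ext :: "nat \<Rightarrow> nat \<Rightarrow> bool" where
  "ext s t \<longleftrightarrow> lenc s \<le> lenc t \<and> (\<forall>i. i < lenc s \<longrightarrow> (sel s i = 0) = (sel t i = 0))"

definition res :: "nat set \<Rightarrow> nat \<Rightarrow> nat" where
  "res w k = list_encode (map (\<lambda>i. if i \<in> w then 1 else 0) [0..<k])"

definition inc :: "nat \<Rightarrow> nat set \<Rightarrow> bool" where
  "inc s w \<longleftrightarrow> (\<forall>i. i < lenc s \<longrightarrow> (i \<in> w) = (sel s i \<noteq> 0))"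

lemma cp_ext [cfi]: "cf a \<Longrightarrow> cf b \<Longrightarrow> cp (\<lambda>w e. ext (a w e) (b w e))"
proof -
  assume ab: "cf a" "cf b"
  have "cp (\<lambda>w e. ext (e 0) (e (Suc 0)))" unfolding ext_def by (intro cfi)
  then show ?thesis unfolding cp_def
    using cf_fun2[of "\<lambda>x y. if ext x y then 1 else 0" a b] ab by simp
qed

lemma cp_inc0: "cp (\<lambda>w e. inc (e 0) w)" unfolding inc_def by (intro cfi)

lemma cp_inc [cfi]: "cf a \<Longrightarrow> cp (\<lambda>w e. inc (a w e) w)"
  using cp_app[of "\<lambda>w e x. inc x w" a] cp_inc0 by simp

lemma cf_res0: "cf (\<lambda>w e. res w (e 0))" unfolding res_def by (intro cfi)

lemma cf_res [cfi]: "cf a \<Longrightarrow> cf (\<lambda>w e. res w (a w e))"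
  using cf_app[of "\<lambda>w e x. res w x" a] cf_res0 by simp

lemma lenc_res [simp]: "lenc (res w k) = k" by (simp add: res_def)

lemma sel_res [simp]: "i < k \<Longrightarrow> sel (res w k) i = (if i \<in> w then 1 else 0)" by (simp add: res_def)

lemma ext_refl [simp]: "ext s s" by (simp add: ext_def)

lemma ext_trans: "ext s t \<Longrightarrow> ext t u \<Longrightarrow> ext s u" by (auto simp: ext_def)

lemma ext_res [simp]: "j \<le> k \<Longrightarrow> ext (res w j) (res w k)" by (auto simp: ext_def)

lemma inc_ext_res: "inc s w \<Longrightarrow> lenc s \<le> k \<Longrightarrow> ext s (res w k)" by (auto simp: ext_def inc_def)

lemma inc_res [simp]: "inc (res w k) w" by (auto simp: inc_def)

lemma inc_ext: "inc t w \<Longrightarrow> ext s t \<Longrightarrow> inc s w" by (auto simp: ext_def inc_def)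

lemma inc_ex: "\<exists>w. inc s w" by (intro exI[of _ "{i. sel s i \<noteq> 0}"]) (auto simp: inc_def)

section \<open>Category in Cantor space in terms of conditions\<close>

lemma openin_inc: "openin cantor_top {w. inc s w}"
  unfolding openin_cantor_top cantor_open_def
proof
  fix x assume "x \<in> {w. inc s w}"
  then have "{z. z \<inter> {..<lenc s} = x \<inter> {..<lenc s}} \<subseteq> {w. inc s w}" unfolding inc_def by (auto simp: set_eq_iff)
  then show "\<exists>n. {z. z \<inter> {..<n} = x \<inter> {..<n}} \<subseteq> {w. inc s w}" by blast
qed

lemma nowhere_denseI:
  assumes "\<And>s. \<exists>t. ext s t \<and> (\<forall>w. inc t w \<longrightarrow> w \<notin> X)"
  shows "nowhere_dense X"
proof -
  have False if U: "openin cantor_top U" "U \<subseteq> cantor_top closure_of X" "x \<in> U" for U x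
  proof -
    obtain n where n: "{z. z \<inter> {..<n} = x \<inter> {..<n}} \<subseteq> U"
      using U(1,3) unfolding openin_cantor_top cantor_open_def by blast
    obtain t where t: "ext (res x n) t" "\<forall>w. inc t w \<longrightarrow> w \<notin> X" using assms by blast
    obtain w where w: "inc t w" using inc_ex by blast
    then have "inc (res x n) w" using inc_ext t(1) by blast
    then have "w \<in> U" using n by (auto simp: inc_def split: if_splits)
    then have "w \<in> cantor_top closure_of X" using U(2) by blast
    then show False using t(2) w openin_inc[of t] unfolding in_closure_of by blast
  qed
  then show ?thesis unfolding nowhere_dense_def interior_of_def by blast
qed

lemma nowhere_dense_meager: "nowhere_dense X \<Longrightarrow> meager X"
  unfolding meager_def by (intro exI[of _ "\<lambda>_. X"]) auto

lemma meager_subset: "meager Y \<Longrightarrow> X \<subseteq> Y \<Longrightarrow> meager X"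
  unfolding meager_def by (meson order_trans)

lemma meager_UN: assumes "\<And>n::nat. meager (X n)" shows "meager (\<Union>n. X n)"
proof -
  have "\<forall>n. \<exists>F. (\<forall>m::nat. nowhere_dense (F m)) \<and> X n \<subseteq> (\<Union>m. F m)"
    using assms unfolding meager_def by blast
  from choice[OF this] obtain F :: "nat \<Rightarrow> nat \<Rightarrow> nat set set" where
    F: "\<And>n m. nowhere_dense (F n m)" "\<And>n. X n \<subseteq> (\<Union>m. F n m)" by blast
  show ?thesis unfolding meager_def
  proof (intro exI[of _ "\<lambda>k. F (fst (prod_decode k)) (snd (prod_decode k))"] conjI allI subsetI)
    fix x assume "x \<in> (\<Union>n. X n)"
    then obtain n m where "x \<in> F n m" using F(2) by blast
    then show "x \<in> (\<Union>k. F (fst (prod_decode k)) (snd (prod_decode k)))"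
      by (intro UN_I[of "prod_encode (n, m)"]) auto
  qed (use F(1) in auto)
qed

lemma meager_countable_UN:
  assumes "countable A" "\<And>a. a \<in> A \<Longrightarrow> meager (X a)" shows "meager (\<Union>a\<in>A. X a)"
proof (cases "A = {}")
  case True
  have "meager {}" by (rule nowhere_dense_meager, rule nowhere_denseI) (auto intro: ext_refl)
  then show ?thesis using True by simp
next
  case False
  then have "(\<Union>a\<in>A. X a) = (\<Union>n. X (from_nat_into A n))"
    using range_from_nat_into[OF False assms(1)] by (metis image_image)
  moreover have "meager (\<Union>n. X (from_nat_into A n))"
    by (rule meager_UN) (use assms(2) from_nat_into[OF False] in blast)
  ultimately show ?thesis by simp
qed

lemma meager_Un: assumes "meager X" "meager Y" shows "meager (X \<union> Y)"
proof -
  have "meager (\<Union>a\<in>{X, Y}. a)" by (rule meager_countable_UN) (use assms in auto)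
  then show ?thesis by simp
qed

instance instr :: countable by countable_datatype

text \<open>A program decides at most one set and there are only countably many programs, so
  countably many meager sets are united.\<close>

lemma meager_non_random: "meager {w. \<not> itrm_c_random w}"
proof -
  define D where "D = {X. meager X \<and> itrm_decidable X}"
  have "\<forall>X\<in>D. \<exists>p. \<forall>w. (w \<in> X \<longrightarrow> itrm_comp0 p w 1) \<and> (w \<notin> X \<longrightarrow> itrm_comp0 p w 0)"
    unfolding D_def itrm_decidable_def by blast
  from bchoice[OF this] obtain P where
    P: "\<And>X w. X \<in> D \<Longrightarrow> (w \<in> X \<longrightarrow> itrm_comp0 (P X) w 1) \<and> (w \<notin> X \<longrightarrow> itrm_comp0 (P X) w 0)"
    by blast
  have uniq: "i = j" if ij: "itrm_comp0 p w i" "itrm_comp0 p w j" for p w i j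
  proof -
    obtain V d where d: "trun (vstep p w) (vec (init_config 0)) V d" "length p \<le> d 0" "d (Suc 0) = i"
      using ij(1) unfolding itrm_comp0_def halts_with_iff by blast
    obtain W e where e: "trun (vstep p w) (vec (init_config 0)) W e" "length p \<le> e 0" "e (Suc 0) = j"
      using ij(2) unfolding itrm_comp0_def halts_with_iff by blast
    show ?thesis using trun_unique[OF d(1) e(1)] vstep_halt d e by auto
  qed
  have "inj_on P D"
  proof
    fix X Y assume XY: "X \<in> D" "Y \<in> D" "P X = P Y"
    show "X = Y"
    proof (rule set_eqI)
      fix w
      show "w \<in> X \<longleftrightarrow> w \<in> Y" using P[OF XY(1), of w] P[OF XY(2), of w] uniq[of "P X" w 1 0] XY(3) by auto
    qed
  qed
  moreover have "countable (P ` D)" by blast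
  ultimately have "countable D" using countable_image_inj_on by blast
  then have "meager (\<Union>X\<in>D. X)" by (rule meager_countable_UN) (simp add: D_def)
  then show ?thesis by (rule meager_subset) (auto simp: itrm_c_random_def D_def)
qed

lemma random_avoid: "itrm_c_random w \<Longrightarrow> cp A \<Longrightarrow> meager {w. A w e} \<Longrightarrow> \<not> A w e"
  unfolding itrm_c_random_def using cp_decidable[of A e] by blast

lemma nowhere_dense_avoid:
  assumes mono: "\<And>s t. ext s t \<Longrightarrow> D s \<Longrightarrow> D t"
    and dense: "\<And>t. ext s t \<Longrightarrow> \<exists>u. ext t u \<and> D u"
  shows "nowhere_dense {w. inc s w \<and> (\<forall>k. lenc s \<le> k \<longrightarrow> \<not> D (res w k))}"
proof (rule nowhere_denseI)
  fix t
  show "\<exists>u. ext t u \<and> (\<forall>w. inc u w \<longrightarrow> w \<notin> {w. inc s w \<and> (\<forall>k. lenc s \<le> k \<longrightarrow> \<not> D (res w k))})"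
  proof (cases "\<exists>w. inc t w \<and> inc s w")
    case True
    then obtain w where w: "inc t w" "inc s w" by blast
    define v where "v = res w (max (lenc s) (lenc t))"
    have v: "ext s v" "ext t v" using w inc_ext_res unfolding v_def by auto
    then obtain u where u: "ext v u" "D u" using dense by blast
    have "w' \<notin> {w. inc s w \<and> (\<forall>k. lenc s \<le> k \<longrightarrow> \<not> D (res w k))}" if "inc u w'" for w'
    proof -
      have "ext u (res w' (lenc u))" using inc_ext_res that by simp
      then have "D (res w' (lenc u))" using mono u(2) by blast
      moreover have "lenc s \<le> lenc u" using v(1) u(1) unfolding ext_def by simp
      ultimately show ?thesis by blast
    qed
    then show ?thesis using v u ext_trans by blast
  qed (use ext_refl in blast)
qed

text \<open>Genericity: the reals in the cone of \<open>s\<close> that miss a set \<open>D\<close>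
  dense below \<open>s\<close> form a nowhere dense set. It is decidable because \<open>D\<close>
  is, so a random real is not among them.\<close>

lemma random_dense:
  assumes w: "itrm_c_random w" "inc s w"
    and D: "cp (\<lambda>w e. D (\<lambda>i. e (Suc i)) (e 0))"
    and mono: "\<And>s t. ext s t \<Longrightarrow> D e s \<Longrightarrow> D e t"
    and dense: "\<And>t. ext s t \<Longrightarrow> \<exists>u. ext t u \<and> D e u"
  shows "\<exists>k\<ge>lenc s. D e (res w k)"
proof -
  have "cp (\<lambda>w e. D (t w e) (a w e))" if "\<And>i. cf (\<lambda>w e. t w e i)" "cf a" for t a
    using cf_subst[OF D[unfolded cp_def], of "\<lambda>i w e. case_nat (a w e) (t w e) i"] that unfolding cp_def
    by (simp add: cf_case_nat)
  then have 1: "cp (\<lambda>w e. D (\<lambda>i. e (Suc (Suc i))) (res w (e 0)))" by this (intro cfi)+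
  have "cp (\<lambda>w e. inc (e 0) w \<and> (\<forall>k. lenc (e 0) \<le> k \<longrightarrow> \<not> D (\<lambda>i. e (Suc i)) (res w k)))"
    by (intro cfi 1)
  from random_avoid[OF w(1) this, of "case_nat s e"]
  show ?thesis using nowhere_dense_meager[OF nowhere_dense_avoid[of "D e" s]] mono dense w(2) by auto
qed

subsection \<open>Forced predicates\<close>

lemma cp_app_env:
  assumes "cp (\<lambda>w e. J (\<lambda>i. e (Suc i)) (e 0))" "\<And>i. cf (\<lambda>w e. t w e i)" "cf a"
  shows "cp (\<lambda>w e. J (t w e) (a w e))"
  using cf_subst[OF assms(1)[unfolded cp_def], of "\<lambda>i w e. case_nat (a w e) (t w e) i"] assms(2,3) unfolding cp_def
  by (simp add: cf_case_nat)

text \<open>\<open>J e s\<close> says that the condition \<open>s\<close> forces \<open>A\<close> with parameters \<open>e\<close>; for random reals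
  forcing and truth agree.\<close>

definition fname :: "((nat \<Rightarrow> nat) \<Rightarrow> nat \<Rightarrow> bool) \<Rightarrow> (nat set \<Rightarrow> (nat \<Rightarrow> nat) \<Rightarrow> bool) \<Rightarrow> bool" where
  "fname J A \<longleftrightarrow> cp (\<lambda>w e. J (\<lambda>i. e (Suc i)) (e 0)) \<and> (\<forall>s t e. ext s t \<longrightarrow> J e s \<longrightarrow> J e t) \<and>
     (\<forall>w e. itrm_c_random w \<longrightarrow> A w e = (\<exists>k. J e (res w k)))"

definition fp :: "(nat set \<Rightarrow> (nat \<Rightarrow> nat) \<Rightarrow> bool) \<Rightarrow> bool" where
  "fp A \<longleftrightarrow> cp A \<and> (\<exists>J. fname J A)"

lemma fnameI:
  assumes "\<And>w e. itrm_c_random w \<Longrightarrow> A w e \<longleftrightarrow> (\<exists>k. J e (res w k))"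
    "cp (\<lambda>w e. J (\<lambda>i. e (Suc i)) (e 0))" "\<And>s t e. ext s t \<Longrightarrow> J e s \<Longrightarrow> J e t"
  shows "fname J A"
  unfolding fname_def using assms by blast

lemma fpI: "cp A \<Longrightarrow> fname J A \<Longrightarrow> fp A" unfolding fp_def by blast

lemma fp_cp: "fp A \<Longrightarrow> cp A" unfolding fp_def by blast

lemma fp_name: assumes "fp A"
  obtains J where "\<And>t a. (\<And>i. cf (\<lambda>w e. t w e i)) \<Longrightarrow> cf a \<Longrightarrow> cp (\<lambda>w e. J (t w e) (a w e))"
    "\<And>s t e. ext s t \<Longrightarrow> J e s \<Longrightarrow> J e t" "\<And>w e. itrm_c_random w \<Longrightarrow> A w e \<longleftrightarrow> (\<exists>k. J e (res w k))"
proof -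
  obtain J where J: "fname J A" using assms unfolding fp_def by blast
  show ?thesis
  proof (rule that[of J])
    show "cp (\<lambda>w e. J (t w e) (a w e))" if "\<And>i. cf (\<lambda>w e. t w e i)" "cf a" for t a
      using J that cp_app_env[of J t a] unfolding fname_def by blast
  qed (use J in \<open>auto simp: fname_def\<close>)
qed

lemma fp_cong: "fp A \<Longrightarrow> (\<And>w e. A w e = B w e) \<Longrightarrow> fp B"
proof -
  assume "fp A" "\<And>w e. A w e = B w e"
  moreover from this(2) have "A = B" by (intro ext)
  ultimately show "fp B" by simp
qed

named_theorems fpi

lemma fp_const [fpi]: assumes "cp (\<lambda>w e. A e)" shows "fp (\<lambda>w e. A e)"
proof (rule fpI[OF assms, of "\<lambda>e s. A e"])
  have "cp (\<lambda>w e. A (\<lambda>i. e (Suc i)))" by (rule cp_env[OF assms]) (intro cfi)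
  then show "fname (\<lambda>e s. A e) (\<lambda>w. A)" unfolding fname_def by auto
qed

text \<open>A condition forces the negation when no extension forces \<open>A\<close>. The
  conditions that decide \<open>A\<close> one way or the other are dense, so a random real meets one
  of them.\<close>

lemma fp_not [fpi]: assumes "fp A" shows "fp (\<lambda>w e. \<not> A w e)"
proof -
  obtain J where J: "\<And>t a. (\<And>i. cf (\<lambda>w e. t w e i)) \<Longrightarrow> cf a \<Longrightarrow> cp (\<lambda>w e. J (t w e) (a w e))"
    "\<And>s t e. ext s t \<Longrightarrow> J e s \<Longrightarrow> J e t" "\<And>w e. itrm_c_random w \<Longrightarrow> A w e \<longleftrightarrow> (\<exists>k. J e (res w k))"
    using fp_name[OF assms] by blast
  let ?N = "\<lambda>e s. \<forall>t. ext s t \<longrightarrow> \<not> J e t"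
  have "\<not> A w e \<longleftrightarrow> (\<exists>k. ?N e (res w k))" if w: "itrm_c_random w" for w e
  proof
    assume n: "\<not> A w e"
    have "\<exists>k\<ge>lenc 0. (J e (res w k) \<or> ?N e (res w k))"
    proof (rule random_dense[OF w, of 0 "\<lambda>e s. J e s \<or> ?N e s"])
      show "inc 0 w" by (simp add: inc_def lenc_def)
      show "cp (\<lambda>w e. J (\<lambda>i. e (Suc i)) (e 0) \<or> (\<forall>t. ext (e 0) t \<longrightarrow> \<not> J (\<lambda>i. e (Suc i)) t))"
        by (intro cfi J(1))
      show "J e t \<or> ?N e t" if "ext s t" "J e s \<or> ?N e s" for s t
        using that J(2) ext_trans by blast
      show "\<exists>u. ext t u \<and> (J e u \<or> ?N e u)" for t using ext_refl by blast
    qed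
    then show "\<exists>k. ?N e (res w k)" using n J(3)[OF w] by blast
  next
    assume "\<exists>k. ?N e (res w k)"
    then obtain k where k: "?N e (res w k)" by blast
    show "\<not> A w e"
    proof
      assume "A w e"
      then obtain j where "J e (res w j)" using J(3)[OF w] by blast
      then have "J e (res w (max j k))" using J(2) ext_res by (metis max.cobounded1)
      then show False using k ext_res by (metis max.cobounded2)
    qed
  qed
  moreover have "cp (\<lambda>w e. ?N (\<lambda>i. e (Suc i)) (e 0))" by (intro cfi J(1))
  moreover have "?N e t" if "ext s t" "?N e s" for s t e using that ext_trans by blast
  ultimately have "fname ?N (\<lambda>w e. \<not> A w e)" by (intro fnameI)
  then show ?thesis by (rule fpI[OF cp_not[OF fp_cp[OF assms]]])
qed

lemma fp_conj [fpi]: assumes "fp A" "fp B" shows "fp (\<lambda>w e. A w e \<and> B w e)"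
proof -
  obtain J where J: "\<And>t a. (\<And>i. cf (\<lambda>w e. t w e i)) \<Longrightarrow> cf a \<Longrightarrow> cp (\<lambda>w e. J (t w e) (a w e))"
    "\<And>s t e. ext s t \<Longrightarrow> J e s \<Longrightarrow> J e t" "\<And>w e. itrm_c_random w \<Longrightarrow> A w e \<longleftrightarrow> (\<exists>k. J e (res w k))"
    using fp_name[OF assms(1)] by blast
  obtain K where K: "\<And>t a. (\<And>i. cf (\<lambda>w e. t w e i)) \<Longrightarrow> cf a \<Longrightarrow> cp (\<lambda>w e. K (t w e) (a w e))"
    "\<And>s t e. ext s t \<Longrightarrow> K e s \<Longrightarrow> K e t" "\<And>w e. itrm_c_random w \<Longrightarrow> B w e \<longleftrightarrow> (\<exists>k. K e (res w k))"
    using fp_name[OF assms(2)] by blast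
  have "(\<exists>k. J e (res w k)) \<and> (\<exists>k. K e (res w k)) \<longleftrightarrow> (\<exists>k. J e (res w k) \<and> K e (res w k))" for w e
  proof
    assume "(\<exists>k. J e (res w k)) \<and> (\<exists>k. K e (res w k))"
    then obtain j k where "J e (res w j)" "K e (res w k)" by blast
    then have "J e (res w (max j k))" "K e (res w (max j k))"
      using J(2)[of "res w j" "res w (max j k)"] K(2)[of "res w k" "res w (max j k)"] by simp_all
    then show "\<exists>k. J e (res w k) \<and> K e (res w k)" by blast
  qed blast
  moreover have "cp (\<lambda>w e. J (\<lambda>i. e (Suc i)) (e 0) \<and> K (\<lambda>i. e (Suc i)) (e 0))" by (intro cfi J(1) K(1))
  ultimately have "fname (\<lambda>e s. J e s \<and> K e s) (\<lambda>w e. A w e \<and> B w e)"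
    unfolding fname_def using J(2,3) K(2,3) by blast
  then show ?thesis by (rule fpI[OF cp_conj[OF fp_cp[OF assms(1)] fp_cp[OF assms(2)]]])
qed

lemma fp_disj [fpi]: assumes "fp A" "fp B" shows "fp (\<lambda>w e. A w e \<or> B w e)"
  by (rule fp_cong[OF fp_not[OF fp_conj[OF fp_not[OF assms(1)] fp_not[OF assms(2)]]]]) auto

lemma fp_imp [fpi]: assumes "fp A" "fp B" shows "fp (\<lambda>w e. A w e \<longrightarrow> B w e)"
  by (rule fp_cong[OF fp_disj[OF fp_not[OF assms(1)] assms(2)]]) auto

lemma fp_if [fpi]:
  assumes "fp A" "fp B" "fp C" shows "fp (\<lambda>w e. if A w e then B w e else C w e)"
  by (rule fp_cong[OF fp_conj[OF fp_imp[OF assms(1,2)] fp_imp[OF fp_not[OF assms(1)] assms(3)]]]) auto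

lemma fp_iff [fpi]: assumes "fp A" "fp B" shows "fp (\<lambda>w e. A w e = B w e)"
  by (rule fp_cong[OF fp_conj[OF fp_imp[OF assms] fp_imp[OF assms(2,1)]]]) auto

text \<open>This is strong forcing: the condition has to settle one definite witness.\<close>

lemma fp_ex [fpi]: assumes "fp (\<lambda>w e. A w (\<lambda>i. e (Suc i)) (e 0))" shows "fp (\<lambda>w e. \<exists>n. A w e n)"
proof -
  obtain J where J: "\<And>t a. (\<And>i. cf (\<lambda>w e. t w e i)) \<Longrightarrow> cf a \<Longrightarrow> cp (\<lambda>w e. J (t w e) (a w e))"
    "\<And>s t e. ext s t \<Longrightarrow> J e s \<Longrightarrow> J e t"
    "\<And>w e. itrm_c_random w \<Longrightarrow> A w (\<lambda>i. e (Suc i)) (e 0) \<longleftrightarrow> (\<exists>k. J e (res w k))"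
    using fp_name[OF assms] by blast
  have "cp (\<lambda>w e. \<exists>n. J (case_nat n (\<lambda>i. e (Suc i))) (e 0))" by (intro cfi J(1))
  moreover have "A w e n \<longleftrightarrow> (\<exists>k. J (case_nat n e) (res w k))" if "itrm_c_random w" for w e n
    using J(3)[OF that, of "case_nat n e"] by simp
  ultimately have "fname (\<lambda>e s. \<exists>n. J (case_nat n e) s) (\<lambda>w e. \<exists>n. A w e n)"
    unfolding fname_def using J(2) by blast
  then show ?thesis by (rule fpI[OF cp_ex[OF fp_cp[OF assms]]])
qed

lemma fp_all [fpi]: assumes "fp (\<lambda>w e. A w (\<lambda>i. e (Suc i)) (e 0))" shows "fp (\<lambda>w e. \<forall>n. A w e n)"
  by (rule fp_cong[OF fp_not[OF fp_ex[OF fp_not[OF assms]]]]) auto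

lemma fp_subst: assumes "fp A" "\<And>i. cf (\<lambda>w e. t e i)" shows "fp (\<lambda>w e. A w (t e))"
proof -
  obtain J where J: "\<And>t a. (\<And>i. cf (\<lambda>w e. t w e i)) \<Longrightarrow> cf a \<Longrightarrow> cp (\<lambda>w e. J (t w e) (a w e))"
    "\<And>s t e. ext s t \<Longrightarrow> J e s \<Longrightarrow> J e t" "\<And>w e. itrm_c_random w \<Longrightarrow> A w e \<longleftrightarrow> (\<exists>k. J e (res w k))"
    using fp_name[OF assms(1)] by blast
  have "cf (\<lambda>w e. t (\<lambda>i. e (Suc i)) i)" for i by (rule cf_shift[OF assms(2)])
  then have "cp (\<lambda>w e. J (t (\<lambda>i. e (Suc i))) (e 0))" by (intro J(1) cf_var)
  then have "fname (\<lambda>e s. J (t e) s) (\<lambda>w e. A w (t e))" unfolding fname_def using J(2,3) by blast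
  then show ?thesis by (rule fpI[OF cp_env[OF fp_cp[OF assms(1)] assms(2)]])
qed

lemma fp_app: "fp (\<lambda>w e. A w (\<lambda>i. e (Suc i)) (e 0)) \<Longrightarrow> cf (\<lambda>w e. a e) \<Longrightarrow> fp (\<lambda>w e. A w e (a e))"
  by (rule fp_cong[OF fp_subst[of _ "\<lambda>e. case_nat (a e) e"]]) (auto intro!: cfi)

lemma fp_rel1: "fp (\<lambda>w e. A w (e 0)) \<Longrightarrow> cf (\<lambda>w e. x e) \<Longrightarrow> fp (\<lambda>w e. A w (x e))"
  by (rule fp_app[of "\<lambda>w e. A w"])

lemma fp_rel2: "fp (\<lambda>w e. A w (e 0) (e (Suc 0))) \<Longrightarrow> cf (\<lambda>w e. x e) \<Longrightarrow> cf (\<lambda>w e. y e) \<Longrightarrow>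
    fp (\<lambda>w e. A w (x e) (y e))"
  by (rule fp_cong[OF fp_subst[of _ "\<lambda>e. case_nat (x e) (case_nat (y e) e)"]]) (auto intro!: cfi)

lemma fp_mem [fpi]: assumes "cf (\<lambda>w e. a e)" shows "fp (\<lambda>w e. a e \<in> w)"
proof -
  let ?J = "\<lambda>e s. a e < lenc s \<and> sel s (a e) \<noteq> 0"
  have "cf (\<lambda>w e. a (\<lambda>i. e (Suc i)))" by (rule cf_shift[OF assms])
  then have "cp (\<lambda>w e. ?J (\<lambda>i. e (Suc i)) (e 0))" by (intro cfi)
  moreover have "a e \<in> w \<longleftrightarrow> (\<exists>k. ?J e (res w k))" for w e
    by (auto intro!: exI[of _ "Suc (a e)"] split: if_splits)
  moreover have "?J e s \<Longrightarrow> ext s t \<Longrightarrow> ?J e t" for e s t by (auto simp: ext_def)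
  ultimately have "fname ?J (\<lambda>w e. a e \<in> w)" unfolding fname_def by blast
  then show ?thesis by (rule fpI[OF cp_oracle[OF assms]])
qed

subsection \<open>Forcing inductive definitions\<close>

text \<open>Rules for forcing \<open>ind M c\<close>. The statement \<open>s'\<close> is a pair of a
  condition and \<open>c\<close>; the challenge \<open>a'\<close> pairs a challenge \<open>a\<close>
  of \<open>M\<close> with an extension \<open>t\<close>. It is answered by a further extension
  \<open>u\<close> that forces a justification \<open>b\<close>, the premises then being claimed at
  \<open>u\<close>. Challenges whose \<open>t\<close> is no extension are dismissed by 0, the code
  of the empty list.\<close>

definition find_rules :: "(nat \<Rightarrow> nat \<Rightarrow> nat \<Rightarrow> nat \<Rightarrow> bool) \<Rightarrow> nat \<Rightarrow> nat \<Rightarrow> nat \<Rightarrow> bool" where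
  "find_rules FM s' a' b' \<longleftrightarrow>
     (if ext (fst (prod_decode s')) (snd (prod_decode a'))
      then \<exists>u b. ext (snd (prod_decode a')) u \<and> FM (snd (prod_decode s')) (fst (prod_decode a')) b u \<and>
        b' = list_encode (map (\<lambda>i. prod_encode (u, sel b i)) [0..<lenc b])
      else b' = 0)"

lemma ind_find_rules:
  "ind (find_rules FM) (prod_encode (s, c)) \<longleftrightarrow>
    (\<forall>a t. ext s t \<longrightarrow> (\<exists>u b. ext t u \<and> FM c a b u \<and> (\<forall>d\<in>set (list_decode b). ind (find_rules FM) (prod_encode (u, d)))))"
  (is "?L \<longleftrightarrow> ?R")
proof -
  have set: "set (map (\<lambda>i. prod_encode (u, sel b i)) [0..<lenc b]) = (\<lambda>d. prod_encode (u, d)) ` set (list_decode b)" for u b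
    unfolding list_decode_alt[of b] by auto
  show ?thesis
  proof
    assume L: ?L
    show ?R
    proof (intro allI impI)
      fix a t assume st: "ext s t"
      obtain b' where b': "find_rules FM (prod_encode (s, c)) (prod_encode (a, t)) b'" "\<forall>x\<in>set (list_decode b'). ind (find_rules FM) x"
        using indD[OF L] by blast
      then obtain u b where u: "ext t u" "FM c a b u" "b' = list_encode (map (\<lambda>i. prod_encode (u, sel b i)) [0..<lenc b])"
        using st unfolding find_rules_def by auto
      have "\<forall>d\<in>set (list_decode b). ind (find_rules FM) (prod_encode (u, d))"
        using b'(2) set[of u b] unfolding u(3) list_encode_inverse by blast
      then show "\<exists>u b. ext t u \<and> FM c a b u \<and> (\<forall>d\<in>set (list_decode b). ind (find_rules FM) (prod_encode (u, d)))"
        using u by blast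
    qed
  next
    assume R: ?R
    show ?L
    proof (rule indI)
      fix a'
      define a t where "a = fst (prod_decode a')" and "t = snd (prod_decode a')"
      show "\<exists>b'. find_rules FM (prod_encode (s, c)) a' b' \<and> (\<forall>x\<in>set (list_decode b'). ind (find_rules FM) x)"
      proof (cases "ext s t")
        case True
        then obtain u b where "ext t u" "FM c a b u" "\<forall>d\<in>set (list_decode b). ind (find_rules FM) (prod_encode (u, d))"
          using R by blast
        then show ?thesis using True
          by (intro exI[of _ "list_encode (map (\<lambda>i. prod_encode (u, sel b i)) [0..<lenc b])"])
             (auto simp: find_rules_def set a_def t_def simp del: set_map)
      next
        case False
        then show ?thesis by (intro exI[of _ 0]) (simp add: find_rules_def t_def)
      qed
    qed
  qed
qed

text \<open>Soundness is proved first up to a meager set only: the dense sets \<open>D a\<close>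
  speak of meagerness and come with no decision procedure, so a given random real cannot be shown to
  meet them. In \<open>fp_ind\<close> the exceptional set itself is decidable and hence avoided by
  every random real.\<close>

lemma ind_find_rules_meager:
  assumes "ind (find_rules FM) s'"
    and mono: "\<And>c a b s t. ext s t \<Longrightarrow> FM c a b s \<Longrightarrow> FM c a b t"
    and truth: "\<And>w c a b. itrm_c_random w \<Longrightarrow> M w c a b \<longleftrightarrow> (\<exists>k. FM c a b (res w k))"
  shows "meager {w. inc (fst (prod_decode s')) w \<and> \<not> ind (M w) (snd (prod_decode s'))}"
  using assms(1)
proof (induction rule: ind.induct)
  case (indI s')
  define s c where "s = fst (prod_decode s')" and "c = snd (prod_decode s')"
  define N where "N u d = {w. inc u w \<and> \<not> ind (M w) d}" for u d
  define D where "D a u \<longleftrightarrow> (\<exists>b. FM c a b u \<and> (\<forall>d\<in>set (list_decode b). meager (N u d)))" for a u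
  have Nmono: "meager (N t d)" if "ext s t" "meager (N s d)" for s t d
    by (rule meager_subset[OF that(2)]) (use that(1) inc_ext in \<open>auto simp: N_def\<close>)
  have Dmono: "D a t" if "ext s t" "D a s" for a s t using that mono Nmono unfolding D_def by blast
  have Ddense: "\<exists>u. ext t u \<and> D a u" if st: "ext s t" for a t
  proof -
    obtain b' where b': "find_rules FM s' (prod_encode (a, t)) b'"
      "\<And>x. x \<in> set (list_decode b') \<Longrightarrow> meager {w. inc (fst (prod_decode x)) w \<and> \<not> ind (M w) (snd (prod_decode x))}"
      using indI by blast
    then obtain u b where u: "ext t u" "FM c a b u" "b' = list_encode (map (\<lambda>i. prod_encode (u, sel b i)) [0..<lenc b])"
      using st unfolding find_rules_def s_def c_def by auto
    have "meager (N u d)" if d: "d \<in> set (list_decode b)" for d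
    proof -
      have "prod_encode (u, d) \<in> set (list_decode b')" using d u(3) unfolding list_decode_alt[of b] by auto
      from b'(2)[OF this] show ?thesis by (simp add: N_def)
    qed
    then show ?thesis using u unfolding D_def by blast
  qed
  \<comment> \<open>Pairs of numbers are countable in number, so all meager sets
    \<open>N u d\<close> can be discarded at once; this covers every premise at every initial
    segment.\<close>
  let ?B = "{w. \<not> itrm_c_random w} \<union> (\<Union>a. {w. inc s w \<and> (\<forall>k. lenc s \<le> k \<longrightarrow> \<not> D a (res w k))}) \<union>
    (\<Union>(u, d)\<in>{(u, d). meager (N u d)}. N u d)"
  have "meager (\<Union>a. {w. inc s w \<and> (\<forall>k. lenc s \<le> k \<longrightarrow> \<not> D a (res w k))})"
    by (intro meager_UN nowhere_dense_meager nowhere_dense_avoid) (use Dmono Ddense in blast)+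
  moreover have "meager (\<Union>(u, d)\<in>{(u, d). meager (N u d)}. N u d)"
    by (rule meager_countable_UN) auto
  ultimately have "meager ?B" using meager_non_random meager_Un by blast
  moreover have "{w. inc s w \<and> \<not> ind (M w) c} \<subseteq> ?B"
  proof (rule subsetI, rule ccontr)
    fix w assume w: "w \<in> {w. inc s w \<and> \<not> ind (M w) c}" "w \<notin> ?B"
    then have r: "itrm_c_random w" by blast
    have "\<exists>b. M w c a b \<and> (\<forall>d\<in>set (list_decode b). ind (M w) d)" for a
    proof -
      obtain k where "D a (res w k)" using w by blast
      then obtain b where b: "FM c a b (res w k)" "\<forall>d\<in>set (list_decode b). meager (N (res w k) d)"
        unfolding D_def by blast
      then have "\<forall>d\<in>set (list_decode b). w \<notin> N (res w k) d" using w(2) by blast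
      then show ?thesis using b(1) truth[OF r] unfolding N_def by auto
    qed
    then have "ind (M w) c" by (rule ind.indI)
    then show False using w(1) by blast
  qed
  ultimately show ?case unfolding s_def c_def by (rule meager_subset)
qed

lemma cp_subst_tail2:
  assumes "cp (\<lambda>w e. M w (\<lambda>i. e (Suc (Suc (Suc i)))) (e (Suc (Suc 0))) (e (Suc 0)) (e 0))"
  shows "cp (\<lambda>w e. M w (\<lambda>i. e (Suc (Suc (Suc (Suc (Suc i)))))) (e (Suc (Suc 0))) (e (Suc 0)) (e 0))"
  by (rule cp_env3[OF assms]) (intro cfi)+

theorem fp_ind:
  assumes M: "fp (\<lambda>w e. M w (\<lambda>i. e (Suc (Suc (Suc i)))) (e (Suc (Suc 0))) (e (Suc 0)) (e 0))"
    and s: "cf (\<lambda>w e. s e)"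
  shows "fp (\<lambda>w e. ind (M w e) (s e))"
proof -
  obtain J0 where J0: "\<And>t a. (\<And>i. cf (\<lambda>w e. t w e i)) \<Longrightarrow> cf a \<Longrightarrow> cp (\<lambda>w e. J0 (t w e) (a w e))"
    "\<And>s t e. ext s t \<Longrightarrow> J0 e s \<Longrightarrow> J0 e t"
    "\<And>w e. itrm_c_random w \<Longrightarrow> M w (\<lambda>i. e (Suc (Suc (Suc i)))) (e (Suc (Suc 0))) (e (Suc 0)) (e 0) \<longleftrightarrow> (\<exists>k. J0 e (res w k))"
    using fp_name[OF M] by blast
  define FM where "FM e c a b u = J0 (case_nat b (case_nat a (case_nat c e))) u" for e c a b u
  have FMc: "cp (\<lambda>w e. FM (t w e) (x w e) (y w e) (z w e) (u w e))"
    if "\<And>i. cf (\<lambda>w e. t w e i)" "cf x" "cf y" "cf z" "cf u" for t x y z u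
    unfolding FM_def by (intro cfi J0(1) that)
  have FMm: "FM e c a b t" if "ext s t" "FM e c a b s" for e c a b s t
    using that J0(2) unfolding FM_def by blast
  have FMt: "M w e c a b \<longleftrightarrow> (\<exists>k. FM e c a b (res w k))" if "itrm_c_random w" for w e c a b
    using J0(3)[OF that, of "case_nat b (case_nat a (case_nat c e))"] unfolding FM_def by simp
  define J where "J e c u = ind (find_rules (FM e)) (prod_encode (u, c))" for e c u
  have J_unfold: "J e c u \<longleftrightarrow> (\<forall>a t. ext u t \<longrightarrow> (\<exists>v b. ext t v \<and> FM e c a b v \<and> (\<forall>d\<in>set (list_decode b). J e d v)))" for e c u
    unfolding J_def by (rule ind_find_rules)
  have J_mono: "J e c t" if "ext u t" "J e c u" for e c u t
    using that(2) ext_trans[OF that(1)] unfolding J_unfold[of e c u] J_unfold[of e c t] by blast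
  have Jc0: "cp (\<lambda>w e. J (\<lambda>i. e (Suc (Suc i))) (e (Suc 0)) (e 0))"
    unfolding J_def
    by (rule cp_ind[where M = "\<lambda>w e. find_rules (FM (\<lambda>i. e (Suc (Suc i))))" and s = "\<lambda>w e. prod_encode (e 0, e (Suc 0))"];
        (unfold find_rules_def)?) (intro cfi FMc)+
  have Jc: "cp (\<lambda>w e. J (t w e) (x w e) (u w e))" if "\<And>i. cf (\<lambda>w e. t w e i)" "cf x" "cf u" for t x u
    using cf_subst[OF Jc0[unfolded cp_def], of "\<lambda>i w e. case_nat (u w e) (case_nat (x w e) (t w e)) i"] that
    unfolding cp_def by (simp add: cf_case_nat)
  have sound: "ind (M w e) c" if w: "itrm_c_random w" "J e c (res w k)" for w e c k
  proof -
    have "meager {v. inc (fst (prod_decode (prod_encode (res w k, c)))) v \<and> \<not> ind (M v e) (snd (prod_decode (prod_encode (res w k, c))))}"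
      by (rule ind_find_rules_meager[where FM = "FM e" and M = "\<lambda>w. M w e"])
         (use w(2) FMm FMt in \<open>simp_all add: J_def\<close>)
    then have "meager {v. inc (res w k) v \<and> \<not> ind (M v e) c}" by (simp only: prod_encode_inverse fst_conv snd_conv)
    moreover have "cp (\<lambda>v e. inc (e 0) v \<and> \<not> ind (M v (\<lambda>i. e (Suc (Suc i)))) (e (Suc 0)))"
      by (intro cfi cp_ind cp_subst_tail2[OF fp_cp[OF M]])
    ultimately have "\<not> (inc (res w k) w \<and> \<not> ind (M w e) c)"
      using random_avoid[OF w(1), of "\<lambda>v e. inc (e 0) v \<and> \<not> ind (M v (\<lambda>i. e (Suc (Suc i)))) (e (Suc 0))" "case_nat (res w k) (case_nat c e)"]
      by simp
    then show ?thesis by simp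
  qed
  \<comment> \<open>Here the induction follows the given random real. If no initial segment forces
    \<open>c\<close>, then some segment has no extension forcing it, and below that segment the
    conditions with an unanswerable challenge \<open>a\<close> are dense. The real meets one of
    them, but the true justification against \<open>a\<close>, with its finitely many premises, is
    forced by a long initial segment.\<close>
  have complete: "\<exists>k. J e c (res w k)" if "ind (M w e) c" and w: "itrm_c_random w" for w e c
    using that(1)
  proof (induction rule: ind.induct)
    case (indI c)
    show ?case
    proof (rule ccontr)
      assume n: "\<nexists>k. J e c (res w k)"
      let ?D = "\<lambda>e u. J (\<lambda>i. e (Suc i)) (e 0) u \<or> (\<forall>t. ext u t \<longrightarrow> \<not> J (\<lambda>i. e (Suc i)) (e 0) t)"
      have "\<exists>k\<ge>lenc 0. ?D (case_nat c e) (res w k)"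
      proof (rule random_dense[OF w, of 0 ?D])
        show "inc 0 w" by (simp add: inc_def lenc_def)
        show "cp (\<lambda>w e. ?D (\<lambda>i. e (Suc i)) (e 0))" by (intro cfi Jc)
        show "?D (case_nat c e) t" if "ext s t" "?D (case_nat c e) s" for s t
          using that J_mono ext_trans by blast
        show "\<exists>u. ext t u \<and> ?D (case_nat c e) u" for t using ext_refl by blast
      qed
      then obtain k where k: "\<And>t. ext (res w k) t \<Longrightarrow> \<not> J e c t" using n by auto
      let ?E = "\<lambda>e t. \<exists>a. \<forall>u. ext t u \<longrightarrow> \<not> (\<exists>b. FM (\<lambda>i. e (Suc i)) (e 0) a b u \<and>
        (\<forall>d. d \<in> set (list_decode b) \<longrightarrow> J (\<lambda>i. e (Suc i)) d u))"
      have "\<exists>j\<ge>lenc (res w k). ?E (case_nat c e) (res w j)"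
      proof (rule random_dense[OF w, of "res w k" ?E])
        show "cp (\<lambda>w e. ?E (\<lambda>i. e (Suc i)) (e 0))" by (intro cfi FMc Jc)
        show "?E (case_nat c e) t" if "ext s t" "?E (case_nat c e) s" for s t
          using that ext_trans by blast
        show "\<exists>u. ext t u \<and> ?E (case_nat c e) u" if kt: "ext (res w k) t" for t
        proof -
          obtain a t' where "ext t t'" "\<forall>u. ext t' u \<longrightarrow> \<not> (\<exists>b. FM e c a b u \<and> (\<forall>d\<in>set (list_decode b). J e d u))"
            using k[OF kt] unfolding J_unfold[of e c t] by blast
          then show ?thesis unfolding nat.case by blast
        qed
      qed simp
      then obtain j a where j: "\<And>u b. ext (res w j) u \<Longrightarrow> FM e c a b u \<Longrightarrow> \<exists>d\<in>set (list_decode b). \<not> J e d u"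
        unfolding nat.case by blast
      obtain b where b: "M w e c a b" "\<And>d. d \<in> set (list_decode b) \<Longrightarrow> \<exists>k. J e d (res w k)" using indI by blast
      then obtain i where i: "FM e c a b (res w i)" using FMt[OF w] by blast
      obtain kd where kd: "\<And>d. d \<in> set (list_decode b) \<Longrightarrow> J e d (res w (kd d))" using b(2) by metis
      define K where "K = Max (insert i (insert j (kd ` set (list_decode b))))"
      have "x \<le> K" if "x \<in> insert i (insert j (kd ` set (list_decode b)))" for x
        unfolding K_def by (rule Max_ge) (use that in auto)
      then have K: "i \<le> K" "j \<le> K" "\<And>d. d \<in> set (list_decode b) \<Longrightarrow> kd d \<le> K" by auto
      have "FM e c a b (res w K)" using FMm i K(1) ext_res by blast
      moreover have "J e d (res w K)" if "d \<in> set (list_decode b)" for d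
        using J_mono kd[OF that] K(3)[OF that] ext_res by blast
      ultimately show False using j[of "res w K" b] K(2) ext_res by blast
    qed
  qed
  have fn: "fname (\<lambda>e u. J e (s e) u) (\<lambda>w e. ind (M w e) (s e))"
    unfolding fname_def
  proof (intro conjI allI impI)
    show "cp (\<lambda>w e. J (\<lambda>i. e (Suc i)) (s (\<lambda>i. e (Suc i))) (e 0))"
      by (intro Jc cfi cf_shift[OF s])
  qed (use J_mono sound complete in blast)+
  show ?thesis by (rule fpI[OF cp_ind[OF fp_cp[OF M] s] fn])
qed

section \<open>Reachability of runs as an inductive definition\<close>

definition osuc :: "om \<Rightarrow> om" where "osuc t = (LEAST u. t < u)"

lemma osuc_gt: "t < osuc t"
proof -
  obtain a where "t < a" using bounded_om[of "{t}"] by auto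
  then show ?thesis unfolding osuc_def by (rule LeastI)
qed

lemma osuc_le: "t < u \<Longrightarrow> osuc t \<le> u"
  unfolding osuc_def by (rule Least_le)

lemma is_succ_osuc: "is_succ_of rom (osuc t) t"
  unfolding is_succ_rom using osuc_gt osuc_le by (meson leI less_le_not_le)

lemma orun_osuc: "orun G c (osuc t) = G (orun G c t)"
  by (rule orun.f_succ[OF is_succ_osuc])

definition olim :: "om \<Rightarrow> bool" where "olim t \<longleftrightarrow> t \<noteq> om0 \<and> (\<forall>s<t. osuc s < t)"

lemma not_less_om0 [simp]: "\<not> q < om0"
  by (simp add: not_less)

lemma olim_gt0: "olim t \<Longrightarrow> om0 < t"
  using om0_le[of t] unfolding olim_def by (metis order_le_imp_less_or_eq)

lemma om_cases: obtains "t = om0" | s where "t = osuc s" | "olim t"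
  unfolding olim_def using osuc_le by (metis order_le_imp_less_or_eq)

lemma olim_not_succ: "olim t \<Longrightarrow> \<not> is_succ_of rom t b"
  unfolding is_succ_rom olim_def using osuc_gt by (meson leD)

definition oliminf :: "om \<Rightarrow> (om \<Rightarrow> nat) \<Rightarrow> nat \<Rightarrow> bool" where
  "oliminf t v x \<longleftrightarrow> (\<exists>g<t. \<forall>b. g \<le> b \<and> b < t \<longrightarrow> x \<le> v b) \<and> (\<forall>g<t. \<exists>b. g \<le> b \<and> b < t \<and> v b = x)"

lemma oliminf_iff: "liminf_is rom t v x \<longleftrightarrow> oliminf t v x"
  unfolding liminf_is_def oliminf_def by auto

lemma orun_lim_val: "olim t \<Longrightarrow> orun G c t h = lim_val rom t (\<lambda>b. orun G c b h)"
proof -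
  assume t: "olim t"
  then have "om0 < t" by (rule olim_gt0)
  then show ?thesis using orun.f_lim[of om0 t G c] olim_not_succ[OF t] by auto
qed

lemma orun_oliminf: "olim t \<Longrightarrow> oliminf t (\<lambda>b. orun G c b h) x \<Longrightarrow> orun G c t h = x"
  using orun_lim_val rom.lim_val_eq oliminf_iff by metis

lemma orun_overflow: "olim t \<Longrightarrow> (\<And>x. \<not> oliminf t (\<lambda>b. orun G c b h) x) \<Longrightarrow> orun G c t h = 0"
  using orun_lim_val[of t G c h] unfolding lim_val_def oliminf_iff by simp

lemma oliminf_or_div:
  assumes "olim t" "\<And>x. \<not> oliminf t v x"
  shows "\<exists>g<t. \<forall>b. g \<le> b \<and> b < t \<longrightarrow> N \<le> v b"
proof (rule ccontr)
  assume n: "\<not> ?thesis"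
  define Q where "Q x \<longleftrightarrow> (\<forall>g<t. \<exists>b. g \<le> b \<and> b < t \<and> v b \<le> x)" for x
  have "Q N" using n unfolding Q_def by (meson less_imp_le not_le)
  then have Q: "Q (LEAST x. Q x)" by (rule LeastI)
  define x where "x = (LEAST x. Q x)"
  have "\<exists>g<t. \<forall>b. g \<le> b \<and> b < t \<longrightarrow> x \<le> v b"
  proof (cases x)
    case 0
    have "om0 < t" by (rule olim_gt0[OF assms(1)])
    then show ?thesis using 0 by auto
  next
    case (Suc y)
    have "\<not> Q y" using Suc not_less_Least[of y Q] unfolding x_def by simp
    then show ?thesis unfolding Q_def Suc by (metis not_less_eq_eq)
  qed
  then obtain g where g: "g < t" "\<And>b. g \<le> b \<Longrightarrow> b < t \<Longrightarrow> x \<le> v b" by blast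
  have "\<exists>b. h \<le> b \<and> b < t \<and> v b = x" if "h < t" for h
  proof -
    have "max g h < t" using that g(1) by simp
    then obtain b where "max g h \<le> b" "b < t" "v b \<le> x" using Q unfolding Q_def x_def by blast
    then show ?thesis using g(2)[of b] by (intro exI[of _ b]) auto
  qed
  then show False using assms(2)[of x] g unfolding oliminf_def by blast
qed

lemma finite_tail:
  assumes "olim t" "s < t" "\<And>h. h < (m::nat) \<Longrightarrow> \<exists>g<t. \<forall>b. g \<le> b \<and> b < t \<longrightarrow> P h b"
  shows "\<exists>g. s \<le> g \<and> g < t \<and> (\<forall>b h. g \<le> b \<longrightarrow> b < t \<longrightarrow> h < m \<longrightarrow> P h b)"
  using assms(3)
proof (induction m)
  case 0
  then show ?case using assms(2) by auto
next
  case (Suc m)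
  obtain g where g: "s \<le> g" "g < t" "\<forall>b h. g \<le> b \<longrightarrow> b < t \<longrightarrow> h < m \<longrightarrow> P h b" using Suc by auto
  obtain g' where g': "g' < t" "\<forall>b. g' \<le> b \<and> b < t \<longrightarrow> P m b" using Suc.prems[of m] by auto
  show ?case using g g' by (intro exI[of _ "max g g'"]) (auto simp: less_Suc_eq max.coboundedI1)
qed

section \<open>Rules for reachability between vectors with finitely many components\<close>

locale fin_system =
  fixes m :: nat and G :: "vec \<Rightarrow> vec"
  assumes supp_G: "\<And>v. \<forall>i\<ge>m. v i = 0 \<Longrightarrow> \<forall>i\<ge>m. G v i = 0"
begin

definition vc :: "nat \<Rightarrow> vec" where "vc c = (\<lambda>i. if i < m then sel c i else 0)"

definition code :: "vec \<Rightarrow> nat" where "code v = list_encode (map v [0..<m])"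

definition supp :: "vec \<Rightarrow> bool" where "supp v \<longleftrightarrow> (\<forall>i\<ge>m. v i = 0)"

lemma vc_code: "supp v \<Longrightarrow> vc (code v) = v"
  unfolding vc_def code_def supp_def by (auto simp: fun_eq_iff)

lemma sel_code [simp]: "h < m \<Longrightarrow> sel (code v) h = v h"
  unfolding code_def by simp

lemma supp_vc [simp]: "supp (vc c)" unfolding vc_def supp_def by simp

lemma vc_sel: "h < m \<Longrightarrow> vc c h = sel c h" unfolding vc_def by simp

lemma supp_trun: "trun G c V d \<Longrightarrow> supp c \<Longrightarrow> supp d \<and> (\<forall>v\<in>V. supp v)"
proof (induction rule: trun.induct)
  case (trun_step c V d)
  then show ?case using supp_G unfolding supp_def by auto
next
  case (trun_lim c V)
  have s: "supp (c n) \<and> (\<forall>v\<in>V n. supp v)" for n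
  proof (induction n)
    case 0 then show ?case using trun_lim by blast
  next
    case (Suc n) then show ?case using trun_lim.IH by blast
  qed
  then have "supp (lim_vec V)" unfolding supp_def using lim_vec_const[of V _ 0] trun_lim(2) by blast
  then show ?case using s by blast
qed auto

lemma supp_orun: "supp c \<Longrightarrow> supp (orun G c t)"
  using supp_trun[of c] orun_trun[of om0 t G c] by auto

definition St :: "nat \<Rightarrow> nat \<Rightarrow> bool" where "St c d \<longleftrightarrow> vc d = G (vc c)"

definition leqv :: "nat \<Rightarrow> nat \<Rightarrow> bool" where "leqv b c \<longleftrightarrow> (\<forall>h. h < m \<longrightarrow> sel b h \<le> sel c h)"

definition eqv :: "nat \<Rightarrow> nat \<Rightarrow> bool" where "eqv b c \<longleftrightarrow> (\<forall>h. h < m \<longrightarrow> sel b h = sel c h)"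

lemma eqv_vc: "eqv b c \<longleftrightarrow> vc b = vc c" unfolding eqv_def vc_def by (auto simp: fun_eq_iff)

text \<open>Statements: \<open>tri e b d\<close> - the run from \<open>e\<close> reaches \<open>d\<close> with all configurations visited before
  \<open>d\<close> above \<open>b\<close>; \<open>lims c d\<close> - the run from \<open>c\<close> stays above \<open>d\<close> and has limit \<open>d\<close>; \<open>chain c d i j\<close> -
  the run from \<open>c\<close> passes \<open>j\<close> more times through configurations attaining a component of \<open>d\<close>,
  the component being \<open>fst (prod_decode i)\<close> first.\<close>

abbreviation "tri e b d \<equiv> list_encode [0, e, b, d]"
abbreviation "lims c d \<equiv> list_encode [1, c, d]"
abbreviation "chain c d i j \<equiv> list_encode [2, c, d, i, j]"
abbreviation "fin c d p i \<equiv> list_encode [c, d, p, i]"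

text \<open>The challenge \<open>a\<close> matters only for \<open>lims\<close>: a limit has to
  provide chains of every length. The rule with \<open>L\<close> treats limits with divergence:
  \<open>p\<close> marks the divergent components and \<open>k\<close> bounds them from below during
  the approach, so \<open>z\<close> has to lie below \<open>k\<close> at these components.\<close>

definition Mst :: "(nat \<Rightarrow> nat \<Rightarrow> nat \<Rightarrow> nat \<Rightarrow> bool) \<Rightarrow> nat \<Rightarrow> nat \<Rightarrow> nat \<Rightarrow> bool" where
  "Mst L s a b \<longleftrightarrow>
     (\<exists>e z d. s = tri e z d \<and> b = list_encode [] \<and> eqv e d) \<or>
     (\<exists>e z d d1. s = tri e z d \<and> b = list_encode [tri e z d1] \<and> leqv z d1 \<and> St d1 d) \<or>
     (\<exists>e z d c. s = tri e z d \<and> b = list_encode [tri e z c, lims c d] \<and> leqv z d) \<or>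
     (\<exists>e z d c p k. s = tri e z d \<and> b = list_encode [tri e z c] \<and> L c d p k \<and>
        (\<forall>h. h < m \<longrightarrow> sel z h \<le> (if sel p h = 0 then sel d h else k))) \<or>
     (\<exists>c d. s = lims c d \<and> b = list_encode [chain c d 0 a]) \<or>
     (\<exists>c d i. s = chain c d i 0 \<and> b = list_encode []) \<or>
     (\<exists>c d i j c1 c'. s = chain c d i (Suc j) \<and> b = list_encode [tri c1 d c', chain c' d (Suc i) j] \<and>
        leqv d c \<and> St c c1 \<and> (fst (prod_decode i) < m \<longrightarrow> sel c' (fst (prod_decode i)) = sel d (fst (prod_decode i))))"

text \<open>One round of an approach with divergence: marked components stay at least
  \<open>i\<close>, the others at least at their limit, and the component scheduled by
  \<open>i\<close> attains its limit if it is unmarked. The step from \<open>c\<close> to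
  \<open>c1\<close> is split off so that time advances in every round.\<close>

definition link :: "(nat \<Rightarrow> bool) \<Rightarrow> nat \<Rightarrow> nat \<Rightarrow> nat \<Rightarrow> nat \<Rightarrow> nat \<Rightarrow> bool" where
  "link R c d p i a \<longleftrightarrow> (\<exists>c1 z. St c c1 \<and> (\<forall>h. h < m \<longrightarrow> sel z h = (if sel p h = 0 then sel d h else i)) \<and>
     leqv z c \<and> R (tri c1 z a) \<and>
     (fst (prod_decode i) < m \<and> sel p (fst (prod_decode i)) = 0 \<longrightarrow>
        sel a (fst (prod_decode i)) = sel d (fst (prod_decode i))))"

text \<open>The challenge proposes the next point of the approach. A proposal that is no link is
  dismissed by the empty list of premises.\<close>

definition Mfin :: "(nat \<Rightarrow> bool) \<Rightarrow> nat \<Rightarrow> nat \<Rightarrow> nat \<Rightarrow> bool" where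
  "Mfin R s a b \<longleftrightarrow> (\<exists>c d p i. s = fin c d p i \<and>
     (if link R c d p i a then b = list_encode [fin a d p (Suc i)] else b = list_encode []))"

text \<open>\<open>ind (Mfin R)\<close> holds where all chains of links are finite; since the bound \<open>i\<close> on the components
  marked by \<open>p\<close> grows along the links, an infinite chain leads to a limit at which exactly these
  components diverge.\<close>

definition LL :: "(nat \<Rightarrow> bool) \<Rightarrow> nat \<Rightarrow> nat \<Rightarrow> nat \<Rightarrow> nat \<Rightarrow> bool" where
  "LL R c d p k \<longleftrightarrow> (\<forall>h. h < m \<longrightarrow> sel p h \<noteq> 0 \<longrightarrow> sel d h = 0) \<and> \<not> ind (Mfin R) (fin c d p k)"

text \<open>\<open>RR n\<close> admits limits at which at most \<open>n\<close> components diverge: while approaching such a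
  limit the divergent components are eventually nonzero, hence do not diverge at intermediate limits,
  so the approach is described by \<open>RR (n - 1)\<close>.\<close>

primrec RR :: "nat \<Rightarrow> nat \<Rightarrow> bool" where
  "RR 0 = ind (Mst (\<lambda>c d p k. False))"
| "RR (Suc n) = ind (Mst (LL (RR n)))"

subsection \<open>Soundness\<close>

fun chn :: "vec \<Rightarrow> vec \<Rightarrow> nat \<Rightarrow> nat \<Rightarrow> bool" where
  "chn c d i 0 = True"
| "chn c d i (Suc j) = (\<exists>V c'. trun G c V c' \<and> V \<noteq> {} \<and> (\<forall>v\<in>V. \<forall>h<m. d h \<le> v h) \<and>
     (fst (prod_decode i) < m \<longrightarrow> c' (fst (prod_decode i)) = d (fst (prod_decode i))) \<and> chn c' d (Suc i) j)"

definition Good :: "nat \<Rightarrow> bool" where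
  "Good s \<longleftrightarrow> (\<forall>e z d. s = tri e z d \<longrightarrow> (\<exists>V. trun G (vc e) V (vc d) \<and> (\<forall>v\<in>V. \<forall>h<m. sel z h \<le> v h))) \<and>
     (\<forall>c d. s = lims c d \<longrightarrow> (\<exists>V. trun G (vc c) V (vc d) \<and> (\<forall>v\<in>V. \<forall>h<m. sel d h \<le> v h))) \<and>
     (\<forall>c d i j. s = chain c d i j \<longrightarrow> chn (vc c) (vc d) i j)"

text \<open>The greedy choice of hitting times is bounded by every chain, so chains of all finite lengths
  yield an infinite one.\<close>

lemma chn_limit:
  assumes "\<And>j. chn c d 0 j" "supp c" "supp d"
  shows "\<exists>V. trun G c V d \<and> (\<forall>v\<in>V. \<forall>h<m. d h \<le> v h)"
proof -
  let ?F = "orun G c"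
  define hit where "hit i t \<longleftrightarrow> (fst (prod_decode i) < m \<longrightarrow> ?F t (fst (prod_decode i)) = d (fst (prod_decode i)))" for i t
  define low where "low s t \<longleftrightarrow> (\<forall>q h. s \<le> q \<longrightarrow> q < t \<longrightarrow> h < m \<longrightarrow> d h \<le> ?F q h)" for s t
  \<comment> \<open>These earliest hitting times are chosen without regard to the lower bound
    \<open>low\<close>. They inherit it, since every chain respects it and hits no earlier.\<close>
  define u where "u = rec_nat om0 (\<lambda>n s. LEAST t. s < t \<and> hit n t)"
  have u0: "u 0 = om0" and uS: "u (Suc n) = (LEAST t. u n < t \<and> hit n t)" for n unfolding u_def by simp_all
  have chn_step: "\<exists>t>s. hit i t \<and> low s t \<and> chn (?F t) d (Suc i) j" if ch: "chn (?F s) d i (Suc j)" for s i j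
  proof -
    obtain V c' where V: "trun G (?F s) V c'" "V \<noteq> {}" "\<forall>v\<in>V. \<forall>h<m. d h \<le> v h"
      "fst (prod_decode i) < m \<longrightarrow> c' (fst (prod_decode i)) = d (fst (prod_decode i))" "chn c' d (Suc i) j"
      using ch by auto
    obtain t where t: "t \<ge> s" "?F t = c'" "V = ?F ` {s..<t}" using trun_orun[OF V(1)] by blast
    then have "s < t" using V(2) by (cases "s = t") auto
    then show ?thesis using V t unfolding hit_def low_def by auto
  qed
  have main: "\<forall>j. \<exists>s\<ge>u n. low (u n) s \<and> chn (?F s) d n j" for n
  proof (induction n)
    case 0
    show ?case using assms(1) by (auto simp: u0 low_def intro!: exI[of _ om0])
  next
    case (Suc n)
    show ?case
    proof
      fix j
      obtain s where s: "s \<ge> u n" "low (u n) s" "chn (?F s) d n (Suc j)" using Suc by blast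
      obtain t where t: "s < t" "hit n t" "low s t" "chn (?F t) d (Suc n) j" using chn_step[OF s(3)] by blast
      have "u (Suc n) \<le> t" unfolding uS using s(1) t(1,2) by (intro Least_le) auto
      moreover have "u n < u (Suc n)" unfolding uS using s(1) t(1,2) LeastI[of "\<lambda>t. u n < t \<and> hit n t" t] by auto
      then have "low (u (Suc n)) t" using s(2) t(3) unfolding low_def by (meson leI less_imp_le order_trans)
      ultimately show "\<exists>s\<ge>u (Suc n). low (u (Suc n)) s \<and> chn (?F s) d (Suc n) j" using t(4) by blast
    qed
  qed
  have step: "u n < u (Suc n) \<and> hit n (u (Suc n)) \<and> low (u n) (u (Suc n))" for n
  proof -
    obtain s where s: "s \<ge> u n" "low (u n) s" "chn (?F s) d n (Suc 0)" using main by blast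
    obtain t where t: "s < t" "hit n t" "low s t" using chn_step[OF s(3)] by blast
    have "u n < t \<and> hit n t" using s t by auto
    then have "u n < u (Suc n) \<and> hit n (u (Suc n))" unfolding uS by (rule LeastI)
    moreover have "u (Suc n) \<le> t" unfolding uS by (rule Least_le) fact
    moreover have "low (u n) t" using s(2) t(3) unfolding low_def by (meson leI)
    ultimately show ?thesis unfolding low_def by (meson less_le_trans)
  qed
  define V where "V n = ?F ` {u n..<u (Suc n)}" for n
  have t: "trun G (?F (u 0)) (\<Union>n. V n) (lim_vec V)"
  proof (rule trun_lim[of G "\<lambda>n. ?F (u n)"])
    show "trun G (?F (u n)) (V n) (?F (u (Suc n)))" for n
      unfolding V_def using step[of n] by (intro orun_trun) auto
    show "V n \<noteq> {}" for n using step[of n] unfolding V_def by auto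
  qed
  have low: "d h \<le> v h" if "v \<in> V n" "h < m" for v n h
    using step[of n] that unfolding V_def low_def by auto
  have "lim_vec V h = d h" for h
  proof (cases "h < m")
    case True
    show ?thesis
    proof (rule lim_vec_eq)
      have "\<exists>n\<ge>N. \<exists>v\<in>V n. v h = d h" for N
      proof -
        define n where "n = prod_encode (h, N)"
        have "N \<le> Suc n" unfolding n_def using le_prod_encode_2[of N h] by simp
        moreover have "?F (u (Suc n)) h = d h" using step[of n] True unfolding hit_def n_def by simp
        moreover have "?F (u (Suc n)) \<in> V (Suc n)" unfolding V_def using step[of "Suc n"] by auto
        ultimately show ?thesis by blast
      qed
      then show "is_liminf V h (d h)" unfolding is_liminf_def using low True by blast
    qed
  next
    case False
    have "V n \<noteq> {}" for n using step[of n] unfolding V_def by auto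
    moreover have "v h = 0" if "v \<in> V n" for n v
      using that supp_orun[OF assms(2)] False unfolding V_def supp_def by auto
    ultimately have "lim_vec V h = 0" by (rule lim_vec_const)
    then show ?thesis using assms(3) False unfolding supp_def by simp
  qed
  then have "lim_vec V = d" by blast
  then show ?thesis using t low u0 by auto
qed

text \<open>Since the \<open>fin\<close> statement is not derivable, dependent choice gives
  infinitely many links with bounds k, k + 1, and so on. Marked components outgrow every bound and
  are reset to 0, their value in \<open>d\<close>; unmarked ones never fall below \<open>d\<close>
  and attain it in every scheduled round.\<close>

lemma LL_sound:
  assumes R: "\<And>s. R s \<Longrightarrow> Good s" and L: "LL R c d p k"
  shows "\<exists>V. trun G (vc c) V (vc d) \<and> (\<forall>v\<in>V. \<forall>h<m. (if sel p h = 0 then sel d h else k) \<le> v h)"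
proof -
  have step: "\<exists>a. link R c d p i a \<and> \<not> ind (Mfin R) (fin a d p (Suc i))" if ni: "\<not> ind (Mfin R) (fin c d p i)" for c i
  proof -
    have "\<exists>a. \<forall>b. Mfin R (fin c d p i) a b \<longrightarrow> (\<exists>t\<in>set (list_decode b). \<not> ind (Mfin R) t)"
    proof (rule ccontr)
      assume h: "\<not> ?thesis"
      have "ind (Mfin R) (fin c d p i)" by (rule indI) (use h in blast)
      then show False using ni by blast
    qed
    then obtain a where a: "\<And>b. Mfin R (fin c d p i) a b \<Longrightarrow> \<exists>t\<in>set (list_decode b). \<not> ind (Mfin R) t"
      by blast
    show ?thesis
    proof (cases "link R c d p i a")
      case True
      then have "Mfin R (fin c d p i) a (list_encode [fin a d p (Suc i)])" unfolding Mfin_def by auto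
      from a[OF this] show ?thesis using True by auto
    next
      case False
      then have "Mfin R (fin c d p i) a (list_encode [])" unfolding Mfin_def by auto
      from a[OF this] show ?thesis by simp
    qed
  qed
  have "\<exists>f. \<forall>n. (\<not> ind (Mfin R) (fin (f n) d p (k + n)) \<and> (n = 0 \<longrightarrow> f n = c)) \<and> link R (f n) d p (k + n) (f (Suc n))"
  proof (rule dependent_nat_choice)
    show "\<exists>x. \<not> ind (Mfin R) (fin x d p (k + 0)) \<and> (0 = (0::nat) \<longrightarrow> x = c)" using L unfolding LL_def by auto
  next
    fix x and n :: nat assume "\<not> ind (Mfin R) (fin x d p (k + n)) \<and> (n = 0 \<longrightarrow> x = c)"
    then show "\<exists>y. (\<not> ind (Mfin R) (fin y d p (k + Suc n)) \<and> (Suc n = 0 \<longrightarrow> y = c)) \<and> link R x d p (k + n) y"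
      using step[of x "k + n"] by auto
  qed
  then obtain f where f: "f 0 = c" "\<And>n. link R (f n) d p (k + n) (f (Suc n))" by blast
  let ?B = "\<lambda>n h. if sel p h = 0 then sel d h else k + n"
  have "\<exists>V. trun G (vc (f n)) V (vc (f (Suc n))) \<and> vc (f n) \<in> V \<and> (\<forall>v\<in>V. supp v \<and> (\<forall>h<m. ?B n h \<le> v h))" for n
  proof -
    obtain c1 z where z: "St (f n) c1" "\<And>h. h < m \<Longrightarrow> sel z h = ?B n h" "leqv z (f n)" "R (tri c1 z (f (Suc n)))"
      using f(2)[of n] unfolding link_def by auto
    obtain V where V: "trun G (vc c1) V (vc (f (Suc n)))" "\<forall>v\<in>V. \<forall>h<m. sel z h \<le> v h"
      using R[OF z(4)] unfolding Good_def by auto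
    have "trun G (vc (f n)) (insert (vc (f n)) V) (vc (f (Suc n)))"
      using trun_Cons[of G "vc (f n)"] V(1) z(1) unfolding St_def by simp
    moreover from this have "\<forall>v\<in>insert (vc (f n)) V. supp v" using supp_trun supp_vc by blast
    moreover have "\<forall>v\<in>insert (vc (f n)) V. \<forall>h<m. ?B n h \<le> v h"
      using V(2) z(2,3) unfolding leqv_def by (auto simp: vc_sel)
    ultimately show ?thesis by blast
  qed
  then obtain V where V: "\<And>n. trun G (vc (f n)) (V n) (vc (f (Suc n)))" "\<And>n. vc (f n) \<in> V n"
    "\<And>n v. v \<in> V n \<Longrightarrow> supp v" "\<And>n v h. v \<in> V n \<Longrightarrow> h < m \<Longrightarrow> ?B n h \<le> v h" by metis
  have ne: "V n \<noteq> {}" for n using V(2) by blast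
  have t: "trun G (vc c) (\<Union>n. V n) (lim_vec V)"
    using trun_lim[of G "\<lambda>n. vc (f n)" V, OF V(1) ne] f(1) by simp
  have "lim_vec V h = vc d h" for h
  proof -
    consider "h \<ge> m" | "h < m" "sel p h \<noteq> 0" | "h < m" "sel p h = 0" by fastforce
    then show ?thesis
    proof cases
      case 1
      then have "lim_vec V h = 0" using lim_vec_const[of V h 0] ne V(3) unfolding supp_def by blast
      then show ?thesis using 1 unfolding vc_def by simp
    next
      case 2
      have "\<not> is_liminf V h x" for x
      proof
        assume "is_liminf V h x"
        then obtain n v where "n \<ge> Suc x" "v \<in> V n" "v h = x" unfolding is_liminf_def by blast
        then show False using V(4)[of v n h] 2 by simp
      qed
      then have "lim_vec V h = 0" by (rule lim_vec_none)
      then show ?thesis using L 2 unfolding LL_def by (simp add: vc_sel)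
    next
      case 3
      show ?thesis
      proof (rule lim_vec_eq)
        have "\<exists>n\<ge>N. \<exists>v\<in>V n. v h = vc d h" for N
        proof -
          \<comment> \<open>Rounds are numbered from \<open>k\<close>, so a round that schedules
            \<open>h\<close> is chosen beyond \<open>k + N\<close> and shifted back by
            \<open>k\<close>.\<close>
          define i where "i = prod_encode (h, k + N)"
          have i: "k + N \<le> i" unfolding i_def by (rule le_prod_encode_2)
          define n where "n = i - k"
          have n: "k + n = i" "N \<le> n" using i unfolding n_def by auto
          have "fst (prod_decode (k + n)) < m \<and> sel p (fst (prod_decode (k + n))) = 0 \<longrightarrow>
              sel (f (Suc n)) (fst (prod_decode (k + n))) = sel d (fst (prod_decode (k + n)))"
            using f(2)[of n] unfolding link_def by blast
          then have "sel (f (Suc n)) h = sel d h" using 3 unfolding n(1) i_def by simp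
          then have "vc (f (Suc n)) h = vc d h" using 3 by (simp add: vc_sel)
          then show ?thesis using V(2)[of "Suc n"] n(2) by (intro exI[of _ "Suc n"]) auto
        qed
        moreover have "vc d h \<le> v h" if "v \<in> V n" for v n using V(4)[OF that 3(1)] 3 by (simp add: vc_sel)
        ultimately show "is_liminf V h (vc d h)" unfolding is_liminf_def by blast
      qed
    qed
  qed
  then have "lim_vec V = vc d" by blast
  then have "trun G (vc c) (\<Union>n. V n) (vc d)" using t by simp
  moreover have "(if sel p h = 0 then sel d h else k) \<le> v h" if "v \<in> V n" "h < m" for v n h
    using V(4)[OF that] by (auto split: if_splits)
  ultimately show ?thesis by blast
qed

lemma Mst_sound:
  assumes L: "\<And>c d p k. L c d p k \<Longrightarrow>
     \<exists>V. trun G (vc c) V (vc d) \<and> (\<forall>v\<in>V. \<forall>h<m. (if sel p h = 0 then sel d h else k) \<le> v h)"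
  shows "ind (Mst L) s \<Longrightarrow> Good s"
proof (induction rule: ind.induct)
  case (indI s)
  have IH: "\<exists>b. Mst L s a b \<and> (\<forall>t\<in>set (list_decode b). Good t)" for a using indI by blast
  show ?case unfolding Good_def
  proof (intro conjI allI impI)
    fix e z d assume s: "s = tri e z d"
    let ?T = "\<lambda>c. \<exists>V. trun G (vc e) V (vc c) \<and> (\<forall>v\<in>V. \<forall>h<m. sel z h \<le> v h)"
    obtain b where b: "Mst L s 0 b" "\<forall>t\<in>set (list_decode b). Good t" using IH by blast
    from b(1)[unfolded Mst_def s] consider
        "eqv e d"
      | d1 where "b = list_encode [tri e z d1]" "leqv z d1" "St d1 d"
      | c where "b = list_encode [tri e z c, lims c d]" "leqv z d"
      | c p k where "b = list_encode [tri e z c]" "L c d p k"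
          "\<forall>h. h < m \<longrightarrow> sel z h \<le> (if sel p h = 0 then sel d h else k)"
      by (auto simp: list_encode_eq simp del: list_encode.simps)
    then show "?T d"
    proof cases
      case 1
      then show ?thesis using trun_refl[of G "vc e"] unfolding eqv_vc by (intro exI[of _ "{}"]) auto
    next
      case 2
      then have "Good (tri e z d1)" using b(2) by auto
      then obtain V where V: "trun G (vc e) V (vc d1)" "\<forall>v\<in>V. \<forall>h<m. sel z h \<le> v h" unfolding Good_def by blast
      then show ?thesis using trun_step[OF V(1)] 2(2,3) unfolding St_def leqv_def
        by (intro exI[of _ "insert (vc d1) V"]) (auto simp: vc_sel)
    next
      case 3
      then have g: "Good (tri e z c)" "Good (lims c d)" using b(2) by auto
      obtain V where V: "trun G (vc e) V (vc c)" "\<forall>v\<in>V. \<forall>h<m. sel z h \<le> v h" using g(1) unfolding Good_def by blast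
      obtain W where W: "trun G (vc c) W (vc d)" "\<forall>v\<in>W. \<forall>h<m. sel d h \<le> v h" using g(2) unfolding Good_def by blast
      have "\<forall>v\<in>V \<union> W. \<forall>h<m. sel z h \<le> v h" using V(2) W(2) 3(2) unfolding leqv_def by (blast intro: order_trans)
      then show ?thesis using trun_trans[OF W(1) V(1)] by blast
    next
      case 4
      then have g: "Good (tri e z c)" using b(2) by auto
      obtain V where V: "trun G (vc e) V (vc c)" "\<forall>v\<in>V. \<forall>h<m. sel z h \<le> v h" using g(1) unfolding Good_def by blast
      obtain W where W: "trun G (vc c) W (vc d)" "\<forall>v\<in>W. \<forall>h<m. (if sel p h = 0 then sel d h else k) \<le> v h"
        using L[OF 4(2)] by blast
      have "\<forall>v\<in>V \<union> W. \<forall>h<m. sel z h \<le> v h" using V(2) W(2) 4(3) by (blast intro: order_trans)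
      then show ?thesis using trun_trans[OF W(1) V(1)] by blast
    qed
  next
    fix c d assume s: "s = lims c d"
    have "chn (vc c) (vc d) 0 a" for a
    proof -
      obtain b where b: "Mst L s a b" "\<forall>t\<in>set (list_decode b). Good t" using IH by blast
      then have "b = list_encode [chain c d 0 a]"
        unfolding Mst_def s by (auto simp: list_encode_eq simp del: list_encode.simps)
      then have "Good (chain c d 0 a)" using b(2) by simp
      then show ?thesis unfolding Good_def by blast
    qed
    from chn_limit[OF this] show "\<exists>V. trun G (vc c) V (vc d) \<and> (\<forall>v\<in>V. \<forall>h<m. sel d h \<le> v h)"
      by (auto simp: vc_sel)
  next
    fix c d i j assume s: "s = chain c d i j"
    obtain b where b: "Mst L s 0 b" "\<forall>t\<in>set (list_decode b). Good t" using IH by blast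
    from b(1)[unfolded Mst_def s] consider "j = 0"
      | j' c1 c' where "j = Suc j'" "b = list_encode [tri c1 d c', chain c' d (Suc i) j']" "leqv d c" "St c c1"
         "fst (prod_decode i) < m \<longrightarrow> sel c' (fst (prod_decode i)) = sel d (fst (prod_decode i))"
      by (auto simp: list_encode_eq simp del: list_encode.simps)
    then show "chn (vc c) (vc d) i j"
    proof cases
      case 2
      then have g: "Good (tri c1 d c')" "Good (chain c' d (Suc i) j')" using b(2) by auto
      obtain V where V: "trun G (vc c1) V (vc c')" "\<forall>v\<in>V. \<forall>h<m. sel d h \<le> v h" using g(1) unfolding Good_def by blast
      have "trun G (vc c) (insert (vc c) V) (vc c')" using trun_Cons[of G "vc c"] V(1) 2(4) unfolding St_def by simp
      moreover have "\<forall>v\<in>insert (vc c) V. \<forall>h<m. vc d h \<le> v h" using V(2) 2(3) unfolding leqv_def by (auto simp: vc_sel)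
      moreover have "chn (vc c') (vc d) (Suc i) j'" using g(2) unfolding Good_def by blast
      ultimately show ?thesis unfolding 2(1) chn.simps using 2(5)
        by (intro exI[of _ "insert (vc c) V"] exI[of _ "vc c'"]) (simp add: vc_sel)
    qed simp
  qed
qed

theorem RR_sound: "RR n s \<Longrightarrow> Good s"
proof (induction n arbitrary: s)
  case 0
  then show ?case using Mst_sound[of "\<lambda>c d p k. False" s] by simp
next
  case (Suc n)
  show ?case by (rule Mst_sound[of "LL (RR n)"], rule LL_sound[OF Suc.IH]) (use Suc.prems in simp_all)
qed

subsection \<open>Completeness\<close>

definition Lev :: "nat \<Rightarrow> nat \<Rightarrow> nat \<Rightarrow> nat \<Rightarrow> nat \<Rightarrow> bool" where
  "Lev n = (case n of 0 \<Rightarrow> (\<lambda>c d p k. False) | Suc k \<Rightarrow> LL (RR k))"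

lemma RR_Lev: "RR n = ind (Mst (Lev n))"
  unfolding Lev_def by (cases n) auto

lemma RR_I: "(\<And>a. \<exists>b. Mst (Lev n) s a b \<and> (\<forall>t\<in>set (list_decode b). RR n t)) \<Longrightarrow> RR n s"
  unfolding RR_Lev by (rule indI)

lemma Mst_intros:
  "eqv e d \<Longrightarrow> Mst L (tri e z d) a (list_encode [])"
  "leqv z d1 \<Longrightarrow> St d1 d \<Longrightarrow> Mst L (tri e z d) a (list_encode [tri e z d1])"
  "leqv z d \<Longrightarrow> Mst L (tri e z d) a (list_encode [tri e z c, lims c d])"
  "L c d p k \<Longrightarrow> (\<forall>h. h < m \<longrightarrow> sel z h \<le> (if sel p h = 0 then sel d h else k)) \<Longrightarrow>
     Mst L (tri e z d) a (list_encode [tri e z c])"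
  "Mst L (lims c d) a (list_encode [chain c d 0 a])"
  "Mst L (chain c d i 0) a (list_encode [])"
  "leqv d c \<Longrightarrow> St c c1 \<Longrightarrow>
     (fst (prod_decode i) < m \<longrightarrow> sel c' (fst (prod_decode i)) = sel d (fst (prod_decode i))) \<Longrightarrow>
     Mst L (chain c d i (Suc j)) a (list_encode [tri c1 d c', chain c' d (Suc i) j])"
  subgoal by (unfold Mst_def, rule disjI1, intro exI conjI, rule refl, rule refl, assumption)
  subgoal by (unfold Mst_def, rule disjI2, rule disjI1, intro exI conjI, rule refl, rule refl, assumption+)
  subgoal by (unfold Mst_def, rule disjI2, rule disjI2, rule disjI1, intro exI conjI, rule refl, rule refl, assumption+)
  subgoal by (unfold Mst_def, rule disjI2, rule disjI2, rule disjI2, rule disjI1, intro exI conjI, rule refl, rule refl, assumption+)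
  subgoal by (unfold Mst_def, rule disjI2, rule disjI2, rule disjI2, rule disjI2, rule disjI1, intro exI conjI, rule refl, rule refl)
  subgoal by (unfold Mst_def, rule disjI2, rule disjI2, rule disjI2, rule disjI2, rule disjI2, rule disjI1, intro exI conjI, rule refl, rule refl)
  subgoal by (unfold Mst_def, rule disjI2, rule disjI2, rule disjI2, rule disjI2, rule disjI2, rule disjI2, intro exI conjI, rule refl, rule refl, assumption+)
  done

lemma RR_refl: "vc e = vc d \<Longrightarrow> RR n (tri e z d)"
  by (rule RR_I, rule exI, rule conjI, rule Mst_intros(1)) (simp_all add: eqv_vc)

lemma RR_step: "RR n (tri e z d1) \<Longrightarrow> leqv z d1 \<Longrightarrow> St d1 d \<Longrightarrow> RR n (tri e z d)"
  by (rule RR_I, rule exI, rule conjI, rule Mst_intros(2), assumption+) (simp del: list_encode.simps)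

lemma RR_lim: "RR n (tri e z c) \<Longrightarrow> RR n (lims c d) \<Longrightarrow> leqv z d \<Longrightarrow> RR n (tri e z d)"
  by (rule RR_I, rule exI, rule conjI, rule Mst_intros(3)[where c = c], assumption) (simp del: list_encode.simps)

lemma RR_over: "RR (Suc n) (tri e z c) \<Longrightarrow> LL (RR n) c d p k \<Longrightarrow>
    (\<forall>h. h < m \<longrightarrow> sel z h \<le> (if sel p h = 0 then sel d h else k)) \<Longrightarrow> RR (Suc n) (tri e z d)"
  by (rule RR_I, rule exI, rule conjI, rule Mst_intros(4)[where c = c and p = p and k = k], unfold Lev_def nat.case, assumption+)
     (simp del: list_encode.simps RR.simps)

lemma RR_lims: assumes "\<And>a. RR n (chain c d 0 a)" shows "RR n (lims c d)"
  by (rule RR_I, rule exI, rule conjI, rule Mst_intros(5)) (simp add: assms del: list_encode.simps)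

lemma RR_chain_0: "RR n (chain c d i 0)"
  by (rule RR_I, rule exI, rule conjI, rule Mst_intros(6)) simp

lemma RR_chain_Suc: "RR n (tri c1 d c') \<Longrightarrow> RR n (chain c' d (Suc i) j) \<Longrightarrow> leqv d c \<Longrightarrow> St c c1 \<Longrightarrow>
    (fst (prod_decode i) < m \<longrightarrow> sel c' (fst (prod_decode i)) = sel d (fst (prod_decode i))) \<Longrightarrow> RR n (chain c d i (Suc j))"
  by (rule RR_I, rule exI, rule conjI, rule Mst_intros(7)[where c' = c'], assumption+) (simp del: list_encode.simps)

text \<open>The components that diverge to infinity at the limit \<open>t\<close>.\<close>

definition over :: "(om \<Rightarrow> vec) \<Rightarrow> om \<Rightarrow> nat set" where
  "over F t = {h. h < m \<and> (\<forall>x. \<not> oliminf t (\<lambda>b. F b h) x)}"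

text \<open>\<open>U\<close> contains the components that may diverge during the stretch from
  \<open>s\<close> to \<open>t\<close>, and \<open>n\<close> bounds its size. The outer induction is
  on \<open>n\<close>, the inner one on \<open>t\<close>. Splitting off a limit with divergence set
  \<open>O\<close> reduces the approach to \<open>U - O\<close>, while the part before the approach
  keeps \<open>U\<close> and has a smaller end time.\<close>

lemma RR_complete:
  assumes v0: "supp v0"
  shows "\<lbrakk>finite U; card U \<le> n; s \<le> t; \<And>t'. s < t' \<Longrightarrow> t' \<le> t \<Longrightarrow> olim t' \<Longrightarrow> over (orun G v0) t' \<subseteq> U;
     \<And>q h. s \<le> q \<Longrightarrow> q < t \<Longrightarrow> h < m \<Longrightarrow> sel z h \<le> orun G v0 q h; vc e = orun G v0 s; vc d = orun G v0 t\<rbrakk>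
     \<Longrightarrow> RR n (tri e z d)"
proof (induction n arbitrary: U s t z e d rule: less_induct)
  case n: (less n)
  define F where "F = orun G v0"
  have vF [simp]: "vc (code (F x)) = F x" for x unfolding F_def by (rule vc_code[OF supp_orun[OF v0]])
  have FS: "F (osuc x) = G (F x)" for x unfolding F_def by (rule orun_osuc)
  have St_F: "vc c = F x \<Longrightarrow> St c (code (F (osuc x)))" for c x unfolding St_def using FS vF by metis
  have over_att: "oliminf t (\<lambda>b. F b h) (F t h)" if "olim t" "h < m" "h \<notin> over F t" for t h
    using that orun_oliminf[OF that(1), of G v0 h] unfolding over_def F_def by auto
  have over_0: "F t h = 0" if "olim t" "h \<in> over F t" for t h
    using that orun_overflow[OF that(1), of G v0 h] unfolding over_def F_def by auto
  have main: "\<forall>s z e d. s \<le> t \<longrightarrow> (\<forall>t'. s < t' \<longrightarrow> t' \<le> t \<longrightarrow> olim t' \<longrightarrow> over F t' \<subseteq> U) \<longrightarrow>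
     (\<forall>q h. s \<le> q \<longrightarrow> q < t \<longrightarrow> h < m \<longrightarrow> sel z h \<le> F q h) \<longrightarrow> vc e = F s \<longrightarrow> vc d = F t \<longrightarrow> RR n (tri e z d)" for t
  proof (induction t rule: less_induct)
    case (less t)
    show ?case
    proof (intro allI impI)
      fix s z e d
      assume st: "s \<le> t" and ov: "\<forall>t'. s < t' \<longrightarrow> t' \<le> t \<longrightarrow> olim t' \<longrightarrow> over F t' \<subseteq> U"
        and low: "\<forall>q h. s \<le> q \<longrightarrow> q < t \<longrightarrow> h < m \<longrightarrow> sel z h \<le> F q h"
        and e: "vc e = F s" and d: "vc d = F t"
      have dh: "sel d h = F t h" if "h < m" for h using vc_sel[OF that, of d] d by simp
      have IH: "RR n (tri e' z' (code (F u)))" if "u < t" "s \<le> x" "x \<le> u" "vc e' = F x"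
        "\<And>q h. x \<le> q \<Longrightarrow> q < u \<Longrightarrow> h < m \<Longrightarrow> sel z' h \<le> F q h" for e' z' u x
      proof (rule less.IH[OF that(1), rule_format])
        show "over F t' \<subseteq> U" if "x < t'" "t' \<le> u" "olim t'" for t'
          using ov that \<open>u < t\<close> \<open>s \<le> x\<close> by auto
      qed (use that in auto)
      consider "s = t" | "s < t" "t = om0" | p where "s < t" "t = osuc p" | "s < t" "olim t"
        using st om_cases[of t] by (metis order_le_imp_less_or_eq)
      then show "RR n (tri e z d)"
      proof cases
        case 1
        then show ?thesis using RR_refl e d by simp
      next
        case 2
        then show ?thesis using not_less_om0 by blast
      next
        case 3
        have sp: "s \<le> p" using 3 osuc_le[of p s] by (metis not_le)
        have pt: "p < t" using 3 osuc_gt by simp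
        have "RR n (tri e z (code (F p)))" by (rule IH[OF pt order_refl sp e]) (use low pt in auto)
        moreover have "leqv z (code (F p))" unfolding leqv_def using low sp pt by simp
        moreover have "St (code (F p)) d" unfolding St_def using d 3(2) FS by simp
        ultimately show ?thesis by (rule RR_step)
      next
        case 4
        note lim = 4(2)
        have next_lt: "osuc x < t" if "x < t" for x using lim that unfolding olim_def by blast
        have zd: "sel z h \<le> F t h" if hm: "h < m" "h \<notin> over F t" for h
        proof -
          obtain b where "s \<le> b" "b < t" "F b h = F t h"
            using over_att[OF lim hm] 4(1) unfolding oliminf_def by blast
          then show ?thesis using low hm(1) by metis
        qed
        \<comment> \<open>\<open>k\<close> bounds the components of \<open>z\<close>, so the
          approach stays above \<open>z\<close>. It is also positive, so a component kept at or
          above \<open>k\<close> cannot diverge at an intermediate limit, where its value would be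
          0.\<close>
        define k where "k = Suc (\<Sum>h<m. sel z h)"
        have zk: "sel z h \<le> k" if "h < m" for h
          unfolding k_def using member_le_sum[of h "{..<m}" "sel z"] that by (simp add: le_SucI)
        have div: "\<exists>g<t. \<forall>b. g \<le> b \<and> b < t \<longrightarrow> N \<le> F b h" if "h \<in> over F t" for h N
          using oliminf_or_div[OF lim, of "\<lambda>b. F b h" N] that unfolding over_def by blast
        have tail: "\<exists>g. x \<le> g \<and> g < t \<and> (\<forall>b h. g \<le> b \<longrightarrow> b < t \<longrightarrow> h < m \<longrightarrow>
            (if h \<in> over F t then N else F t h) \<le> F b h)" if "x < t" for x N
        proof (rule finite_tail[OF lim that])
          fix h assume "h < m"
          then show "\<exists>g<t. \<forall>b. g \<le> b \<and> b < t \<longrightarrow> (if h \<in> over F t then N else F t h) \<le> F b h"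
            using div[of h N] over_att[OF lim] unfolding oliminf_def by (cases "h \<in> over F t") auto
        qed
        obtain g where g: "s \<le> g" "g < t" "\<And>b h. g \<le> b \<Longrightarrow> b < t \<Longrightarrow> h < m \<Longrightarrow>
            (if h \<in> over F t then k else F t h) \<le> F b h"
          using tail[OF 4(1), of k] by blast
        have tg: "RR n (tri e z (code (F g)))" by (rule IH[OF g(2) order_refl g(1) e]) (use low g(2) in auto)
        show ?thesis
        proof (cases "over F t = {}")
          case True
          have "RR n (chain (code (F x)) d i j)" if "g \<le> x" "x < t" for x i j
            using that
          proof (induction j arbitrary: x i)
            case 0
            show ?case by (rule RR_chain_0)
          next
            case (Suc j)
            let ?h = "fst (prod_decode i)"
            obtain y where y: "osuc x \<le> y" "y < t" "?h < m \<longrightarrow> F y ?h = F t ?h"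
            proof (cases "?h < m")
              case m: True
              then show ?thesis
                using that over_att[OF lim m] True next_lt[OF Suc.prems(2)] unfolding oliminf_def by blast
            next
              case False
              then show ?thesis using that[of "osuc x"] next_lt[OF Suc.prems(2)] by simp
            qed
            have gx: "g \<le> osuc x" "g \<le> y" using Suc.prems(1) osuc_gt[of x] y(1) by auto
            have "RR n (tri (code (F (osuc x))) d (code (F y)))"
              by (rule IH[OF y(2) _ y(1)]) (use gx g True dh y(2) in \<open>auto intro: order_trans less_trans\<close>)
            moreover have "RR n (chain (code (F y)) d (Suc i) j)" using Suc.IH gx(2) y(2) by blast
            moreover have "leqv d (code (F x))" unfolding leqv_def using g(3)[of x] Suc.prems True dh by simp
            moreover have "St (code (F x)) (code (F (osuc x)))" by (rule St_F) simp
            ultimately show ?case by (rule RR_chain_Suc) (use y(3) dh in simp)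
          qed
          then have "RR n (lims (code (F g)) d)" using RR_lims g(2) by blast
          then show ?thesis by (rule RR_lim[OF tg]) (use zd True dh in \<open>simp add: leqv_def\<close>)
        next
          case False
          let ?O = "over F t"
          have OU: "?O \<subseteq> U" using ov 4(1) lim by blast
          then have cU: "card (U - ?O) < card U" using False n.prems(1) by (intro psubset_card_mono) auto
          then obtain n' where n': "n = Suc n'" using n.prems(2) by (cases n) auto
          have cU': "card (U - ?O) \<le> n'" using cU n.prems(2) n' by simp
          define p where "p = code (\<lambda>h. if h \<in> ?O then 1 else 0)"
          have p: "sel p h = (if h \<in> ?O then 1 else 0)" if "h < m" for h unfolding p_def using that by simp
          \<comment> \<open>The infinite chain of links is not constructed. Instead no
            \<open>fin\<close> statement about a late time \<open>x\<close> of the approach is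
            derivable: a later time \<open>y\<close> that closes a link refutes it, by the induction
            hypothesis for \<open>y\<close>.\<close>
          have "ind (Mfin (RR n')) S \<Longrightarrow> \<forall>x i. S = fin (code (F x)) d p i \<longrightarrow> g \<le> x \<longrightarrow> x < t \<longrightarrow> k \<le> i \<longrightarrow>
              (\<forall>b h. x \<le> b \<longrightarrow> b < t \<longrightarrow> h \<in> ?O \<longrightarrow> i \<le> F b h) \<longrightarrow> False" for S
          proof (induction rule: ind.induct)
            case (indI S)
            show ?case
            proof (intro allI impI)
              fix x i assume S: "S = fin (code (F x)) d p i" and x: "g \<le> x" "x < t" and ki: "k \<le> i"
                and xi: "\<forall>b h. x \<le> b \<longrightarrow> b < t \<longrightarrow> h \<in> ?O \<longrightarrow> i \<le> F b h"
              let ?h = "fst (prod_decode i)"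
              obtain y1 where y1: "osuc x \<le> y1" "y1 < t" "\<And>b h. y1 \<le> b \<Longrightarrow> b < t \<Longrightarrow> h < m \<Longrightarrow>
                (if h \<in> ?O then Suc i else F t h) \<le> F b h" using tail[OF next_lt[OF x(2)], of "Suc i"] by blast
              obtain y where y: "y1 \<le> y" "y < t" "?h < m \<and> ?h \<notin> ?O \<longrightarrow> F y ?h = F t ?h"
              proof (cases "?h < m \<and> ?h \<notin> ?O")
                case True
                then show ?thesis using that over_att[OF lim] y1(2) unfolding oliminf_def by blast
              next
                case False
                then show ?thesis using that[of y1] y1(2) by blast
              qed
              have xy: "x < osuc x" "osuc x \<le> y" using osuc_gt y1(1) y(1) by auto
              define zz where "zz = code (\<lambda>h. if h \<in> ?O then i else F t h)"
              have zz: "sel zz h = (if sel p h = 0 then sel d h else i)" if "h < m" for h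
                unfolding zz_def using that p dh by simp
              have Fzz: "sel zz h \<le> F b h" if "x \<le> b" "b < t" "h < m" for b h
                unfolding zz_def using that xi g(3)[of b h] x(1) by (auto split: if_splits)
              have "RR n' (tri (code (F (osuc x))) zz (code (F y)))"
              proof (rule n.IH[of n' "U - ?O"])
                show "n' < n" using n' by simp
                show "finite (U - ?O)" using n.prems(1) by simp
                show "card (U - ?O) \<le> n'" by (rule cU')
                show "osuc x \<le> y" by (rule xy)
                show "sel zz h \<le> orun G v0 q h" if "osuc x \<le> q" "q < y" "h < m" for q h
                  using Fzz[of q h] that xy y(2) unfolding F_def by auto
                show "over (orun G v0) t' \<subseteq> U - ?O" if t': "osuc x < t'" "t' \<le> y" "olim t'" for t'
                proof -
                  have tt: "s < t'" "t' \<le> t" "x \<le> t'" "t' < t" using t' xy g(1) x(1) y(2) by auto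
                  have "h \<notin> ?O" if "h \<in> over F t'" for h
                  proof
                    assume "h \<in> ?O"
                    then have "i \<le> F t' h" using xi tt by blast
                    then show False using over_0[OF t'(3) that] ki unfolding k_def by simp
                  qed
                  then show ?thesis using ov tt t'(3) unfolding F_def by blast
                qed
              qed (simp_all add: F_def[symmetric])
              then have lnk: "link (RR n') (code (F x)) d p i (code (F y))"
                unfolding link_def leqv_def
                using St_F[of "code (F x)" x] zz Fzz[of x] x(2) y(3) dh p
                by (intro exI[of _ "code (F (osuc x))"] exI[of _ zz]) auto
              from indI[of "code (F y)"] obtain b where b: "Mfin (RR n') S (code (F y)) b" "\<forall>t'\<in>set (list_decode b).
                  ind (Mfin (RR n')) t' \<and> (\<forall>x i. t' = fin (code (F x)) d p i \<longrightarrow> g \<le> x \<longrightarrow> x < t \<longrightarrow> k \<le> i \<longrightarrow>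
                  (\<forall>b h. x \<le> b \<longrightarrow> b < t \<longrightarrow> h \<in> ?O \<longrightarrow> i \<le> F b h) \<longrightarrow> False)"
                by (elim exE conjE) (rule that; assumption)
              obtain c0 d0 p0 i0 where cd: "S = fin c0 d0 p0 i0" "if link (RR n') c0 d0 p0 i0 (code (F y))
                  then b = list_encode [fin (code (F y)) d0 p0 (Suc i0)] else b = list_encode []"
                using b(1) unfolding Mfin_def by blast
              have "fin (code (F x)) d p i = fin c0 d0 p0 i0" by (rule trans[OF S[symmetric] cd(1)])
              then have "c0 = code (F x)" "d0 = d" "p0 = p" "i0 = i" by (simp_all only: list_encode_eq list.inject)
              then have "b = list_encode [fin (code (F y)) d p (Suc i)]"
                using cd(2) lnk by (simp only: if_True)
              then have mem: "fin (code (F y)) d p (Suc i) \<in> set (list_decode b)" by simp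
              have "g \<le> y" using x(1) xy by auto
              moreover have "\<forall>b h. y \<le> b \<longrightarrow> b < t \<longrightarrow> h \<in> ?O \<longrightarrow> Suc i \<le> F b h"
              proof (intro allI impI)
                fix b h assume "y \<le> b" "b < t" "h \<in> ?O"
                then show "Suc i \<le> F b h" using y1(3)[of b h] y(1) unfolding over_def by auto
              qed
              ultimately show False
                using b(2)[THEN bspec, OF mem, THEN conjunct2, THEN spec[of _ y], THEN spec[of _ "Suc i"]] y(2) ki by simp
            qed
          qed
          moreover have "\<forall>b h. g \<le> b \<longrightarrow> b < t \<longrightarrow> h \<in> ?O \<longrightarrow> k \<le> F b h"
          proof (intro allI impI)
            fix b h assume "g \<le> b" "b < t" "h \<in> ?O"
            then show "k \<le> F b h" using g(3)[of b h] unfolding over_def by auto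
          qed
          ultimately have "\<not> ind (Mfin (RR n')) (fin (code (F g)) d p k)" using g(2) by blast
          then have "LL (RR n') (code (F g)) d p k"
            unfolding LL_def using p dh over_0[OF lim] by (auto split: if_splits)
          then show ?thesis unfolding n'
            by (rule RR_over[OF tg[unfolded n']]) (use p zk zd dh in auto)
        qed
      qed
    qed
  qed
  show ?case by (rule main[rule_format, unfolded F_def]) (use n.prems in blast)+
qed

text \<open>At most all \<open>m\<close> components diverge, so level \<open>m\<close> suffices. The
  code 0 serves as the trivial lower bound.\<close>

theorem reach_iff_RR:
  assumes "supp (vc e)"
  shows "(\<exists>V. trun G (vc e) V (vc d)) \<longleftrightarrow> RR m (tri e 0 d)"
proof
  assume "\<exists>V. trun G (vc e) V (vc d)"
  then obtain t where t: "orun G (vc e) t = vc d" unfolding trun_iff by blast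
  show "RR m (tri e 0 d)"
    by (rule RR_complete[OF assms, of "{..<m}" m om0 t]) (use t in \<open>auto simp: over_def sel_def\<close>)
next
  assume "RR m (tri e 0 d)"
  then show "\<exists>V. trun G (vc e) V (vc d)" using RR_sound unfolding Good_def by blast
qed

end

section \<open>Halting is forced\<close>

lemma fp_rel4: "fp (\<lambda>w e. A w (e 0) (e (Suc 0)) (e (Suc (Suc 0))) (e (Suc (Suc (Suc 0))))) \<Longrightarrow>
    cf (\<lambda>w e. x e) \<Longrightarrow> cf (\<lambda>w e. y e) \<Longrightarrow> cf (\<lambda>w e. z e) \<Longrightarrow> cf (\<lambda>w e. u e) \<Longrightarrow> fp (\<lambda>w e. A w (x e) (y e) (z e) (u e))"
  by (rule fp_cong[OF fp_subst[of _ "\<lambda>e. case_nat (x e) (case_nat (y e) (case_nat (z e) (case_nat (u e) e)))"]]) (auto intro!: cfi)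

text \<open>The dimension \<open>m\<close>, and with it the depth of nesting, is the same for all
  reals \<open>w\<close>. Finitely many applications of \<open>fp_ind\<close> therefore treat all of
  them uniformly.\<close>

locale fp_system =
  fixes m :: nat and G :: "nat set \<Rightarrow> vec \<Rightarrow> vec"
  assumes sys: "\<And>w. fin_system m (G w)"
    and fp_St0: "fp (\<lambda>w e. fin_system.St m (G w) (e 0) (e (Suc 0)))"
begin

lemma fp_St: "cf (\<lambda>w e. x e) \<Longrightarrow> cf (\<lambda>w e. y e) \<Longrightarrow> fp (\<lambda>w e. fin_system.St m (G w) (x e) (y e))"
  by (rule fp_rel2[OF fp_St0])

lemma fp_Mst:
  assumes L: "fp (\<lambda>w e. L w (e 0) (e (Suc 0)) (e (Suc (Suc 0))) (e (Suc (Suc (Suc 0)))))"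
  shows "fp (\<lambda>w e. fin_system.Mst m (G w) (L w) (e (Suc (Suc 0))) (e (Suc 0)) (e 0))"
  unfolding fin_system.Mst_def[OF sys] fin_system.leqv_def[OF sys] fin_system.eqv_def[OF sys]
  by (intro fpi fp_St fp_rel4[OF L] cfi)

lemma fp_Mfin:
  assumes R: "fp (\<lambda>w e. R w (e 0))"
  shows "fp (\<lambda>w e. fin_system.Mfin m (G w) (R w) (e (Suc (Suc 0))) (e (Suc 0)) (e 0))"
  unfolding fin_system.Mfin_def[OF sys] fin_system.link_def[OF sys] fin_system.leqv_def[OF sys]
  by (intro fpi fp_St fp_rel1[OF R] cfi)

lemma fp_LL:
  assumes R: "fp (\<lambda>w e. R w (e 0))"
  shows "fp (\<lambda>w e. fin_system.LL m (G w) (R w) (e 0) (e (Suc 0)) (e (Suc (Suc 0))) (e (Suc (Suc (Suc 0)))))"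
  unfolding fin_system.LL_def[OF sys]
  by (intro fp_conj fp_not fp_ind[of "\<lambda>w e. fin_system.Mfin m (G w) (R w)"] fp_Mfin[OF R]) (intro fpi cfi)+

lemma fp_RR: "fp (\<lambda>w e. fin_system.RR m (G w) n (e 0))"
proof (induction n)
  case 0
  have "fp (\<lambda>w e. fin_system.Mst m (G w) (\<lambda>c d p k. False) (e (Suc (Suc 0))) (e (Suc 0)) (e 0))"
    by (rule fp_Mst) (intro fpi cfi)
  then show ?case unfolding fin_system.RR.simps[OF sys]
    by (rule fp_ind[of "\<lambda>w e. fin_system.Mst m (G w) (\<lambda>c d p k. False)"]) (intro cfi)
next
  case (Suc n)
  have "fp (\<lambda>w e. fin_system.Mst m (G w) (fin_system.LL m (G w) (fin_system.RR m (G w) n)) (e (Suc (Suc 0))) (e (Suc 0)) (e 0))"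
    by (rule fp_Mst) (rule fp_LL[OF Suc])
  then show ?case unfolding fin_system.RR.simps[OF sys]
    by (rule fp_ind[of "\<lambda>w e. fin_system.Mst m (G w) (fin_system.LL m (G w) (fin_system.RR m (G w) n))"]) (intro cfi)
qed

lemma fp_reach:
  assumes "cf (\<lambda>w e. x e)" "cf (\<lambda>w e. y e)"
  shows "fp (\<lambda>w e. \<exists>V. trun (G w) (fin_system.vc m (x e)) V (fin_system.vc m (y e)))"
  unfolding fin_system.reach_iff_RR[OF sys fin_system.supp_vc[OF sys]]
  by (rule fp_rel1[OF fp_RR]) (intro cfi assms)

end

text \<open>\<open>exec\<close> by components, with the shift of \<open>vec\<close>, in a form to
  which the closure rules for \<open>fp\<close> apply instruction by instruction.\<close>

fun nxt :: "nat set \<Rightarrow> instr \<Rightarrow> vec \<Rightarrow> vec" where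
  "nxt X (Zero n) v h = (if h = 0 then Suc (v 0) else if h = Suc n then 0 else v h)"
| "nxt X (Inc n) v h = (if h = 0 then Suc (v 0) else if h = Suc n then Suc (v (Suc n)) else v h)"
| "nxt X (Copy i j) v h = (if h = 0 then Suc (v 0) else if h = Suc j then v (Suc i) else v h)"
| "nxt X (JumpEq i j k) v h = (if h = 0 then if v (Suc i) = v (Suc j) then k else Suc (v 0) else v h)"
| "nxt X (OracleJump i k) v h = (if h = 0 then if v (Suc i) \<in> X then k else Suc (v 0) else v h)"

lemma vstep_nxt: "v 0 < length Q \<Longrightarrow> vstep Q X v = nxt X (Q ! v 0) v"
proof -
  assume "v 0 < length Q"
  then have "vstep Q X v = vec (exec X (Q ! v 0) (v 0, \<lambda>i. v (Suc i)))"
    using vstep_exec[of "v 0" Q X "\<lambda>i. v (Suc i)"] cfg_eta[of v] by simp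
  also have "\<dots> = nxt X (Q ! v 0) v"
    by (cases "Q ! v 0") (auto simp: vec_def fun_eq_iff split: nat.splits)
  finally show ?thesis .
qed

lemma nxt_supp: "ibd I \<le> N \<Longrightarrow> \<forall>i\<ge>Suc N. v i = 0 \<Longrightarrow> \<forall>i\<ge>Suc N. nxt X I v i = 0"
  by (cases I) auto

lemma nxt_cong: "ibd I \<le> N \<Longrightarrow> (\<And>i. i < Suc N \<Longrightarrow> v i = u i) \<Longrightarrow> h < Suc N \<Longrightarrow> nxt X I v h = nxt X I u h"
  by (cases I) auto

lemma fp_ex_less:
  fixes n :: nat
  assumes "\<And>l. l < n \<Longrightarrow> fp (A l)" shows "fp (\<lambda>w e. \<exists>l<n. A l w e)"
  using assms
proof (induction n)
  case 0
  then show ?case by simp (intro fpi cfi)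
next
  case (Suc n)
  have "fp (\<lambda>w e. A n w e \<or> (\<exists>l<n. A l w e))" by (intro fp_disj Suc.IH Suc.prems) simp_all
  then show ?case by (rule fp_cong) (auto simp: less_Suc_eq)
qed

lemma fp_nxt:
  assumes z: "fp (\<lambda>w e. e 0 \<in> z w)"
  shows "fp (\<lambda>w e. \<forall>h. h < m \<longrightarrow> sel (e (Suc 0)) h = nxt (z w) I (sel (e 0)) h)"
proof (cases I)
  case (OracleJump i k)
  have "fp (\<lambda>w e. if sel (e 0) (Suc i) \<in> z w
     then \<forall>h. h < m \<longrightarrow> sel (e (Suc 0)) h = (if h = 0 then k else sel (e 0) h)
     else \<forall>h. h < m \<longrightarrow> sel (e (Suc 0)) h = (if h = 0 then Suc (sel (e 0) 0) else sel (e 0) h))"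
    by (intro fp_if fp_rel1[OF z] fpi cfi)
  then show ?thesis by (rule fp_cong) (simp add: OracleJump)
qed (simp_all only: nxt.simps, (intro fpi cfi)+)

text \<open>The oracle may itself be a real \<open>z w\<close> with a forced membership predicate.
  This allows running a decision procedure on the output of a reduction.\<close>

theorem fp_itrm_comp:
  assumes z: "fp (\<lambda>w e. e 0 \<in> z w)"
  shows "fp (\<lambda>w e. itrm_comp Q (z w) (e 0) (e (Suc 0)))"
proof -
  obtain N where N: "0 < N" "regs_below N Q" using ex_common_bound[of 0 1 "\<lambda>_. Q"] by auto
  define m where "m = Suc N"
  have I: "ibd (Q ! l) \<le> N" if "l < length Q" for l using N(2) that unfolding regs_below_def by auto
  have sysX: "fin_system m (vstep Q X)" for X
  proof (rule fin_system.intro)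
    fix v :: vec assume v: "\<forall>i\<ge>m. v i = 0"
    show "\<forall>i\<ge>m. vstep Q X v i = 0"
      using v nxt_supp[OF I, of "v 0" v X] vstep_nxt[of v Q X] vstep_halt[of Q v X] unfolding m_def
      by (cases "v 0 < length Q") auto
  qed
  have St: "fin_system.St m (vstep Q X) c d \<longleftrightarrow> (if length Q \<le> sel c 0 then \<forall>h. h < m \<longrightarrow> sel c h = sel d h
     else \<exists>l<length Q. sel c 0 = l \<and> (\<forall>h. h < m \<longrightarrow> sel d h = nxt X (Q ! l) (sel c) h))" for X c d
  proof -
    interpret fin_system m "vstep Q X" by (rule sysX)
    have c0: "vc c 0 = sel c 0" by (rule vc_sel) (simp add: m_def)
    have "St c d \<longleftrightarrow> (\<forall>h. h < m \<longrightarrow> sel d h = vstep Q X (vc c) h)"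
    proof
      assume "St c d"
      then show "\<forall>h. h < m \<longrightarrow> sel d h = vstep Q X (vc c) h" unfolding St_def using vc_sel by metis
    next
      assume h: "\<forall>h. h < m \<longrightarrow> sel d h = vstep Q X (vc c) h"
      have "\<forall>h\<ge>m. vstep Q X (vc c) h = 0" by (rule supp_G) (simp add: vc_def)
      then show "St c d" unfolding St_def using h by (auto simp: fun_eq_iff vc_def not_less)
    qed
    also have "\<dots> \<longleftrightarrow> (if length Q \<le> sel c 0 then \<forall>h. h < m \<longrightarrow> sel c h = sel d h
     else \<exists>l<length Q. sel c 0 = l \<and> (\<forall>h. h < m \<longrightarrow> sel d h = nxt X (Q ! l) (sel c) h))"
    proof (cases "length Q \<le> sel c 0")
      case True
      then show ?thesis using vstep_halt[of Q "vc c" X] c0 vc_sel by auto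
    next
      case False
      then have l: "sel c 0 < length Q" by simp
      have "nxt X (Q ! sel c 0) (vc c) h = nxt X (Q ! sel c 0) (sel c) h" if "h < m" for h
        by (rule nxt_cong[OF I[OF l]]) (use that vc_sel in \<open>auto simp: m_def\<close>)
      then show ?thesis using vstep_nxt[of "vc c" Q X] c0 l by auto
    qed
    finally show ?thesis .
  qed
  interpret fp_system m "\<lambda>w. vstep Q (z w)"
  proof (rule fp_system.intro)
    show "fin_system m (vstep Q (z w))" for w by (rule sysX)
    show "fp (\<lambda>w e. fin_system.St m (vstep Q (z w)) (e 0) (e (Suc 0)))"
      unfolding St
    proof (rule fp_if)
      show "fp (\<lambda>w e. \<exists>l<length Q. sel (e 0) 0 = l \<and> (\<forall>h. h < m \<longrightarrow> sel (e (Suc 0)) h = nxt (z w) (Q ! l) (sel (e 0)) h))"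
      proof (rule fp_ex_less, rule fp_conj)
        fix l show "fp (\<lambda>w e. sel (e 0) 0 = l)" by (intro fpi cfi)
      qed (rule fp_nxt[OF z])
    qed (intro fpi cfi)+
  qed
  have "itrm_comp Q X i j \<longleftrightarrow> (\<exists>d. (\<exists>V. trun (vstep Q X) (fin_system.vc m (list_encode [0, i])) V (fin_system.vc m d)) \<and>
      length Q \<le> sel d 0 \<and> sel d (Suc 0) = j)" for X i j
  proof -
    interpret fin_system m "vstep Q X" by (rule sysX)
    have m: "0 < m" "Suc 0 < m" using N(1) unfolding m_def by auto
    have ini: "vec (init_config i) = vc (list_encode [0, i])"
    proof
      fix h show "vec (init_config i) h = vc (list_encode [0, i]) h"
        using m unfolding vec_def init_config_def vc_def
        by (cases h; cases "h - 1") (auto simp: sel_encode simp del: list_encode.simps)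
    qed
    show ?thesis
    proof
      assume "itrm_comp Q X i j"
      then obtain V d where d: "trun (vstep Q X) (vc (list_encode [0, i])) V d" "length Q \<le> d 0" "d (Suc 0) = j"
        unfolding itrm_comp_def halts_with_iff ini by blast
      have "supp d" using supp_trun[OF d(1)] by simp
      then have "vc (code d) = d" by (rule vc_code)
      then show "\<exists>d. (\<exists>V. trun (vstep Q X) (vc (list_encode [0, i])) V (vc d)) \<and> length Q \<le> sel d 0 \<and> sel d (Suc 0) = j"
        using d m by (intro exI[of _ "code d"]) (auto simp del: list_encode.simps)
    next
      assume "\<exists>d. (\<exists>V. trun (vstep Q X) (vc (list_encode [0, i])) V (vc d)) \<and> length Q \<le> sel d 0 \<and> sel d (Suc 0) = j"
      then obtain V d where "trun (vstep Q X) (vc (list_encode [0, i])) V (vc d)" "length Q \<le> sel d 0" "sel d (Suc 0) = j"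
        by blast
      then show "itrm_comp Q X i j" unfolding itrm_comp_def halts_with_iff ini
        using m by (intro exI[of _ V] exI[of _ "vc d"]) (simp add: vc_sel del: list_encode.simps)
    qed
  qed
  moreover have "fp (\<lambda>w e. \<exists>d. (\<exists>V. trun (vstep Q (z w)) (fin_system.vc m (list_encode [0, e 0])) V (fin_system.vc m d)) \<and>
      length Q \<le> sel d 0 \<and> sel d (Suc 0) = e (Suc 0))"
    by (intro fp_ex fp_conj fp_reach; (intro fpi cfi)?)
  ultimately show ?thesis by simp
qed

lemma itrm_comp_unique: "itrm_comp P w k i \<Longrightarrow> itrm_comp P w k j \<Longrightarrow> i = j"
proof -
  assume i: "itrm_comp P w k i" and j: "itrm_comp P w k j"
  obtain V d where d: "trun (vstep P w) (vec (init_config k)) V d" "length P \<le> d 0" "d (Suc 0) = i"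
    using i unfolding itrm_comp_def halts_with_iff by blast
  obtain W e where e: "trun (vstep P w) (vec (init_config k)) W e" "length P \<le> e 0" "e (Suc 0) = j"
    using j unfolding itrm_comp_def halts_with_iff by blast
  show ?thesis using trun_unique[OF d(1) e(1)] vstep_halt d e by auto
qed

section \<open>Reals computable from random reals\<close>

lemma random_name:
  assumes "\<And>s t e. ext s t \<Longrightarrow> J e s \<Longrightarrow> J e t" "\<And>w e. itrm_c_random w \<Longrightarrow> A w e \<longleftrightarrow> (\<exists>k. J e (res w k))"
    and "itrm_c_random w" "inc s w" "J e s"
  shows "A w e"
  using assms inc_ext_res[OF assms(4) order_refl] by blast

text \<open>The inputs \<open>2 * i\<close> are those at which the doubled copy of \<open>y\<close>
  codes \<open>y\<close>. If the values were computable, some segment of \<open>y\<close> would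
  force the generic real to agree with them, leaving \<open>y\<close> as the only random real in its
  cone. This cone would be meager and decidable and contain \<open>y\<close>.\<close>

lemma random_not_computable:
  assumes y: "itrm_c_random y"
  shows "\<not> (\<exists>P. \<forall>i. itrm_comp P {} (2 * i) (if i \<in> y then 1 else 0))"
proof
  assume "\<exists>P. \<forall>i. itrm_comp P {} (2 * i) (if i \<in> y then 1 else 0)"
  then obtain P where P: "\<And>i. itrm_comp P {} (2 * i) (if i \<in> y then 1 else 0)" by blast
  have y_iff: "itrm_comp P {} (2 * i) 1 \<longleftrightarrow> i \<in> y" for i
    using P[of i] itrm_comp_unique[of P "{}" "2 * i" 0 1] by (auto split: if_splits)
  have e0: "fp (\<lambda>w e. e 0 \<in> {})" unfolding empty_iff by (intro fpi cfi)
  have "fp (\<lambda>w e. itrm_comp P {} (2 * e 0) 1)"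
    by (rule fp_rel2[of "\<lambda>w. itrm_comp P {}", OF fp_itrm_comp[OF e0]]) (intro cfi)+
  then have "fp (\<lambda>w e. \<forall>i. itrm_comp P {} (2 * i) 1 = (i \<in> w))"
    by (intro fp_all fp_iff fp_mem cf_var)
  then obtain J :: "(nat \<Rightarrow> nat) \<Rightarrow> nat \<Rightarrow> bool" where J: "\<And>s t e. ext s t \<Longrightarrow> J e s \<Longrightarrow> J e t"
    "\<And>w e. itrm_c_random w \<Longrightarrow> (\<forall>i. itrm_comp P {} (2 * i) 1 = (i \<in> w)) \<longleftrightarrow> (\<exists>k. J e (res w k))"
    unfolding fp_def fname_def by blast
  obtain k where k: "J (\<lambda>_. 0) (res y k)" using J(2)[OF y] y_iff by blast
  have only: "w = y" if "itrm_c_random w" "inc (res y k) w" for w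
    using random_name[of J "\<lambda>w e. \<forall>i. itrm_comp P {} (2 * i) 1 = (i \<in> w)", OF J that k] y_iff by auto
  have "nowhere_dense {y}"
  proof (rule nowhere_denseI)
    fix s
    define w where "w = (if lenc s \<in> y then {i. sel s i \<noteq> 0} - {lenc s} else insert (lenc s) {i. sel s i \<noteq> 0})"
    have "inc s w" unfolding w_def inc_def by auto
    then have "ext s (res w (Suc (lenc s)))" by (rule inc_ext_res) simp
    moreover have "v \<noteq> y" if "inc (res w (Suc (lenc s))) v" for v
    proof -
      have "lenc s \<in> v \<longleftrightarrow> lenc s \<in> w" using that unfolding inc_def by auto
      then show ?thesis unfolding w_def by (auto split: if_splits)
    qed
    ultimately show "\<exists>t. ext s t \<and> (\<forall>w. inc t w \<longrightarrow> w \<notin> {y})" by blast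
  qed
  then have "meager ({w. \<not> itrm_c_random w} \<union> {y})" using meager_Un meager_non_random nowhere_dense_meager by blast
  then have "meager {w. inc (res y k) w}" by (rule meager_subset) (use only in auto)
  moreover have "cp (\<lambda>w e. inc (res y k) w)" by (intro cfi)
  ultimately show False using random_avoid[OF y, of "\<lambda>w e. inc (res y k) w"] by simp
qed

lemma even_part_not_random: "x \<subseteq> {n. even n} \<Longrightarrow> \<not> itrm_c_random x"
proof
  assume x: "x \<subseteq> {n. even n}" and r: "itrm_c_random x"
  have "nowhere_dense {w. \<forall>n. Suc (2 * n) \<notin> w}"
  proof (rule nowhere_denseI)
    fix s
    define w where "w = {i. i < lenc s \<and> sel s i \<noteq> 0} \<union> {Suc (2 * lenc s)}"
    have "inc s w" unfolding w_def inc_def by auto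
    then have "ext s (res w (Suc (Suc (2 * lenc s))))" by (rule inc_ext_res) simp
    moreover have "Suc (2 * lenc s) \<in> v" if "inc (res w (Suc (Suc (2 * lenc s)))) v" for v
      using that unfolding inc_def w_def by auto
    ultimately show "\<exists>t. ext s t \<and> (\<forall>w. inc t w \<longrightarrow> w \<notin> {w. \<forall>n. Suc (2 * n) \<notin> w})" by blast
  qed
  moreover have "cp (\<lambda>w e. \<forall>n. Suc (2 * n) \<notin> w)" by (intro cfi)
  ultimately have "\<not> (\<forall>n. Suc (2 * n) \<notin> x)"
    using random_avoid[OF r, of "\<lambda>w e. \<forall>n. Suc (2 * n) \<notin> w"] nowhere_dense_meager by simp
  then show False using x by auto
qed

lemma random_part1:
  assumes y: "itrm_c_random y"
  shows "\<exists>x. itrm_reducible x y \<and> \<not> itrm_c_random x \<and> \<not> itrm_computable x"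
proof (intro exI[of _ "(*) 2 ` y"] conjI)
  have "cf (\<lambda>w e. if \<exists>n. e 0 = 2 * n \<and> n \<in> w then 1 else 0)" by (intro cfi)
  from cf_itrm_comp[OF this] obtain P where
    "\<And>w i. itrm_comp P w i (if \<exists>n. i = 2 * n \<and> n \<in> w then 1 else 0)" by auto
  moreover have "i \<in> (*) 2 ` y \<longleftrightarrow> (\<exists>n. i = 2 * n \<and> n \<in> y)" for i by auto
  ultimately have "\<forall>i. itrm_comp P y i (if i \<in> (*) 2 ` y then 1 else 0)" by presburger
  then show "itrm_reducible ((*) 2 ` y) y" unfolding itrm_reducible_def by blast
  show "\<not> itrm_c_random ((*) 2 ` y)" by (rule even_part_not_random) auto
  have "2 * i \<in> (*) 2 ` y \<longleftrightarrow> i \<in> y" for i by auto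
  then show "\<not> itrm_computable ((*) 2 ` y)"
    using random_not_computable[OF y] unfolding itrm_computable_def itrm_reducible_def by metis
qed

lemma random_part2:
  assumes y: "itrm_c_random y" and xy: "itrm_reducible x y" and xS: "x \<in> S"
    and S: "countable S" "itrm_decidable S"
  shows "itrm_computable x"
proof -
  obtain P where P: "\<And>i. itrm_comp P y i (if i \<in> x then 1 else 0)" using xy unfolding itrm_reducible_def by blast
  obtain Q where Q: "\<And>w. w \<in> S \<Longrightarrow> itrm_comp Q w 0 1" "\<And>w. w \<notin> S \<Longrightarrow> itrm_comp Q w 0 0"
    using S(2) unfolding itrm_decidable_def itrm_comp0_def itrm_comp_def by blast
  define z where "z w = {i. itrm_comp P w i 1}" for w
  have "itrm_comp P y i 1 \<longleftrightarrow> i \<in> x" for i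
    using P[of i] itrm_comp_unique[of P y i 0 1] by (auto split: if_splits)
  then have zy: "z y = x" unfolding z_def by simp
  have w0: "fp (\<lambda>w e. e 0 \<in> w)" by (rule fp_mem) (rule cf_var)
  have "fp (\<lambda>w e. itrm_comp P w (e 0) 1)"
    by (rule fp_rel2[of "itrm_comp P", OF fp_itrm_comp[OF w0]]) (intro cfi)+
  then have fz: "fp (\<lambda>w e. e 0 \<in> z w)" unfolding z_def mem_Collect_eq .
  have "fp (\<lambda>w e. itrm_comp Q (z w) 0 1)"
    by (rule fp_rel2[of "\<lambda>w. itrm_comp Q (z w)", OF fp_itrm_comp[OF fz]]) (intro cfi)+
  then obtain JA :: "(nat \<Rightarrow> nat) \<Rightarrow> nat \<Rightarrow> bool" where JA: "\<And>s t e. ext s t \<Longrightarrow> JA e s \<Longrightarrow> JA e t"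
    "\<And>w e. itrm_c_random w \<Longrightarrow> itrm_comp Q (z w) 0 1 \<longleftrightarrow> (\<exists>k. JA e (res w k))"
    unfolding fp_def fname_def by blast
  obtain Jz :: "(nat \<Rightarrow> nat) \<Rightarrow> nat \<Rightarrow> bool" where Jz: "\<And>t a. (\<And>i. cf (\<lambda>w e. t w e i)) \<Longrightarrow> cf a \<Longrightarrow> cp (\<lambda>w e. Jz (t w e) (a w e))"
    "\<And>s t e. ext s t \<Longrightarrow> Jz e s \<Longrightarrow> Jz e t"
    "\<And>w e. itrm_c_random w \<Longrightarrow> e 0 \<in> z w \<longleftrightarrow> (\<exists>k. Jz e (res w k))"
    using fp_name[OF fz] by blast
  define I where "I i s = Jz (case_nat i (\<lambda>_. 0)) s" for i s
  have Ic: "cp (\<lambda>w e. I (a w e) (b w e))" if "cf a" "cf b" for a b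
    unfolding I_def by (intro Jz(1) cfi that)
  have Im: "I i t" if "ext s t" "I i s" for i s t using that Jz(2) unfolding I_def by blast
  have It: "i \<in> z w \<longleftrightarrow> (\<exists>k. I i (res w k))" if "itrm_c_random w" for w i
    using Jz(3)[OF that, of "case_nat i (\<lambda>_. 0)"] unfolding I_def by simp
  have I_inc: "i \<in> z w" if "itrm_c_random w" "inc s w" "I i s" for w s i
    using It[OF that(1)] Im[OF inc_ext_res[OF that(2) order_refl] that(3)] by blast
  define No where "No i s \<longleftrightarrow> (\<forall>t. ext s t \<longrightarrow> \<not> I i t)" for i s
  have No_inc: "i \<notin> z w" if w: "itrm_c_random w" and "inc s w" "No i s" for w s i
  proof
    assume "i \<in> z w"
    then obtain k where "I i (res w k)" using It[OF w] by blast
    then have "I i (res w (max k (lenc s)))" by (rule Im[rotated]) simp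
    moreover have "ext s (res w (max k (lenc s)))" using inc_ext_res[OF that(2)] by simp
    ultimately show False using that(3) unfolding No_def by blast
  qed
  have No_ex: "\<exists>k. No i (res w k)" if w: "itrm_c_random w" and ni: "i \<notin> z w" for w i
  proof -
    let ?D = "\<lambda>e s. I (e 0) s \<or> (\<forall>t. ext s t \<longrightarrow> \<not> I (e 0) t)"
    have "\<exists>k\<ge>lenc 0. ?D (\<lambda>_. i) (res w k)"
    proof (rule random_dense[OF w, of 0 ?D])
      show "inc 0 w" by (simp add: inc_def lenc_def)
      show "cp (\<lambda>w e. ?D (\<lambda>i. e (Suc i)) (e 0))" by (intro cfi Ic)
      show "?D (\<lambda>_. i) t" if "ext s t" "?D (\<lambda>_. i) s" for s t using that Im ext_trans by blast
      show "\<exists>u. ext t u \<and> ?D (\<lambda>_. i) u" for t using ext_refl by blast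
    qed
    then show ?thesis using ni It[OF w] unfolding No_def by blast
  qed
  obtain k0 where k0: "JA (\<lambda>_. 0) (res y k0)" using JA(2)[OF y] Q(1)[OF xS] zy by metis
  have zS: "z w \<in> S" if "itrm_c_random w" "inc (res y k0) w" for w
  proof -
    have "itrm_comp Q (z w) 0 1"
      by (rule random_name[of JA "\<lambda>w e. itrm_comp Q (z w) 0 1", OF JA that k0])
    then show ?thesis using Q(2)[of "z w"] itrm_comp_unique by (metis zero_neq_one)
  qed
  \<comment> \<open>The condition splits: two of its extensions give opposite answers about the same
    number \<open>i\<close> in the computed real.\<close>
  define Sp where "Sp s \<longleftrightarrow> (\<exists>i t u. ext s t \<and> I i t \<and> ext s u \<and> No i u)" for s
  have Spc: "cp (\<lambda>w e. Sp (a w e))" if "cf a" for a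
  proof -
    have "cp (\<lambda>w e. Sp (e 0))" unfolding Sp_def No_def by (intro cfi Ic)
    then show ?thesis using cp_app[of "\<lambda>w e x. Sp x" a] that by simp
  qed
  define NN where "NN w \<longleftrightarrow> inc (res y k0) w \<and> (\<forall>k. k0 \<le> k \<longrightarrow> Sp (res w k))" for w
  have "meager {w. NN w}"
  proof -
    define NS where "NS s = {w. NN w \<and> itrm_c_random w \<and> z w = s}" for s
    have "nowhere_dense (NS s)" for s
    proof (rule nowhere_denseI)
      fix c
      show "\<exists>t. ext c t \<and> (\<forall>w. inc t w \<longrightarrow> w \<notin> NS s)"
      proof (cases "\<exists>w. inc c w \<and> NN w")
        case True
        then obtain w where w: "inc c w" "NN w" by blast
        define k where "k = max k0 (lenc c)"
        have ck: "ext c (res w k)" using inc_ext_res[OF w(1)] unfolding k_def by simp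
        have "Sp (res w k)" using w(2) unfolding NN_def k_def by simp
        then obtain i t u where itu: "ext (res w k) t" "I i t" "ext (res w k) u" "No i u" unfolding Sp_def by blast
        show ?thesis
        proof (cases "i \<in> s")
          case True
          then have "\<forall>w. inc u w \<longrightarrow> w \<notin> NS s" using No_inc[OF _ _ itu(4)] unfolding NS_def by blast
          then show ?thesis using ext_trans[OF ck itu(3)] by blast
        next
          case False
          then have "\<forall>w. inc t w \<longrightarrow> w \<notin> NS s" using I_inc[OF _ _ itu(2)] unfolding NS_def by blast
          then show ?thesis using ext_trans[OF ck itu(1)] by blast
        qed
      next
        case False
        then show ?thesis unfolding NS_def using ext_refl by blast
      qed
    qed
    then have "meager ({w. \<not> itrm_c_random w} \<union> (\<Union>s\<in>S. NS s))"
      by (intro meager_Un meager_non_random meager_countable_UN[OF S(1)] nowhere_dense_meager)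
    moreover have "{w. NN w} \<subseteq> {w. \<not> itrm_c_random w} \<union> (\<Union>s\<in>S. NS s)"
      using zS unfolding NS_def NN_def by blast
    ultimately show ?thesis by (rule meager_subset)
  qed
  moreover have "cp (\<lambda>w e. NN w)" unfolding NN_def by (intro cfi Spc)
  ultimately have "\<not> NN y" using random_avoid[OF y, of "\<lambda>w e. NN w"] by simp
  then obtain k where k: "\<not> Sp (res y k)" unfolding NN_def by auto
  \<comment> \<open>An extension that wrongly forced \<open>i\<close>, together with a longer
    initial segment of \<open>y\<close> forbidding \<open>i\<close>, would make
    \<open>res y k\<close> split.\<close>
  have x_iff: "i \<in> x \<longleftrightarrow> (\<exists>t. ext (res y k) t \<and> I i t)" for i
  proof
    assume "i \<in> x"
    then obtain j where "I i (res y j)" using It[OF y] zy by blast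
    then have "I i (res y (max j k))" by (rule Im[rotated]) simp
    moreover have "ext (res y k) (res y (max j k))" by simp
    ultimately show "\<exists>t. ext (res y k) t \<and> I i t" by blast
  next
    assume t: "\<exists>t. ext (res y k) t \<and> I i t"
    show "i \<in> x"
    proof (rule ccontr)
      assume "i \<notin> x"
      then obtain j where j: "No i (res y j)" using No_ex[OF y] zy by blast
      have "No i (res y (max j k))" unfolding No_def
      proof (intro allI impI)
        fix t assume "ext (res y (max j k)) t"
        then have "ext (res y j) t" using ext_trans[of "res y j" "res y (max j k)" t] by simp
        then show "\<not> I i t" using j unfolding No_def by blast
      qed
      moreover have "ext (res y k) (res y (max j k))" by simp
      ultimately have "Sp (res y k)" using t unfolding Sp_def by blast
      then show False using k by blast
    qed
  qed
  \<comment> \<open>The segment enters as a fixed number, so the answer does not depend on the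
    oracle and the empty oracle will do.\<close>
  define s where "s = res y k"
  have "cf (\<lambda>w e. if \<exists>t. ext s t \<and> I (e 0) t then 1 else 0)" by (intro cfi Ic)
  from cf_itrm_comp[OF this] obtain P' where
    "\<And>w i. itrm_comp P' w i (if \<exists>t. ext s t \<and> I i t then 1 else 0)" by auto
  then show ?thesis unfolding itrm_computable_def itrm_reducible_def x_iff s_def by blast
qed

theorem mainTheorem10:
  shows "(\<forall>y. itrm_c_random y \<longrightarrow>
            (\<exists>x. itrm_reducible x y \<and> \<not> itrm_c_random x \<and> \<not> itrm_computable x)) \<and>
         (\<forall>x y S. itrm_c_random y \<and> itrm_reducible x y \<and> x \<in> S \<and> countable S \<and>
            itrm_decidable S \<longrightarrow> itrm_computable x)"
  using random_part1 random_part2 by blast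

end
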